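(* Let $\Gamma\subset\partial D$ be a regular piece of the boundary of the scatterer $D$, and suppose that the mean curvature of $\Gamma$ satisfies $$H(x)=0\quad\text{for } x\in\Gamma .$$ Let $U=(U_j)_{j=1}^3$ be a solution to the elastic scattering system for $D$ and the incident plane wave $U^{in}$ (as described in the context). Then $U$ satisfies the fourth kind boundary condition on $\Gamma$, $$\nu\wedge U=0\quad\text{and}\quad \nu\cdot TU=0\qquad\text{on }\Gamma,$$ if and only if $$\nabla\cdot U=0\quad\text{and}\quad \nu\wedge\big(\nabla\wedge(\nabla\wedge U)\big)=0\qquad\text{on }\Gamma .$$
   Context: Constants: $\lambda,\mu\in\mathbb{R}$ with $\mu>0$ and $3\lambda+2\mu>0$; $\omega>0$; $k_s=\omega/\sqrt{\mu}$, $k_p=\omega/\sqrt{\lambda+2\mu}$. The symbol $\wedge$ denotes the cross product, so $\nabla\wedge$ is the curl. Scatterer: $D\subset\mathbb{R}^3$ is a bounded domain with Lipschitz, piecewise $C^{2,1}$-smooth boundary and connected complement $\mathbb{R}^3\setminus\overline{D}$. $\nu$ is the outward unit normal to $\partial D$. A regular piece $\Gamma$ of $\partial D$ is a $C^{2,1}$-smooth piece of the surface $\partial D$. $H=\frac12(\kappa_1+\kappa_2)$ is the mean curvature, where $\kappa_1,\kappa_2$ are the principal curvatures. Traction operator: $TU:=2\mu\,\partial_\nu U+\lambda\,\nu\,(\nabla\cdot U)+\mu\,\nu\wedge(\nabla\wedge U)$, with $\partial_\nu U:=[\nu\cdot\nabla U_j]_{j=1}^3$. Elastic scattering system: $U$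 is complex vector-valued on $\mathbb{R}^3\setminus\overline D$ (locally $H^1$ up to the boundary) with $$(\Delta^*+\omega^2)U=0 \text{ in }\mathbb{R}^3\setminus\overline{D},\qquad \Delta^*U:=\mu\Delta U+(\lambda+\mu)\nabla(\nabla\cdot U),$$ $U=U^{in}+U^{sc}$, where $U^{in}(x)=\alpha_p d\,e^{ik_pd\cdot x}+\alpha_s d^\perp e^{ik_sd\cdot x}$ with $d,d^\perp\in\mathbb{S}^2$, $d\cdot d^\perp=0$, $\alpha_p,\alpha_s\in\mathbb{C}$, and $U^{sc}$ satisfies the Kupradze radiation condition $$(\nabla\wedge\nabla\wedge U^{sc})\wedge\tfrac{x}{\|x\|}-ik_s\nabla\wedge U^{sc}=\mathcal{O}(\|x\|^{-2}),\qquad \tfrac{x}{\|x\|}\cdot\nabla(\nabla\cdot U^{sc})-ik_p\nabla\cdot U^{sc}=\mathcal{O}(\|x\|^{-2})$$ as $\|x\|\to\infty$, uniformly in all directions. Solutions are locally $H^3$ near regular pieces of $\partial D$ (standing regularity), so that the boundary expressions make sense. *)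

theory Defs
  imports "HOL-Analysis.Analysis" "HOL-Library.Landau_Symbols"
begin

section \<open>Differentiability classes\<close>

text \<open>The set \<open>S\<close> is meant to be open, so that \<^const>\<open>frechet_derivative\<close> at its points is unique.\<close>

definition dir_deriv :: "'a::euclidean_space \<Rightarrow> ('a \<Rightarrow> 'b::real_normed_vector) \<Rightarrow> 'a \<Rightarrow> 'b" where
  "dir_deriv b f x = frechet_derivative f (at x) b"

primrec Ck_on :: "nat \<Rightarrow> 'a::euclidean_space set \<Rightarrow> ('a \<Rightarrow> 'b::real_normed_vector) \<Rightarrow> bool" where
  "Ck_on 0 S f \<longleftrightarrow> continuous_on S f"
| "Ck_on (Suc k) S f \<longleftrightarrow> f differentiable_on S \<and> (\<forall>b\<in>Basis. Ck_on k S (dir_deriv b f))"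

definition smooth_on :: "'a::euclidean_space set \<Rightarrow> ('a \<Rightarrow> 'b::real_normed_vector) \<Rightarrow> bool" where
  "smooth_on S f \<longleftrightarrow> (\<forall>k. Ck_on k S f)"

text \<open>\<open>Ck1_on k S f\<close>: class \<open>C\<close> with exponents \<open>k,1\<close>, i.e. the partial derivatives of order \<open>k\<close>
  are Lipschitz on \<open>S\<close>.\<close>

primrec Ck1_on :: "nat \<Rightarrow> 'a::euclidean_space set \<Rightarrow> ('a \<Rightarrow> 'b::real_normed_vector) \<Rightarrow> bool" where
  "Ck1_on 0 S f \<longleftrightarrow> (\<exists>L. L-lipschitz_on S f)"
| "Ck1_on (Suc k) S f \<longleftrightarrow> f differentiable_on S \<and> (\<forall>b\<in>Basis. Ck1_on k S (dir_deriv b f))"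


section \<open>Sobolev spaces on open subsets of three-space\<close>

definition L2_on :: "(real^3) set \<Rightarrow> (real^3 \<Rightarrow> 'b::euclidean_space) \<Rightarrow> bool" where
  "L2_on S f \<longleftrightarrow> f \<in> borel_measurable (lebesgue_on S) \<and>
     integrable (lebesgue_on S) (\<lambda>x. (norm (f x))\<^sup>2)"

text \<open>Continuously differentiable test functions with compact support in \<open>S\<close>; they define the
  same weak derivatives as the infinitely differentiable ones.\<close>

definition test_fun :: "(real^3) set \<Rightarrow> (real^3 \<Rightarrow> real) \<Rightarrow> bool" where
  "test_fun S \<eta> \<longleftrightarrow> Ck_on 1 UNIV \<eta> \<and> (\<exists>K. compact K \<and> K \<subseteq> S \<and> (\<forall>x. x \<notin> K \<longrightarrow> \<eta> x = 0))"

definition weak_deriv ::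
  "(real^3) set \<Rightarrow> real^3 \<Rightarrow> (real^3 \<Rightarrow> 'b::euclidean_space) \<Rightarrow> (real^3 \<Rightarrow> 'b) \<Rightarrow> bool" where
  "weak_deriv S b f g \<longleftrightarrow> (\<forall>\<eta>. test_fun S \<eta> \<longrightarrow>
     (\<integral>x. dir_deriv b \<eta> x *\<^sub>R f x \<partial>lebesgue_on S) = - (\<integral>x. \<eta> x *\<^sub>R g x \<partial>lebesgue_on S))"

primrec Hk_on :: "nat \<Rightarrow> (real^3) set \<Rightarrow> (real^3 \<Rightarrow> 'b::euclidean_space) \<Rightarrow> bool" where
  "Hk_on 0 S f \<longleftrightarrow> L2_on S f"
| "Hk_on (Suc k) S f \<longleftrightarrow> L2_on S f \<and> (\<forall>b\<in>Basis. \<exists>g. Hk_on k S g \<and> weak_deriv S b f g)"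

definition H1_tendsto ::
  "(real^3) set \<Rightarrow> (nat \<Rightarrow> real^3 \<Rightarrow> 'b::euclidean_space) \<Rightarrow> (real^3 \<Rightarrow> 'b) \<Rightarrow> bool" where
  "H1_tendsto S F f \<longleftrightarrow> L2_on S f \<and>
     (\<lambda>n. \<integral>\<^sup>+x. ennreal ((norm (F n x - f x))\<^sup>2) \<partial>lebesgue_on S) \<longlonglongrightarrow> 0 \<and>
     (\<forall>b\<in>Basis. \<exists>g. L2_on S g \<and> weak_deriv S b f g \<and>
        (\<lambda>n. \<integral>\<^sup>+x. ennreal ((norm (dir_deriv b (F n) x - g x))\<^sup>2) \<partial>lebesgue_on S) \<longlonglongrightarrow> 0)"


section \<open>The scatterer and its boundary\<close>

text \<open>In the cylinder of radius \<open>r\<close> and half-height \<open>s\<close> around \<open>p\<close>, placed by the linear isometry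
  \<open>\<phi>\<close>, the set \<open>D\<close> is the part strictly below the graph of \<open>h\<close>.\<close>

definition graph_chart ::
  "(real^3) set \<Rightarrow> real^3 \<Rightarrow> ((real^2) \<times> real \<Rightarrow> real^3) \<Rightarrow> real \<Rightarrow> real \<Rightarrow> (real^2 \<Rightarrow> real) \<Rightarrow> bool" where
  "graph_chart D p \<phi> r s h \<longleftrightarrow>
     linear \<phi> \<and> (\<forall>z. norm (\<phi> z) = norm z) \<and> 0 < r \<and> 0 < s \<and> h 0 = 0 \<and>
     (\<forall>y\<in>ball 0 r. \<bar>h y\<bar> < s) \<and>
     (\<forall>y\<in>ball 0 r. \<forall>t\<in>{-s<..<s}. p + \<phi> (y, t) \<in> D \<longleftrightarrow> t < h y)"

definition graph_point ::
  "real^3 \<Rightarrow> ((real^2) \<times> real \<Rightarrow> real^3) \<Rightarrow> (real^2 \<Rightarrow> real) \<Rightarrow> real^2 \<Rightarrow> real^3" where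
  "graph_point p \<phi> h y = p + \<phi> (y, h y)"

definition above_graph ::
  "real^3 \<Rightarrow> ((real^2) \<times> real \<Rightarrow> real^3) \<Rightarrow> real \<Rightarrow> real \<Rightarrow> (real^2 \<Rightarrow> real) \<Rightarrow> (real^3) set" where
  "above_graph p \<phi> r s h = {p + \<phi> (y, t) | y t. y \<in> ball 0 r \<and> h y < t \<and> t < s}"

definition area_element :: "(real^2 \<Rightarrow> real) \<Rightarrow> real^2 \<Rightarrow> real" where
  "area_element h y = sqrt (1 + (\<Sum>b\<in>Basis. (dir_deriv b h y)\<^sup>2))"

definition lipschitz_boundary :: "(real^3) set \<Rightarrow> bool" where
  "lipschitz_boundary D \<longleftrightarrow>
     (\<forall>p\<in>frontier D. \<exists>\<phi> r s h L. graph_chart D p \<phi> r s h \<and> L-lipschitz_on (ball 0 r) h)"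

definition regular_piece :: "(real^3) set \<Rightarrow> (real^3) set \<Rightarrow> bool" where
  "regular_piece D \<Gamma> \<longleftrightarrow>
     openin (top_of_set (frontier D)) \<Gamma> \<and>
     (\<forall>p\<in>\<Gamma>. \<exists>\<phi> r s h. graph_chart D p \<phi> r s h \<and> Ck1_on 2 (ball 0 r) h)"

definition piecewise_C21_boundary :: "(real^3) set \<Rightarrow> bool" where
  "piecewise_C21_boundary D \<longleftrightarrow>
     (\<exists>\<G>. finite \<G> \<and> (\<forall>\<Gamma>\<in>\<G>. regular_piece D \<Gamma>) \<and> disjoint \<G> \<and>
          frontier D = (\<Union>\<Gamma>\<in>\<G>. closure \<Gamma>))"

definition scatterer :: "(real^3) set \<Rightarrow> bool" where
  "scatterer D \<longleftrightarrow> open D \<and> connected D \<and> D \<noteq> {} \<and> bounded D \<and>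
     lipschitz_boundary D \<and> piecewise_C21_boundary D \<and> connected (- closure D)"

text \<open>A unit vector orthogonal to the boundary surface at \<open>x\<close> and pointing out of \<open>D\<close>.\<close>

definition outward_unit_normal :: "(real^3) set \<Rightarrow> real^3 \<Rightarrow> real^3 \<Rightarrow> bool" where
  "outward_unit_normal D x n \<longleftrightarrow> norm n = 1 \<and>
     ((\<lambda>z. ((z - x) \<bullet> n) / norm (z - x)) \<longlongrightarrow> 0) (at x within frontier D) \<and>
     (\<forall>\<^sub>F t in at_right 0. x + t *\<^sub>R n \<notin> closure D \<and> x - t *\<^sub>R n \<in> D)"

text \<open>The principal curvatures are the eigenvalues of the differential of the normal field along
  the surface, on an orthonormal basis of the tangent plane.  The values of \<open>L\<close> on the tangent
  plane are determined by the derivative within \<open>\<Gamma>\<close>.\<close>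

definition principal_curvatures ::
  "(real^3) set \<Rightarrow> (real^3 \<Rightarrow> real^3) \<Rightarrow> real^3 \<Rightarrow> real \<Rightarrow> real \<Rightarrow> bool" where
  "principal_curvatures \<Gamma> \<nu> x \<kappa>1 \<kappa>2 \<longleftrightarrow>
     (\<exists>L e1 e2. (\<nu> has_derivative L) (at x within \<Gamma>) \<and>
        norm e1 = 1 \<and> norm e2 = 1 \<and> e1 \<bullet> e2 = 0 \<and> e1 \<bullet> \<nu> x = 0 \<and> e2 \<bullet> \<nu> x = 0 \<and>
        L e1 = \<kappa>1 *\<^sub>R e1 \<and> L e2 = \<kappa>2 *\<^sub>R e2)"

definition has_mean_curvature ::
  "(real^3) set \<Rightarrow> (real^3 \<Rightarrow> real^3) \<Rightarrow> real^3 \<Rightarrow> real \<Rightarrow> bool" where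
  "has_mean_curvature \<Gamma> \<nu> x H \<longleftrightarrow>
     (\<exists>\<kappa>1 \<kappa>2. principal_curvatures \<Gamma> \<nu> x \<kappa>1 \<kappa>2 \<and> H = (\<kappa>1 + \<kappa>2) / 2)"


section \<open>Traces\<close>

text \<open>Trace from above on the graph of \<open>h\<close>, written in the parameter \<open>y\<close>: the extension of the
  restriction map by continuity, from functions that are continuously differentiable up to the
  boundary, with respect to the \<open>H\<close>-one norm above the graph and the square-integral norm for
  surface measure on the graph.\<close>

definition has_graph_trace ::
  "real^3 \<Rightarrow> ((real^2) \<times> real \<Rightarrow> real^3) \<Rightarrow> real \<Rightarrow> real \<Rightarrow> (real^2 \<Rightarrow> real) \<Rightarrow>
   (real^3 \<Rightarrow> 'b::euclidean_space) \<Rightarrow> (real^2 \<Rightarrow> 'b) \<Rightarrow> bool" where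
  "has_graph_trace p \<phi> r s h f g \<longleftrightarrow>
     g \<in> borel_measurable (lebesgue_on (ball 0 r)) \<and>
     (\<exists>F. (\<forall>n. \<exists>V. open V \<and> closure (above_graph p \<phi> r s h) \<subseteq> V \<and> Ck_on 1 V (F n)) \<and>
          H1_tendsto (above_graph p \<phi> r s h) F f \<and>
          (\<lambda>n. \<integral>\<^sup>+y. ennreal ((norm (F n (graph_point p \<phi> h y) - g y))\<^sup>2 * area_element h y)
             \<partial>lebesgue_on (ball 0 r)) \<longlonglongrightarrow> 0)"

text \<open>\<open>f\<close> has locally on \<open>\<Gamma>\<close> an exterior trace, whose value at \<open>x\<close> satisfies \<open>P x\<close> for almost
  every \<open>x\<close> in \<open>\<Gamma>\<close>.  Null sets of \<open>\<Gamma>\<close> are those whose preimages in graph parameters are null.\<close>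

definition trace_satisfies ::
  "(real^3) set \<Rightarrow> (real^3) set \<Rightarrow> (real^3 \<Rightarrow> 'b::euclidean_space) \<Rightarrow> (real^3 \<Rightarrow> 'b \<Rightarrow> bool) \<Rightarrow> bool" where
  "trace_satisfies D \<Gamma> f P \<longleftrightarrow>
     (\<forall>p\<in>\<Gamma>. \<exists>\<phi> r s h g. graph_chart D p \<phi> r s h \<and> Ck1_on 2 (ball 0 r) h \<and>
        graph_point p \<phi> h ` ball 0 r \<subseteq> \<Gamma> \<and> has_graph_trace p \<phi> r s h f g \<and>
        (AE y in lebesgue_on (ball 0 r). P (graph_point p \<phi> h y) (g y)))"


section \<open>Complex vector fields\<close>

definition cvec :: "real^3 \<Rightarrow> complex^3" where
  "cvec v = (\<chi> i. complex_of_real (v $ i))"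

text \<open>Bilinear (no conjugation).\<close>

definition cdot :: "complex^3 \<Rightarrow> complex^3 \<Rightarrow> complex" where
  "cdot a b = (\<Sum>i\<in>UNIV. a $ i * b $ i)"

definition ccross :: "complex^3 \<Rightarrow> complex^3 \<Rightarrow> complex^3" where
  "ccross a b = vector [a$2 * b$3 - a$3 * b$2, a$3 * b$1 - a$1 * b$3, a$1 * b$2 - a$2 * b$1]"

definition pd :: "3 \<Rightarrow> (real^3 \<Rightarrow> 'b::real_normed_vector) \<Rightarrow> real^3 \<Rightarrow> 'b" where
  "pd i f = dir_deriv (axis i 1) f"

definition gradient :: "(real^3 \<Rightarrow> complex) \<Rightarrow> real^3 \<Rightarrow> complex^3" where
  "gradient f x = (\<chi> i. pd i f x)"

text \<open>Row \<open>j\<close> is the gradient of the \<open>j\<close>-th component.\<close>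

definition jacobian :: "(real^3 \<Rightarrow> complex^3) \<Rightarrow> real^3 \<Rightarrow> complex^3^3" where
  "jacobian U x = (\<chi> j i. pd i U x $ j)"

definition curl_of_jacobian :: "complex^3^3 \<Rightarrow> complex^3" where
  "curl_of_jacobian J = vector [J$3$2 - J$2$3, J$1$3 - J$3$1, J$2$1 - J$1$2]"

definition divergence :: "(real^3 \<Rightarrow> complex^3) \<Rightarrow> real^3 \<Rightarrow> complex" where
  "divergence U x = trace (jacobian U x)"

definition curl :: "(real^3 \<Rightarrow> complex^3) \<Rightarrow> real^3 \<Rightarrow> complex^3" where
  "curl U x = curl_of_jacobian (jacobian U x)"

definition laplacian :: "(real^3 \<Rightarrow> complex^3) \<Rightarrow> real^3 \<Rightarrow> complex^3" where
  "laplacian U x = (\<Sum>i\<in>UNIV. pd i (pd i U) x)"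

definition lame_operator :: "real \<Rightarrow> real \<Rightarrow> (real^3 \<Rightarrow> complex^3) \<Rightarrow> real^3 \<Rightarrow> complex^3" where
  "lame_operator lam \<mu> U x = \<mu> *\<^sub>R laplacian U x + (lam + \<mu>) *\<^sub>R gradient (divergence U) x"

text \<open>The traction \<open>TU\<close> at a boundary point with unit normal \<open>n\<close>, as a function of the Jacobian
  \<open>J\<close> of \<open>U\<close> there; \<open>J *v cvec n\<close> is the normal derivative of \<open>U\<close>.\<close>

definition traction :: "real \<Rightarrow> real \<Rightarrow> real^3 \<Rightarrow> complex^3^3 \<Rightarrow> complex^3" where
  "traction lam \<mu> n J =
     (2 * \<mu>) *\<^sub>R (J *v cvec n) + lam *\<^sub>R (trace J *s cvec n) + \<mu> *\<^sub>R ccross (cvec n) (curl_of_jacobian J)"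


section \<open>The elastic scattering system\<close>

definition k_shear :: "real \<Rightarrow> real \<Rightarrow> real" where
  "k_shear \<mu> \<omega> = \<omega> / sqrt \<mu>"

definition k_pressure :: "real \<Rightarrow> real \<Rightarrow> real \<Rightarrow> real" where
  "k_pressure lam \<mu> \<omega> = \<omega> / sqrt (lam + 2 * \<mu>)"

definition incident_wave ::
  "real \<Rightarrow> real \<Rightarrow> real \<Rightarrow> complex \<Rightarrow> complex \<Rightarrow> real^3 \<Rightarrow> real^3 \<Rightarrow> real^3 \<Rightarrow> complex^3" where
  "incident_wave lam \<mu> \<omega> \<alpha>p \<alpha>s d d' x =
     (\<alpha>p * exp (\<i> * complex_of_real (k_pressure lam \<mu> \<omega> * (d \<bullet> x)))) *s cvec d +
     (\<alpha>s * exp (\<i> * complex_of_real (k_shear \<mu> \<omega> * (d \<bullet> x)))) *s cvec d'"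

definition kupradze_radiating :: "real \<Rightarrow> real \<Rightarrow> real \<Rightarrow> (real^3 \<Rightarrow> complex^3) \<Rightarrow> bool" where
  "kupradze_radiating lam \<mu> \<omega> V \<longleftrightarrow>
     (\<lambda>x. norm (ccross (curl (curl V) x) (cvec (x /\<^sub>R norm x)) -
                (\<i> * complex_of_real (k_shear \<mu> \<omega>)) *s curl V x))
        \<in> O[at_infinity](\<lambda>x. 1 / (norm x)\<^sup>2) \<and>
     (\<lambda>x. norm (cdot (cvec (x /\<^sub>R norm x)) (gradient (divergence V) x) -
                \<i> * complex_of_real (k_pressure lam \<mu> \<omega>) * divergence V x))
        \<in> O[at_infinity](\<lambda>x. 1 / (norm x)\<^sup>2)"

text \<open>By interior elliptic regularity a locally \<open>H\<close>-one solution has a smooth representative in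
  the open exterior; \<open>U\<close> denotes this representative, for which the equation and the radiation
  condition are pointwise statements.  Only the values of \<open>U\<close> outside the closure of \<open>D\<close> matter.\<close>

definition scattering_solution ::
  "real \<Rightarrow> real \<Rightarrow> real \<Rightarrow> (real^3) set \<Rightarrow> (real^3 \<Rightarrow> complex^3) \<Rightarrow> (real^3 \<Rightarrow> complex^3) \<Rightarrow> bool" where
  "scattering_solution lam \<mu> \<omega> D Uin U \<longleftrightarrow>
     smooth_on (- closure D) U \<and>
     (\<forall>R>0. Hk_on 1 (ball 0 R - closure D) U) \<and>
     (\<forall>x. x \<notin> closure D \<longrightarrow> lame_operator lam \<mu> U x + (\<omega>\<^sup>2) *\<^sub>R U x = 0) \<and>
     kupradze_radiating lam \<mu> \<omega> (\<lambda>x. U x - Uin x)"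

definition locally_H3_near :: "(real^3) set \<Rightarrow> (real^3) set \<Rightarrow> (real^3 \<Rightarrow> complex^3) \<Rightarrow> bool" where
  "locally_H3_near D \<Gamma> U \<longleftrightarrow> (\<forall>p\<in>\<Gamma>. \<exists>\<rho>>0. Hk_on 3 (ball p \<rho> - closure D) U)"

text \<open>The pair of \<open>U\<close> and its Jacobian is traced jointly; its exterior trace is \<open>(u, J)\<close>.\<close>

definition fourth_kind_condition ::
  "real \<Rightarrow> real \<Rightarrow> (real^3) set \<Rightarrow> (real^3) set \<Rightarrow> (real^3 \<Rightarrow> real^3) \<Rightarrow> (real^3 \<Rightarrow> complex^3) \<Rightarrow> bool" where
  "fourth_kind_condition lam \<mu> D \<Gamma> \<nu> U \<longleftrightarrow>
     trace_satisfies D \<Gamma> (\<lambda>x. (U x, jacobian U x))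
       (\<lambda>x (u, J). ccross (cvec (\<nu> x)) u = 0 \<and> cdot (cvec (\<nu> x)) (traction lam \<mu> (\<nu> x) J) = 0)"

end

theory Submission
  imports Defs
begin

text \<open>Write \<open>T\<close> for a tangent vector of the graph of \<open>h\<close> and \<open>U\<close>, \<open>J\<close> for the traces of the
  field and its Jacobian.  If \<open>\<nu> \<and> U = 0\<close> on \<open>\<Gamma>\<close>, then \<open>T\<^sub>a \<cdot> U = 0\<close>, and differentiating along
  the surface gives \<open>T\<^sub>a \<cdot> J T\<^sub>b = - (\<partial>\<^sub>a \<partial>\<^sub>b h) e \<cdot> U\<close> with \<open>e\<close> the vertical direction.  The shape
  operator satisfies the same identity with \<open>\<nu>\<close> in place of \<open>U\<close>, so the tangential part of \<open>J\<close> is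
  a multiple of it and its trace is a multiple of \<open>H = 0\<close>.  Hence \<open>\<nabla>\<cdot>U = \<nu> \<cdot> J \<nu>\<close> and
  \<open>\<nu> \<cdot> TU = (\<lambda> + 2\<mu>) \<nabla>\<cdot>U\<close>.  On the other hand the equation reads
  \<open>(\<lambda> + 2\<mu>) \<nabla>(\<nabla>\<cdot>U) - \<mu> \<nabla> \<and> (\<nabla> \<and> U) = - \<omega>\<^sup>2 U\<close>, and \<open>\<nabla>\<cdot>U = 0\<close> on \<open>\<Gamma>\<close> removes the tangential
  part of the first term, so that then \<open>\<nu> \<and> U\<close> and \<open>\<nu> \<and> (\<nabla> \<and> (\<nabla> \<and> U))\<close> vanish together.

  For a function \<open>f\<close> that is continuously differentiable above the graph with square integrable
  gradient, \<open>f(y, h y + \<tau>)\<close> converges for almost every \<open>y\<close> as \<open>\<tau> \<rightarrow> 0\<close>, at the rate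
  \<open>\<bar>f(y, h y + \<tau>) - f(y, h y)\<bar>\<^sup>2 \<le> \<tau> \<integral>\<bar>\<partial>\<^sub>e f(y, h y + t)\<bar>\<^sup>2 dt\<close>.  The limit is the trace, and the
  vertical translates of \<open>f\<close> approximate \<open>f\<close> as the definition of a trace requires.\<close>

section \<open>Calculus of continuously differentiable functions\<close>

text \<open>The obstacle is that \<open>trace_satisfies\<close> chooses the chart, the approximating
  sequence and the trace existentially, and that a trace is merely square integrable, so it can be
  neither evaluated nor differentiated at points. Both difficulties disappear once every trace is
  identified with one concrete function, the limit of the values on the levels
  \<open>lift y (heights n)\<close>. On each level the field is C1 and can be differentiated along
  the tangents; the derivatives are carried to the limit by testing against bump functions under an
  integrable majorant. Everything takes place in a shrunken chart (\<open>r'\<close>,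
  \<open>\<sigma>\<close>): translates need room above the graph, and compactness of the closed ball
  of radius \<open>r'\<close> bounds the coefficients. The coefficients that are differentiated are
  the tangents of the graph, which are C1, whereas \<open>\<nu>\<close> only has a derivative within
  \<open>\<Gamma>\<close> at each point. The H3 hypothesis speaks of weak derivatives. As
  \<open>U\<close> is smooth in the exterior, they agree almost everywhere with the classical ones,
  so that derivatives of \<open>U\<close> up to order two have traces.\<close>

lemma dir_deriv_eqI:
  assumes "(f has_derivative f') (at x)"
  shows "dir_deriv b f x = f' b"
  unfolding dir_deriv_def using frechet_derivative_at[OF assms] by simp

lemma differentiable_on_open_has_derivative:
  assumes "f differentiable_on S" "open S" "x \<in> S"
  shows "(f has_derivative (\<lambda>b. dir_deriv b f x)) (at x)"
proof -
  have "f differentiable (at x)"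
    using assms by (metis at_within_open differentiable_on_def)
  then show ?thesis unfolding dir_deriv_def
    using frechet_derivative_works by blast
qed

text \<open>Holds without differentiability: \<open>frechet_derivative\<close> chooses from the set
  of derivatives at the point, and that set is the same for both functions. So identities valid only
  on an open set can be differentiated.\<close>

lemma dir_deriv_cong:
  assumes "open S" "x \<in> S" "\<And>y. y \<in> S \<Longrightarrow> f y = g y"
  shows "dir_deriv b f x = dir_deriv b g x"
proof -
  have "(f has_derivative f') (at x) \<longleftrightarrow> (g has_derivative f') (at x)" for f'
    using assms has_derivative_transform_within_open by metis
  then show ?thesis unfolding dir_deriv_def frechet_derivative_def by simp
qed

lemma Ck_on_cong:
  assumes "open S" "\<And>y. y \<in> S \<Longrightarrow> f y = g y"
  shows "Ck_on k S f \<longleftrightarrow> Ck_on k S g"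
  using assms(2)
proof (induction k arbitrary: f g)
  case 0
  then show ?case by (simp cong: continuous_on_cong)
next
  case (Suc k)
  have "f differentiable_on S \<longleftrightarrow> g differentiable_on S"
    unfolding differentiable_on_def differentiable_def using Suc.prems
    by (metis has_derivative_transform)
  moreover have "Ck_on k S (dir_deriv b f) \<longleftrightarrow> Ck_on k S (dir_deriv b g)" for b
    using Suc.prems dir_deriv_cong[OF assms(1)] by (intro Suc.IH) blast
  ultimately show ?case by simp
qed

lemma Ck_on_transform:
  assumes "open S" "Ck_on k S g" "\<And>y. y \<in> S \<Longrightarrow> f y = g y"
  shows "Ck_on k S f"
  using Ck_on_cong[OF assms(1,3)] assms(2) by simp

lemma Ck_on_SucD: "Ck_on (Suc k) S f \<Longrightarrow> Ck_on k S f"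
proof (induction k arbitrary: f)
  case 0
  then show ?case by (simp add: differentiable_imp_continuous_on)
next
  case (Suc k)
  then show ?case by (metis Ck_on.simps(2))
qed

lemma Ck_on_mono: "Ck_on k S f \<Longrightarrow> j \<le> k \<Longrightarrow> Ck_on j S f"
  by (induction k) (metis le_zero_eq, metis Ck_on_SucD le_Suc_eq)

lemma Ck_on_imp_continuous_on: "Ck_on k S f \<Longrightarrow> continuous_on S f"
  by (induction k) (auto simp: differentiable_imp_continuous_on)

lemma Ck_on_subset: "Ck_on k S f \<Longrightarrow> T \<subseteq> S \<Longrightarrow> Ck_on k T f"
proof (induction k arbitrary: f)
  case 0
  then show ?case using continuous_on_subset by auto
next
  case (Suc k)
  then show ?case using differentiable_on_subset by auto
qed

lemma dir_deriv_linear_comp: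
  assumes "bounded_linear L" "f differentiable_on S" "open S" "x \<in> S"
  shows "dir_deriv b (\<lambda>x. L (f x)) x = L (dir_deriv b f x)"
  by (rule dir_deriv_eqI)
    (intro bounded_linear.has_derivative[OF assms(1)]
      differentiable_on_open_has_derivative[OF assms(2-4)])

lemma differentiable_on_linear_comp:
  assumes "bounded_linear L" "f differentiable_on S"
  shows "(\<lambda>x. L (f x)) differentiable_on S"
  using assms unfolding differentiable_on_def differentiable_def
  by (metis bounded_linear.has_derivative)

lemma Ck_on_linear_comp:
  assumes "bounded_linear L" "open S" "Ck_on k S f"
  shows "Ck_on k S (\<lambda>x. L (f x))"
  using assms(3)
proof (induction k arbitrary: f)
  case 0
  then show ?case
    using assms(1) by (simp add: bounded_linear.continuous_on)
next
  case (Suc k)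
  have "Ck_on k S (dir_deriv b (\<lambda>x. L (f x)))" if "b \<in> Basis" for b
  proof -
    have "Ck_on k S (\<lambda>x. L (dir_deriv b f x))"
      using Suc that by auto
    moreover have "dir_deriv b (\<lambda>x. L (f x)) x = L (dir_deriv b f x)" if "x \<in> S" for x
      using Suc.prems that by (intro dir_deriv_linear_comp[OF assms(1) _ assms(2)]) auto
    ultimately show ?thesis by (rule Ck_on_transform[OF assms(2)])
  qed
  then show ?case using Suc assms(1) by (simp add: differentiable_on_linear_comp)
qed

lemma dir_deriv_add:
  assumes "f differentiable_on S" "g differentiable_on S" "open S" "x \<in> S"
  shows "dir_deriv b (\<lambda>x. f x + g x) x = dir_deriv b f x + dir_deriv b g x"
  by (rule dir_deriv_eqI)
    (intro has_derivative_add differentiable_on_open_has_derivative[of _ S] assms)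

lemma Ck_on_add:
  assumes "open S" "Ck_on k S f" "Ck_on k S g"
  shows "Ck_on k S (\<lambda>x. f x + g x)"
  using assms(2,3)
proof (induction k arbitrary: f g)
  case 0
  then show ?case by (simp add: continuous_on_add)
next
  case (Suc k)
  have "Ck_on k S (dir_deriv b (\<lambda>x. f x + g x))" if "b \<in> Basis" for b
  proof -
    have "Ck_on k S (\<lambda>x. dir_deriv b f x + dir_deriv b g x)"
      using Suc that by auto
    moreover have "dir_deriv b (\<lambda>x. f x + g x) x = dir_deriv b f x + dir_deriv b g x"
      if "x \<in> S" for x
      using Suc.prems that by (intro dir_deriv_add[OF _ _ assms(1)]) auto
    ultimately show ?thesis by (rule Ck_on_transform[OF assms(1)])
  qed
  then show ?case using Suc by simp
qed

text \<open>Lets a derivative be exhibited by a formula instead of being computed as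
  \<open>dir_deriv\<close>; the C1 proofs for products, compositions, zero extensions and
  restrictions to levels go through it.\<close>

lemma Ck_on_1_iff:
  assumes "open S"
  shows "Ck_on 1 S f \<longleftrightarrow> (\<exists>f'. (\<forall>x\<in>S. (f has_derivative f' x) (at x)) \<and>
    (\<forall>b\<in>Basis. continuous_on S (\<lambda>x. f' x b)))"
proof
  assume "Ck_on 1 S f"
  then show "\<exists>f'. (\<forall>x\<in>S. (f has_derivative f' x) (at x)) \<and> (\<forall>b\<in>Basis. continuous_on S (\<lambda>x. f' x b))"
    using differentiable_on_open_has_derivative[OF _ assms]
    by (intro exI[of _ "\<lambda>x b. dir_deriv b f x"]) (auto simp: eta_contract_eq)
next
  assume "\<exists>f'. (\<forall>x\<in>S. (f has_derivative f' x) (at x)) \<and> (\<forall>b\<in>Basis. continuous_on S (\<lambda>x. f' x b))"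
  then obtain f' where f': "\<And>x. x \<in> S \<Longrightarrow> (f has_derivative f' x) (at x)"
    "\<And>b. b \<in> Basis \<Longrightarrow> continuous_on S (\<lambda>x. f' x b)" by blast
  have "f differentiable_on S"
    using f'(1) unfolding differentiable_on_def differentiable_def
    by (metis has_derivative_at_withinI)
  moreover have "continuous_on S (dir_deriv b f)" if "b \<in> Basis" for b
    using f'(2)[OF that] dir_deriv_eqI[OF f'(1)] by (simp cong: continuous_on_cong)
  ultimately show "Ck_on 1 S f" by simp
qed

lemma Ck_on_1_has_derivative:
  assumes "open S" "Ck_on 1 S f" "x \<in> S"
  shows "(f has_derivative (\<lambda>b. dir_deriv b f x)) (at x)"
  using assms by (intro differentiable_on_open_has_derivative[OF _ assms(1,3)]) simp

text \<open>Smoothness and Sobolev hypotheses control basis directions only; this identity passes to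
  the directions that occur in a chart, namely the vertical direction and the tangents of the
  graph.\<close>

lemma dir_deriv_eq_sum_Basis:
  assumes "open S" "Ck_on 1 S f" "x \<in> S"
  shows "dir_deriv v f x = (\<Sum>b\<in>Basis. (v \<bullet> b) *\<^sub>R dir_deriv b f x)"
proof -
  have "linear (\<lambda>b. dir_deriv b f x)"
    by (rule has_derivative_linear[OF Ck_on_1_has_derivative[OF assms]])
  from linear_sum[OF this, of "\<lambda>b. (v \<bullet> b) *\<^sub>R b" Basis] show ?thesis
    by (simp add: euclidean_representation linear_cmul[OF \<open>linear _\<close>])
qed

lemma continuous_on_dir_deriv:
  assumes "open S" "Ck_on 1 S f"
  shows "continuous_on S (dir_deriv v f)"
proof -
  have "continuous_on S (\<lambda>x. \<Sum>b\<in>Basis. (v \<bullet> b) *\<^sub>R dir_deriv b f x)"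
    using assms(2) by (intro continuous_intros) auto
  then show ?thesis
    by (subst continuous_on_cong[OF refl dir_deriv_eq_sum_Basis[OF assms]])
qed

lemma Ck_on_1_scaleR:
  assumes "open S" "Ck_on 1 S c" "Ck_on 1 S f"
  shows "Ck_on 1 S (\<lambda>x. c x *\<^sub>R f x)"
  unfolding Ck_on_1_iff[OF assms(1)]
proof (intro exI conjI ballI)
  show "((\<lambda>x. c x *\<^sub>R f x) has_derivative
    (\<lambda>b. c x *\<^sub>R dir_deriv b f x + dir_deriv b c x *\<^sub>R f x)) (at x)" if "x \<in> S" for x
    by (rule has_derivative_scaleR[OF Ck_on_1_has_derivative[OF assms(1,2) that]
          Ck_on_1_has_derivative[OF assms(1,3) that]])
  show "continuous_on S (\<lambda>x. c x *\<^sub>R dir_deriv b f x + dir_deriv b c x *\<^sub>R f x)" for b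
    using continuous_on_dir_deriv[OF assms(1,2), of b] continuous_on_dir_deriv[OF assms(1,3), of b]
      assms(2,3)[THEN Ck_on_imp_continuous_on]
    by (intro continuous_on_add continuous_on_scaleR)
qed

lemma dir_deriv_scaleR:
  assumes "open S" "Ck_on 1 S c" "Ck_on 1 S f" "x \<in> S"
  shows "dir_deriv b (\<lambda>x. c x *\<^sub>R f x) x = c x *\<^sub>R dir_deriv b f x + dir_deriv b c x *\<^sub>R f x"
  by (rule dir_deriv_eqI)
    (rule has_derivative_scaleR[OF Ck_on_1_has_derivative[OF assms(1,2,4)]
          Ck_on_1_has_derivative[OF assms(1,3,4)]])

lemma Ck_on_1_real_comp:
  fixes g :: "'a::euclidean_space \<Rightarrow> real"
  assumes "open S" "Ck_on 1 S g"
    and \<theta>: "\<And>t. (\<theta> has_real_derivative \<theta>' t) (at t)" "continuous_on UNIV \<theta>'"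
  shows "Ck_on 1 S (\<lambda>x. \<theta> (g x))"
  unfolding Ck_on_1_iff[OF assms(1)]
proof (intro exI conjI ballI)
  show "((\<lambda>x. \<theta> (g x)) has_derivative (\<lambda>b. \<theta>' (g x) * dir_deriv b g x)) (at x)" if "x \<in> S" for x
    using has_derivative_compose[OF Ck_on_1_has_derivative[OF assms(1,2) that], of \<theta>] \<theta>(1)[of "g x"]
    by (auto simp: has_field_derivative_def)
  show "continuous_on S (\<lambda>x. \<theta>' (g x) * dir_deriv b g x)" for b
    using continuous_on_dir_deriv[OF assms(1,2), of b]
      continuous_on_compose2[OF \<theta>(2) Ck_on_imp_continuous_on[OF assms(2)]]
    by (intro continuous_on_mult) auto
qed

lemma Ck_on_1_prod:
  fixes g :: "'i \<Rightarrow> 'a::euclidean_space \<Rightarrow> real"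
  assumes "open S" "finite I" "\<And>i. i \<in> I \<Longrightarrow> Ck_on 1 S (g i)"
  shows "Ck_on 1 S (\<lambda>x. \<Prod>i\<in>I. g i x)"
  using assms(2,3)
proof (induction rule: finite_induct)
  case empty
  show ?case unfolding Ck_on_1_iff[OF assms(1)]
    by (intro exI[of _ "\<lambda>x b. 0"]) auto
next
  case (insert i I)
  then show ?case using Ck_on_1_scaleR[OF assms(1), of "g i" "\<lambda>x. \<Prod>i\<in>I. g i x"]
    by simp
qed

section \<open>Integration by parts and the fundamental lemma\<close>

text \<open>The sequential form serves dominated convergence of difference quotients and tangent
  vectors as limits of secants.\<close>

lemma has_derivative_imp_difference_quotients:
  fixes f :: "'a::real_normed_vector \<Rightarrow> 'b::real_normed_vector"
  assumes "(f has_derivative f') (at x)" "t \<longlonglongrightarrow> 0" "\<And>n. t n \<noteq> (0::real)"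
  shows "(\<lambda>n. (f (x + t n *\<^sub>R v) - f x) /\<^sub>R t n) \<longlonglongrightarrow> f' v"
proof -
  have "((\<lambda>s. f (x + s *\<^sub>R v)) has_derivative (\<lambda>s. f' (s *\<^sub>R v))) (at 0)"
    by (rule has_derivative_compose[where g=f and f="\<lambda>s. x + s *\<^sub>R v"])
      (use assms(1) in \<open>auto intro!: derivative_eq_intros\<close>)
  moreover have "f' (s *\<^sub>R v) = s *\<^sub>R f' v" for s
    using has_derivative_linear[OF assms(1)] linear_cmul by blast
  ultimately have D: "((\<lambda>s. f (x + s *\<^sub>R v)) has_vector_derivative f' v) (at 0)"
    by (simp add: has_vector_derivative_def)
  have "((\<lambda>h. (f (x + h *\<^sub>R v) - f x) /\<^sub>R h) \<longlongrightarrow> f' v) (at 0)"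
  proof -
    have "((\<lambda>h. norm (f (x + h *\<^sub>R v) - f x - h *\<^sub>R f' v) / norm h) \<longlongrightarrow> 0) (at 0)"
      using D by (simp add: has_vector_derivative_def has_derivative_at)
    moreover have "norm ((f (x + h *\<^sub>R v) - f x) /\<^sub>R h - f' v)
        = norm (f (x + h *\<^sub>R v) - f x - h *\<^sub>R f' v) / norm h" if "h \<noteq> 0" for h
    proof -
      have "(f (x + h *\<^sub>R v) - f x) /\<^sub>R h - f' v = (f (x + h *\<^sub>R v) - f x - h *\<^sub>R f' v) /\<^sub>R h"
        using that by (simp add: scaleR_diff_right)
      then show ?thesis by (simp add: divide_inverse mult.commute)
    qed
    ultimately have "((\<lambda>h. norm ((f (x + h *\<^sub>R v) - f x) /\<^sub>R h - f' v)) \<longlongrightarrow> 0) (at 0)"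
      by (elim Lim_transform_eventually) (simp add: eventually_at_filter)
    then show ?thesis by (rule Lim_null[THEN iffD2, OF tendsto_norm_zero_cancel])
  qed
  moreover have "filterlim t (at 0) sequentially"
    using assms(2,3) by (simp add: filterlim_at)
  ultimately show ?thesis
    by (rule filterlim_compose)
qed

lemma dir_deriv_eq_0_off_support:
  assumes "compact K" "\<And>x. x \<notin> K \<Longrightarrow> f x = 0" "x \<notin> K"
  shows "dir_deriv b f x = 0"
proof -
  have "dir_deriv b f x = dir_deriv b (\<lambda>_. 0) x"
    using assms by (intro dir_deriv_cong[of "-K"]) (auto intro: compact_imp_closed)
  also have "\<dots> = 0" by (rule dir_deriv_eqI) simp
  finally show ?thesis .
qed

lemma integrable_compact_support:
  fixes g :: "'a::euclidean_space \<Rightarrow> 'b::euclidean_space"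
  assumes "compact K" "continuous_on K g" "\<And>x. x \<notin> K \<Longrightarrow> g x = 0"
  shows "integrable lborel g"
proof -
  have "integrable lborel (\<lambda>x. indicator K x *\<^sub>R g x)"
    by (rule borel_integrable_compact[OF assms(1,2)])
  moreover have "indicator K x *\<^sub>R g x = g x" for x using assms(3) by (auto simp: indicator_def)
  ultimately show ?thesis by simp
qed

text \<open>Each difference quotient has integral zero by translation invariance of Lebesgue
  measure, and the quotients converge to the derivative under a bounded majorant of compact
  support.\<close>

lemma integral_dir_deriv_compact_support:
  fixes f :: "'a::euclidean_space \<Rightarrow> 'b::euclidean_space"
  assumes f: "Ck_on 1 UNIV f" and K: "compact K" "\<And>x. x \<notin> K \<Longrightarrow> f x = 0"
  shows "(\<integral>x. dir_deriv b f x \<partial>lborel) = 0"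
proof -
  have D: "(f has_derivative (\<lambda>b. dir_deriv b f x)) (at x)" for x
    by (rule Ck_on_1_has_derivative[OF open_UNIV f UNIV_I])
  have cf: "continuous_on UNIV f" and cd: "continuous_on UNIV (dir_deriv b f)"
    using Ck_on_imp_continuous_on[OF f] continuous_on_dir_deriv[OF open_UNIV f] by auto
  have zero: "dir_deriv b f x = 0" if "x \<notin> K" for x
    using K that by (rule dir_deriv_eq_0_off_support)
  have intf: "integrable lborel f"
    by (rule integrable_compact_support[OF K(1) continuous_on_subset[OF cf]]) (auto simp: K(2))
  have "bounded (dir_deriv b f ` K)"
    using cd K by (intro compact_imp_bounded compact_continuous_image) (auto intro:
        continuous_on_subset)
  then obtain C where "\<forall>x\<in>K. norm (dir_deriv b f x) \<le> C" "C > 0"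
    by (auto simp: bounded_pos)
  then have C: "norm (dir_deriv b f x) \<le> C" for x using zero[of x] by (cases "x \<in> K") auto
  \<comment> \<open>The mean value bound along the segment supplies the constant of the majorant in
    the dominated convergence below.\<close>
  have lip: "norm (f (x + s *\<^sub>R b) - f x) \<le> C * \<bar>s\<bar>" for x s
  proof -
    have "norm ((\<lambda>t. f (x + t *\<^sub>R b)) s - (\<lambda>t. f (x + t *\<^sub>R b)) 0) \<le> C * norm (s - 0)"
    proof (rule differentiable_bound[where S=UNIV and f'="\<lambda>t h. h *\<^sub>R dir_deriv b f (x + t *\<^sub>R b)"])
      fix t :: real
      have "((\<lambda>t. f (x + t *\<^sub>R b)) has_derivative (\<lambda>h. dir_deriv (h *\<^sub>R b) f (x + t *\<^sub>R b))) (at t)"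
        by (rule has_derivative_compose[where g=f and f="\<lambda>t. x + t *\<^sub>R b", OF _ D])
          (auto intro!: derivative_eq_intros)
      moreover have "dir_deriv (h *\<^sub>R b) f y = h *\<^sub>R dir_deriv b f y" for h y
        using has_derivative_linear[OF D] linear_cmul by blast
      ultimately show "((\<lambda>t. f (x + t *\<^sub>R b)) has_derivative (\<lambda>h. h *\<^sub>R dir_deriv b f (x + t *\<^sub>R
          b))) (at t within UNIV)"
        by simp
      show "onorm (\<lambda>h. h *\<^sub>R dir_deriv b f (x + t *\<^sub>R b)) \<le> C"
        by (rule onorm_le) (use C[of "x + t *\<^sub>R b"] in \<open>auto intro: mult_left_mono simp:
            mult.commute[of C]\<close>)
    qed auto
    then show ?thesis by simp
  qed
  obtain R where R: "\<And>x. x \<in> K \<Longrightarrow> norm x \<le> R"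
    using compact_imp_bounded[OF K(1)] by (auto simp: bounded_iff)
  define t where "t n = inverse (real (Suc n))" for n
  have t: "t n \<noteq> 0" "0 < t n" "t n \<le> 1" for n by (auto simp: t_def field_simps)
  have t0: "t \<longlonglongrightarrow> 0" unfolding t_def by (rule LIMSEQ_inverse_real_of_nat)
  define q where "q n x = (f (x + t n *\<^sub>R b) - f x) /\<^sub>R t n" for n x
  have trans: "integrable lborel (\<lambda>x. f (x + c))" "(\<integral>x. f (x + c) \<partial>lborel) = (\<integral>x. f x \<partial>lborel)" for c
  proof -
    have "integrable (distr lborel borel ((+) c)) f" using intf by (simp add: lborel_distr_plus)
    then show "integrable lborel (\<lambda>x. f (x + c))"
      by (subst (asm) integrable_distr_eq) (auto simp: add.commute
          borel_measurable_continuous_onI[OF cf])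
    have "(\<integral>x. f x \<partial>lborel) = (\<integral>x. f x \<partial>distr lborel borel ((+) c))" by (simp add: lborel_distr_plus)
    then show "(\<integral>x. f (x + c) \<partial>lborel) = (\<integral>x. f x \<partial>lborel)"
      by (subst (asm) integral_distr) (auto simp: add.commute borel_measurable_continuous_onI[OF cf])
  qed
  have q0: "(\<integral>x. q n x \<partial>lborel) = 0" for n
    using trans intf by (simp add: q_def)
  have "(\<lambda>n. \<integral>x. q n x \<partial>lborel) \<longlonglongrightarrow> (\<integral>x. dir_deriv b f x \<partial>lborel)"
  \<comment> \<open>As \<open>t n \<le> 1\<close>, the quotients vanish farther than
    \<open>norm b\<close> from \<open>K\<close>, hence outside one ball common to all
    \<open>n\<close>.\<close>
  proof (rule integral_dominated_convergence[where w="\<lambda>x. indicator (cball 0 (R + norm b)) x *\<^sub>R C"])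
    show "dir_deriv b f \<in> borel_measurable lborel"
      using borel_measurable_continuous_onI[OF cd] by simp
    show "q n \<in> borel_measurable lborel" for n
    proof -
      have "continuous_on UNIV (q n)" unfolding q_def
        by (intro continuous_intros cf continuous_on_compose2[OF cf]) auto
      then show ?thesis using borel_measurable_continuous_onI by auto
    qed
    show "integrable lborel (\<lambda>x. indicator (cball 0 (R + norm b)) x *\<^sub>R C)"
      by (intro borel_integrable_compact) auto
    show "AE x in lborel. (\<lambda>n. q n x) \<longlonglongrightarrow> dir_deriv b f x"
      unfolding q_def by (intro AE_I2 has_derivative_imp_difference_quotients[OF D t0 t(1)])
    show "AE x in lborel. norm (q n x) \<le> indicator (cball 0 (R + norm b)) x *\<^sub>R C" for n
    proof (rule AE_I2)
      fix x
      show "norm (q n x) \<le> indicator (cball 0 (R + norm b)) x *\<^sub>R C"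
      proof (cases "norm x \<le> R + norm b")
        case True
        have "norm (q n x) = norm (f (x + t n *\<^sub>R b) - f x) / t n"
          using t[of n] by (simp add: q_def divide_inverse_commute)
        also have "\<dots> \<le> C" using lip[of x "t n"] t[of n] by (simp add: divide_le_eq)
        finally have "norm (q n x) \<le> C" .
        then show ?thesis using True by simp
      next
        case False
        have "norm (t n *\<^sub>R b) \<le> norm b" using t[of n] by (simp add: mult_left_le_one_le)
        then have "norm (x + t n *\<^sub>R b) > R" "norm x > R"
          using False norm_triangle_ineq2[of x "- (t n *\<^sub>R b)"] norm_ge_zero[of b]
          by (simp_all del: norm_scaleR norm_ge_zero)
        then have "x \<notin> K" "x + t n *\<^sub>R b \<notin> K" using R by force+
        then show ?thesis using False K(2) by (simp add: q_def)
      qed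
    qed
  qed
  then show "(\<integral>x. dir_deriv b f x \<partial>lborel) = 0"
    by (simp add: q0 LIMSEQ_const_iff)
qed

lemma borel_measurable_lebesgue_on_lborel_indicator:
  fixes g :: "'a::euclidean_space \<Rightarrow> 'b::euclidean_space"
  assumes "open S" "continuous_on S g"
  shows "(\<lambda>x. indicator S x *\<^sub>R g x) \<in> borel_measurable borel"
  using borel_measurable_continuous_on_indicator[OF _ assms(2)] assms(1) by auto

lemma integral_lebesgue_on_indicator:
  fixes g :: "'a::euclidean_space \<Rightarrow> 'b::euclidean_space"
  assumes "open S" "(\<lambda>x. indicator S x *\<^sub>R g x) \<in> borel_measurable borel"
  shows "(\<integral>x. g x \<partial>lebesgue_on S) = (\<integral>x. indicator S x *\<^sub>R g x \<partial>lborel)"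
proof -
  have "S \<inter> space lebesgue \<in> sets lebesgue" using assms(1) by auto
  then show ?thesis using assms(2) by (simp add: integral_restrict_space integral_completion)
qed

text \<open>The product extended by zero is C1 on the whole space, because \<open>S\<close> and the
  complement of \<open>K\<close> are open and cover everything, and it vanishes on the latter. Its
  derivative has integral zero, and the product rule splits it. The function \<open>f\<close> may
  behave arbitrarily near the boundary of \<open>S\<close>.\<close>

lemma integral_by_parts_test:
  fixes f :: "'a::euclidean_space \<Rightarrow> 'b::euclidean_space" and \<zeta> :: "'a \<Rightarrow> real"
  assumes S: "open S" and \<zeta>: "Ck_on 1 UNIV \<zeta>" and K: "compact K" "K \<subseteq> S" "\<And>x. x \<notin> K \<Longrightarrow> \<zeta> x = 0"
    and f: "Ck_on 1 S f"
  shows "(\<integral>x. dir_deriv b \<zeta> x *\<^sub>R f x \<partial>lebesgue_on S) = - (\<integral>x. \<zeta> x *\<^sub>R dir_deriv b f x \<partial>lebesgue_on S)"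
proof -
  define P where "P x = (if x \<in> S then \<zeta> x *\<^sub>R f x else 0)" for x
  have oK: "open (- K)" using K(1) compact_imp_closed by blast
  have \<zeta>S: "Ck_on 1 S \<zeta>" using Ck_on_subset[OF \<zeta>] by auto
  have PS: "Ck_on 1 S P"
    by (rule Ck_on_transform[OF S Ck_on_1_scaleR[OF S \<zeta>S f]]) (simp add: P_def)
  have PK: "Ck_on 1 (-K) P"
  proof (rule Ck_on_transform[OF oK])
    show "Ck_on 1 (- K) (\<lambda>x. 0::'b)" unfolding Ck_on_1_iff[OF oK]
      by (intro exI[of _ "\<lambda>x b. 0"]) auto
  qed (use K in \<open>auto simp: P_def\<close>)
  have "Ck_on 1 UNIV P"
    unfolding Ck_on_1_iff[OF open_UNIV]
  proof (intro exI conjI ballI)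
    have U: "UNIV = S \<union> - K" using K(2) by auto
    show "(P has_derivative (\<lambda>b. dir_deriv b P x)) (at x)" for x
      using Ck_on_1_has_derivative[OF S PS, of x] Ck_on_1_has_derivative[OF oK PK, of x] K(2) by auto
    show "continuous_on UNIV (\<lambda>x. dir_deriv b P x)" for b
      unfolding U using continuous_on_dir_deriv[OF S PS] continuous_on_dir_deriv[OF oK PK] S oK
      by (intro continuous_on_open_Un) auto
  qed
  note P = this
  have PK0: "P x = 0" if "x \<notin> K" for x using that K by (auto simp: P_def)
  have \<zeta>d: "dir_deriv b \<zeta> x = 0" if "x \<notin> K" for x
    using K(1,3) that by (rule dir_deriv_eq_0_off_support)
  have Pd: "dir_deriv b P x = indicator S x *\<^sub>R (\<zeta> x *\<^sub>R dir_deriv b f x) + indicator S x *\<^sub>R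
      (dir_deriv b \<zeta> x *\<^sub>R f x)" for x
  proof (cases "x \<in> S")
    case True
    have "dir_deriv b P x = dir_deriv b (\<lambda>x. \<zeta> x *\<^sub>R f x) x"
      by (rule dir_deriv_cong[OF S True]) (simp add: P_def)
    then show ?thesis using dir_deriv_scaleR[OF S \<zeta>S f True] True by simp
  next
    case False
    then have "x \<in> - K" using K by auto
    then have "dir_deriv b P x = 0" using dir_deriv_eq_0_off_support[of K P x b] K(1) PK0 by simp
    then show ?thesis using False by simp
  qed
  have c1: "continuous_on S (\<lambda>x. \<zeta> x *\<^sub>R dir_deriv b f x)"
    using continuous_on_scaleR[OF Ck_on_imp_continuous_on[OF \<zeta>S] continuous_on_dir_deriv[OF S f, of
        b]] by simp
  have c2: "continuous_on S (\<lambda>x. dir_deriv b \<zeta> x *\<^sub>R f x)"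
    using continuous_on_scaleR[OF continuous_on_dir_deriv[OF S \<zeta>S, of b] Ck_on_imp_continuous_on[OF
        f]] by simp
  have int: "integrable lborel (\<lambda>x. indicator S x *\<^sub>R g x)"
    if "continuous_on S g" "\<And>x. x \<notin> K \<Longrightarrow> g x = 0" for g :: "'a \<Rightarrow> 'b"
  proof -
    have "(\<lambda>x. indicator S x *\<^sub>R g x) = g" using that(2) K(2) by (auto simp: indicator_def fun_eq_iff)
    then show ?thesis
      using integrable_compact_support[OF K(1) continuous_on_subset[OF that(1) K(2)]] that(2) by simp
  qed
  have m1: "(\<lambda>x. indicator S x *\<^sub>R (\<zeta> x *\<^sub>R dir_deriv b f x)) \<in> borel_measurable borel"
    and m2: "(\<lambda>x. indicator S x *\<^sub>R (dir_deriv b \<zeta> x *\<^sub>R f x)) \<in> borel_measurable borel"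
    using borel_measurable_lebesgue_on_lborel_indicator[OF S c1]
        borel_measurable_lebesgue_on_lborel_indicator[OF S c2] .
  have i1: "integrable lborel (\<lambda>x. indicator S x *\<^sub>R (\<zeta> x *\<^sub>R dir_deriv b f x))"
    by (rule int[OF c1]) (use K in auto)
  have i2: "integrable lborel (\<lambda>x. indicator S x *\<^sub>R (dir_deriv b \<zeta> x *\<^sub>R f x))"
    by (rule int[OF c2]) (use \<zeta>d in auto)
  have "(\<integral>x. dir_deriv b P x \<partial>lborel) = 0"
    by (rule integral_dir_deriv_compact_support[OF P K(1) PK0])
  then have "(\<integral>x. indicator S x *\<^sub>R (\<zeta> x *\<^sub>R dir_deriv b f x) \<partial>lborel)
      + (\<integral>x. indicator S x *\<^sub>R (dir_deriv b \<zeta> x *\<^sub>R f x) \<partial>lborel) = 0"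
    unfolding Pd Bochner_Integration.integral_add[OF i1 i2] .
  then show "(\<integral>x. dir_deriv b \<zeta> x *\<^sub>R f x \<partial>lebesgue_on S) = - (\<integral>x. \<zeta> x *\<^sub>R dir_deriv b f x
      \<partial>lebesgue_on S)"
    unfolding integral_lebesgue_on_indicator[OF S m1] integral_lebesgue_on_indicator[OF S m2]
    by (simp add: eq_neg_iff_add_eq_0 add.commute)
qed

lemma borel_measurable_lebesgue_on_continuous:
  fixes f :: "'a::euclidean_space \<Rightarrow> 'b::euclidean_space"
  assumes "open S" "continuous_on S f"
  shows "f \<in> borel_measurable (lebesgue_on S)"
  using continuous_imp_measurable_on_sets_lebesgue[OF assms(2)] assms(1) by auto

section \<open>Continuously differentiable approximations of the indicator of a box\<close>

lemma has_real_derivative_max_0_power2: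
  "((\<lambda>t. (max 0 t)\<^sup>2) has_real_derivative 2 * max 0 t) (at t)"
proof -
  consider "t < 0" | "t > 0" | "t = 0" by linarith
  then show ?thesis
  proof cases
    case 1
    have "((\<lambda>_. 0) has_real_derivative 2 * max 0 t) (at t)" using 1 by simp
    then show ?thesis
      by (rule has_field_derivative_transform_within_open[where S="{..<0}"]) (use 1 in auto)
  next
    case 2
    have "((\<lambda>t. t\<^sup>2) has_real_derivative 2 * max 0 t) (at t)"
      using 2 by (auto intro!: derivative_eq_intros)
    then show ?thesis
      by (rule has_field_derivative_transform_within_open[where S="{0<..}"]) (use 2 in auto)
  next
    case 3
    have "((\<lambda>h::real. (max 0 h)\<^sup>2 / h) \<longlongrightarrow> 0) (at 0)"
    proof (rule Lim_null_comparison)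
      show "\<forall>\<^sub>F h in at 0. norm ((max 0 h)\<^sup>2 / h) \<le> \<bar>h::real\<bar>"
        by (intro always_eventually allI) (auto simp: max_def power2_eq_square)
      show "((\<lambda>h::real. \<bar>h\<bar>) \<longlongrightarrow> 0) (at 0)"
        by (auto intro!: tendsto_eq_intros)
    qed
    then show ?thesis using 3 by (simp add: DERIV_def)
  qed
qed

text \<open>\<open>\<psi>\<close> is a product of squared positive parts, so it is C1, and it
  vanishes exactly off the open box. The functions \<open>\<theta> n\<close> fix 0, have values in
  [0, 1) and tend to 1 at every other point, so \<open>\<theta> n (\<psi> x)\<close> tends to the
  indicator while the support stays in the closed box.\<close>

lemma box_bump_sequence:
  fixes a b :: "'a::euclidean_space"
  obtains \<zeta> :: "nat \<Rightarrow> 'a \<Rightarrow> real" where "\<And>n. Ck_on 1 UNIV (\<zeta> n)"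
    "\<And>n x. x \<notin> cbox a b \<Longrightarrow> \<zeta> n x = 0" "\<And>n x. \<bar>\<zeta> n x\<bar> \<le> 1"
    "\<And>x. (\<lambda>n. \<zeta> n x) \<longlonglongrightarrow> indicator (box a b) x"
proof -
  define \<psi> :: "'a \<Rightarrow> real" where
    "\<psi> x = (\<Prod>i\<in>Basis. (max 0 (x \<bullet> i - a \<bullet> i))\<^sup>2 * (max 0 (b \<bullet> i - x \<bullet> i))\<^sup>2)" for x
  define \<theta> where "\<theta> n t = 1 - inverse (1 + real n * t\<^sup>2)" for n t
  have nz: "1 + real n * t\<^sup>2 \<noteq> 0" "1 + real n * t\<^sup>2 \<ge> 1" for n t
    by (auto simp: add_nonneg_eq_0_iff)
  have inner: "Ck_on 1 UNIV (\<lambda>x. x \<bullet> i)" for i :: 'a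
    unfolding Ck_on_1_iff[OF open_UNIV]
    by (intro exI[of _ "\<lambda>x b. b \<bullet> i"]) (auto intro!: derivative_eq_intros)
  have "Ck_on 1 UNIV \<psi>"
    unfolding \<psi>_def
  proof (rule Ck_on_1_prod[OF open_UNIV finite_Basis])
    fix i :: 'a
    show "Ck_on 1 UNIV (\<lambda>x. (max 0 (x \<bullet> i - a \<bullet> i))\<^sup>2 * (max 0 (b \<bullet> i - x \<bullet> i))\<^sup>2)"
    proof (rule Ck_on_1_real_comp[OF open_UNIV inner, of "\<lambda>t. (max 0 (t - a \<bullet> i))\<^sup>2 * (max 0 (b \<bullet> i
        - t))\<^sup>2"
          "\<lambda>t. (2 * max 0 (t - a \<bullet> i)) * (max 0 (b \<bullet> i - t))\<^sup>2 + (2 * max 0 (b \<bullet> i - t) * - 1) *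
              (max 0 (t - a \<bullet> i))\<^sup>2"])
      fix t :: real
      have "((\<lambda>t. (max 0 (t - a \<bullet> i))\<^sup>2) has_real_derivative 2 * max 0 (t - a \<bullet> i) * 1) (at t)"
        by (rule DERIV_chain2[where f="\<lambda>t. (max 0 t)\<^sup>2" and g="\<lambda>t. t - a \<bullet> i" and s=UNIV,
              OF has_real_derivative_max_0_power2])
          (auto intro!: derivative_eq_intros)
      then have 1: "((\<lambda>t. (max 0 (t - a \<bullet> i))\<^sup>2) has_real_derivative 2 * max 0 (t - a \<bullet> i)) (at t)"
        by simp
      have 2: "((\<lambda>t. (max 0 (b \<bullet> i - t))\<^sup>2) has_real_derivative 2 * max 0 (b \<bullet> i - t) * - 1) (at t)"
        by (rule DERIV_chain2[where f="\<lambda>t. (max 0 t)\<^sup>2" and g="\<lambda>t. b \<bullet> i - t" and s=UNIV,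
              OF has_real_derivative_max_0_power2])
          (auto intro!: derivative_eq_intros)
      show "((\<lambda>t. (max 0 (t - a \<bullet> i))\<^sup>2 * (max 0 (b \<bullet> i - t))\<^sup>2) has_real_derivative
        (2 * max 0 (t - a \<bullet> i)) * (max 0 (b \<bullet> i - t))\<^sup>2 + (2 * max 0 (b \<bullet> i - t) * - 1) * (max 0 (t
            - a \<bullet> i))\<^sup>2) (at t)"
        by (rule DERIV_mult[OF 1 2])
    qed (auto intro!: continuous_intros)
  qed
  then have C: "Ck_on 1 UNIV (\<lambda>x. \<theta> n (\<psi> x))" for n
  proof (rule Ck_on_1_real_comp[OF open_UNIV])
    show "(\<theta> n has_real_derivative (2 * real n * t) * (inverse (1 + real n * t\<^sup>2))\<^sup>2) (at t)" for t
      unfolding \<theta>_def using nz(1)[of n t]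
      by (auto intro!: derivative_eq_intros simp: power2_eq_square)
    show "continuous_on UNIV (\<lambda>t. (2 * real n * t) * (inverse (1 + real n * t\<^sup>2))\<^sup>2)"
      by (intro continuous_intros) (use nz(1) in blast)
  qed
  have \<psi>0: "\<psi> x = 0" if "x \<notin> box a b" for x
  proof -
    obtain i where "i \<in> Basis" "x \<bullet> i \<le> a \<bullet> i \<or> b \<bullet> i \<le> x \<bullet> i"
      using \<open>x \<notin> box a b\<close> by (auto simp: mem_box not_less)
    then show ?thesis unfolding \<psi>_def by (intro prod_zero bexI[of _ i]) auto
  qed
  have \<psi>1: "\<psi> x \<noteq> 0" if "x \<in> box a b" for x
    using that by (auto simp: \<psi>_def mem_box max_def)
  show ?thesis
  proof (rule that[of "\<lambda>n x. \<theta> n (\<psi> x)"])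
    show "Ck_on 1 UNIV (\<lambda>x. \<theta> n (\<psi> x))" for n by (rule C)
    show "\<theta> n (\<psi> x) = 0" if "x \<notin> cbox a b" for n x
      using \<psi>0[of x] that box_subset_cbox by (force simp: \<theta>_def)
    show "\<bar>\<theta> n (\<psi> x)\<bar> \<le> 1" for n x
      using nz(2)[of n "\<psi> x"] inverse_le_1_iff[of "1 + real n * (\<psi> x)\<^sup>2"]
      by (auto simp: \<theta>_def)
    show "(\<lambda>n. \<theta> n (\<psi> x)) \<longlonglongrightarrow> indicator (box a b) x" for x
    proof (cases "x \<in> box a b")
      case True
      have "filterlim (\<lambda>n. real n * (\<psi> x)\<^sup>2) at_top sequentially"
        by (rule filterlim_at_top_mult_tendsto_pos[OF tendsto_const _ filterlim_real_sequentially])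
          (use \<psi>1[OF True] in simp)
      then have "filterlim (\<lambda>n. 1 + real n * (\<psi> x)\<^sup>2) at_top sequentially"
        by (rule filterlim_tendsto_add_at_top[OF tendsto_const])
      then have "(\<lambda>n. inverse (1 + real n * (\<psi> x)\<^sup>2)) \<longlonglongrightarrow> 0"
        by (rule tendsto_inverse_0_at_top)
      then have "(\<lambda>n. 1 - inverse (1 + real n * (\<psi> x)\<^sup>2)) \<longlonglongrightarrow> 1 - 0"
        by (intro tendsto_diff tendsto_const)
      then show ?thesis using True by (simp add: \<theta>_def)
    next
      case False
      then show ?thesis using \<psi>0 by (simp add: \<theta>_def)
    qed
  qed
qed

text \<open>Lebesgue differentiation: almost every value of \<open>g\<close> is the limit of
  averages over shrinking cubes, and these averages vanish for cubes inside
  \<open>S\<close>.\<close>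

lemma AE_eq_0_if_box_integrals_0:
  fixes g :: "'a::euclidean_space \<Rightarrow> 'b::euclidean_space"
  assumes S: "open S" and g: "integrable (lebesgue_on S) g"
    and box: "\<And>a b. cbox a b \<subseteq> S \<Longrightarrow> (\<integral>x. indicator (box a b) x *\<^sub>R g x \<partial>lebesgue_on S) = 0"
  shows "AE x in lebesgue_on S. g x = 0"
proof -
  \<comment> \<open>The differentiation theorem is applied on the whole space, hence the extension
    by zero.\<close>
  define g0 where "g0 x = indicator S x *\<^sub>R g x" for x
  have S': "S \<inter> space lebesgue \<in> sets lebesgue" using S by auto
  have g0: "integrable lebesgue g0"
    using g unfolding integrable_restrict_space[OF S'] g0_def by simp
  have si: "set_integrable lebesgue (cbox a b) g0" for a b :: 'a
    unfolding set_integrable_def by (rule integrable_mult_indicator[OF _ g0]) auto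
  have ion: "g0 integrable_on cbox a b" for a b :: 'a
    using set_lebesgue_integral_eq_integral(1)[OF si] .
  have zero: "integral (cbox a b) g0 = 0" if "cbox a b \<subseteq> S" for a b
  proof -
    have "integral (cbox a b) g0 = (\<integral>x. indicator (cbox a b) x *\<^sub>R g0 x \<partial>lebesgue)"
      using set_lebesgue_integral_eq_integral(2)[OF si] by (simp add: set_lebesgue_integral_def)
    also have "\<dots> = (\<integral>x. indicator (box a b) x *\<^sub>R g0 x \<partial>lebesgue)"
    proof (rule integral_cong_AE)
      show "(\<lambda>x. indicator (cbox a b) x *\<^sub>R g0 x) \<in> borel_measurable lebesgue"
        "(\<lambda>x. indicator (box a b) x *\<^sub>R g0 x) \<in> borel_measurable lebesgue"
        using g0 by (auto intro!: borel_measurable_scaleR borel_measurable_indicator)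
      have "AE x in lebesgue. x \<notin> cbox a b - box a b"
        using null_sets_cbox_Diff_box by (intro AE_not_in null_sets_completionI) auto
      then show "AE x in lebesgue. indicator (cbox a b) x *\<^sub>R g0 x = indicator (box a b) x *\<^sub>R g0 x"
        by (rule AE_mp) (use box_subset_cbox in \<open>auto simp: indicator_def\<close>)
    qed
    also have "\<dots> = (\<integral>x. indicator (box a b) x *\<^sub>R g x \<partial>lebesgue_on S)"
      unfolding integral_restrict_space[OF S'] g0_def by (simp add: mult.commute)
    also have "\<dots> = 0" by (rule box[OF that])
    finally show ?thesis .
  qed
  obtain N where N: "negligible N"
    "\<And>x e. x \<notin> N \<Longrightarrow> 0 < e \<Longrightarrow> \<exists>d>0. \<forall>h. 0 < h \<and> h < d \<longrightarrow>
       norm (integral (cbox x (x + h *\<^sub>R One)) g0 /\<^sub>R h ^ DIM('a) - g0 x) < e"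
    using integrable_ccontinuous_explicit[of g0] ion by blast
  have "g x = 0" if xS: "x \<in> S" and xN: "x \<notin> N" for x
  proof (rule ccontr)
    assume "g x \<noteq> 0"
    then have e: "norm (g x) > 0" by simp
    \<comment> \<open>The accuracy is \<open>norm (g x)\<close> itself: an average equal to 0 has
      exactly this distance from \<open>g x\<close>, which the strict inequality forbids.\<close>
    obtain d where d: "d > 0" "\<And>h. 0 < h \<Longrightarrow> h < d \<Longrightarrow>
        norm (integral (cbox x (x + h *\<^sub>R One)) g0 /\<^sub>R h ^ DIM('a) - g0 x) < norm (g x)"
      using N(2)[OF xN e] by blast
    obtain \<epsilon> where \<epsilon>: "\<epsilon> > 0" "ball x \<epsilon> \<subseteq> S" using S xS open_contains_ball by blast
    define h where "h = min (d/2) (\<epsilon> / (2 * norm (One::'a)))"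
    have One: "norm (One::'a) > 0" by simp
    have h: "h > 0" "h < d" "h * norm (One::'a) < \<epsilon>"
    proof -
      show "h > 0" "h < d" using d \<epsilon> One by (auto simp: h_def)
      have "h * norm (One::'a) \<le> \<epsilon> / (2 * norm (One::'a)) * norm (One::'a)"
        by (intro mult_right_mono) (auto simp: h_def)
      also have "\<dots> = \<epsilon> / 2" by simp
      finally show "h * norm (One::'a) < \<epsilon>" using \<epsilon> by linarith
    qed
    have "cbox x (x + h *\<^sub>R One) \<subseteq> ball x \<epsilon>"
    proof
      fix y assume y: "y \<in> cbox x (x + h *\<^sub>R One)"
      have "norm (y - x) \<le> norm (h *\<^sub>R (One::'a))"
        by (rule norm_le_componentwise) (use y h(1) in \<open>auto simp: mem_box inner_simps\<close>)
      then show "y \<in> ball x \<epsilon>" using h by (simp add: dist_norm norm_minus_commute)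
    qed
    then have "integral (cbox x (x + h *\<^sub>R One)) g0 = 0" using \<epsilon> zero by blast
    then show False using d(2)[OF h(1,2)] xS by (simp add: g0_def)
  qed
  then show ?thesis
    using N(1) S by (subst AE_restrict_space_iff) (auto simp: negligible_iff_null_sets intro!:
        AE_I'[of N])
qed

text \<open>Bump functions bounded by 1 pass to indicators of boxes by dominated convergence with
  majorant \<open>norm (g x)\<close>.\<close>

lemma AE_eq_0_if_test_integrals_0:
  fixes g :: "'a::euclidean_space \<Rightarrow> 'b::euclidean_space"
  assumes S: "open S" and g: "integrable (lebesgue_on S) g"
    and test: "\<And>\<zeta> K. Ck_on 1 UNIV \<zeta> \<Longrightarrow> compact K \<Longrightarrow> K \<subseteq> S \<Longrightarrow> (\<And>x. x \<notin> K \<Longrightarrow> \<zeta> x = 0) \<Longrightarrow>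
      (\<integral>x. \<zeta> x *\<^sub>R g x \<partial>lebesgue_on S) = 0"
  shows "AE x in lebesgue_on S. g x = 0"
proof (rule AE_eq_0_if_box_integrals_0[OF S g])
  fix a b :: 'a
  assume ab: "cbox a b \<subseteq> S"
  obtain \<zeta> :: "nat \<Rightarrow> 'a \<Rightarrow> real" where \<zeta>: "\<And>n. Ck_on 1 UNIV (\<zeta> n)"
    "\<And>n x. x \<notin> cbox a b \<Longrightarrow> \<zeta> n x = 0" "\<And>n x. \<bar>\<zeta> n x\<bar> \<le> 1"
    "\<And>x. (\<lambda>n. \<zeta> n x) \<longlonglongrightarrow> indicator (box a b) x"
    using box_bump_sequence[of a b] by blast
  have m: "\<zeta> n \<in> borel_measurable (lebesgue_on S)" for n
  proof -
    have "\<zeta> n \<in> borel_measurable borel"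
      using Ck_on_imp_continuous_on[OF \<zeta>(1)] by (rule borel_measurable_continuous_onI)
    then show ?thesis by (intro measurable_restrict_space1 measurable_completion) simp
  qed
  have "(\<lambda>n. \<integral>x. \<zeta> n x *\<^sub>R g x \<partial>lebesgue_on S) \<longlonglongrightarrow> (\<integral>x. indicator (box a b) x *\<^sub>R g x \<partial>lebesgue_on S)"
  proof (rule integral_dominated_convergence[where w="\<lambda>x. norm (g x)"])
    show "(\<lambda>x. indicat_real (box a b) x *\<^sub>R g x) \<in> borel_measurable (lebesgue_on S)"
    proof (intro borel_measurable_scaleR borel_measurable_integrable[OF g])
      have "indicat_real (box a b) \<in> borel_measurable borel" by simp
      then show "indicat_real (box a b) \<in> borel_measurable (lebesgue_on S)"
        by (intro measurable_restrict_space1 measurable_completion) simp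
    qed
    show "(\<lambda>x. \<zeta> n x *\<^sub>R g x) \<in> borel_measurable (lebesgue_on S)" for n
      by (intro borel_measurable_scaleR borel_measurable_integrable[OF g] m)
    show "integrable (lebesgue_on S) (\<lambda>x. norm (g x))" using g by simp
    show "AE x in lebesgue_on S. (\<lambda>n. \<zeta> n x *\<^sub>R g x) \<longlonglongrightarrow> indicat_real (box a b) x *\<^sub>R g x"
      by (intro AE_I2 tendsto_scaleR \<zeta>(4) tendsto_const)
    show "AE x in lebesgue_on S. norm (\<zeta> n x *\<^sub>R g x) \<le> norm (g x)" for n
      by (intro AE_I2) (auto simp: \<zeta>(3) mult_left_le_one_le)
  qed
  moreover have "(\<integral>x. \<zeta> n x *\<^sub>R g x \<partial>lebesgue_on S) = 0" for n
    by (rule test[OF \<zeta>(1) _ ab \<zeta>(2)]) auto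
  ultimately show "(\<integral>x. indicator (box a b) x *\<^sub>R g x \<partial>lebesgue_on S) = 0"
    by (simp add: LIMSEQ_const_iff)
qed

text \<open>Uniqueness of weak derivatives: integration by parts moves the derivative onto a test
  function, where the sequence tends to 0, so the limit \<open>w\<close> of the derivatives tests to
  0. Convergence almost everywhere under one majorant \<open>G\<close> is what vertical limits
  provide.\<close>

lemma limit_of_derivatives_eq_0:
  fixes v :: "nat \<Rightarrow> 'a::euclidean_space \<Rightarrow> 'b::euclidean_space"
  assumes S: "open S" and v: "\<And>n. Ck_on 1 S (v n)"
    and v0: "AE y in lebesgue_on S. (\<lambda>n. v n y) \<longlonglongrightarrow> 0"
    and w: "AE y in lebesgue_on S. (\<lambda>n. dir_deriv b (v n) y) \<longlonglongrightarrow> w y"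
    and wm: "w \<in> borel_measurable (lebesgue_on S)"
    and G: "integrable (lebesgue_on S) G"
    and vG: "\<And>n. AE y in lebesgue_on S. norm (v n y) \<le> G y"
    and wG: "\<And>n. AE y in lebesgue_on S. norm (dir_deriv b (v n) y) \<le> G y"
  shows "AE y in lebesgue_on S. w y = 0"
proof (rule AE_eq_0_if_test_integrals_0[OF S])
  note mc = borel_measurable_lebesgue_on_continuous[OF S]
  have mv: "v n \<in> borel_measurable (lebesgue_on S)" "dir_deriv b (v n) \<in> borel_measurable
      (lebesgue_on S)" for n
    using mc Ck_on_imp_continuous_on[OF v] continuous_on_dir_deriv[OF S v] by blast+
  show "integrable (lebesgue_on S) w"
    by (rule integrable_dominated_convergence[OF wm mv(2) G w wG])
  fix \<zeta> :: "'a \<Rightarrow> real" and K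
  assume \<zeta>: "Ck_on 1 UNIV \<zeta>" and K: "compact K" "K \<subseteq> S" "\<And>x. x \<notin> K \<Longrightarrow> \<zeta> x = 0"
  have \<zeta>d: "dir_deriv b \<zeta> x = 0" if "x \<notin> K" for x
    using K(1,3) that by (rule dir_deriv_eq_0_off_support)
  have bd: "\<exists>Z. \<forall>x. norm (f x) \<le> Z" if "continuous_on UNIV f" "\<And>x. x \<notin> K \<Longrightarrow> f x = 0" for f :: "'a \<Rightarrow> real"
  proof -
    have "bounded (f ` K)" using that K
      by (intro compact_imp_bounded compact_continuous_image) (auto intro: continuous_on_subset)
    then obtain Z where "Z > 0" "\<forall>x\<in>K. norm (f x) \<le> Z" by (auto simp: bounded_pos)
    then have "norm (f x) \<le> Z" for x using that(2)[of x] by (cases "x \<in> K") auto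
    then show ?thesis by blast
  qed
  have c: "continuous_on UNIV \<zeta>" "continuous_on UNIV (dir_deriv b \<zeta>)"
    using Ck_on_imp_continuous_on[OF \<zeta>] continuous_on_dir_deriv[OF open_UNIV \<zeta>] by auto
  obtain Z where Z: "\<And>x. norm (\<zeta> x) \<le> Z" using bd[OF c(1) K(3)] by blast
  obtain Z' where Z': "\<And>x. norm (dir_deriv b \<zeta> x) \<le> Z'" using bd[OF c(2) \<zeta>d] by blast
  have m\<zeta>: "\<zeta> \<in> borel_measurable (lebesgue_on S)" "dir_deriv b \<zeta> \<in> borel_measurable (lebesgue_on S)"
    using c by (auto intro!: mc intro: continuous_on_subset)
  have 1: "(\<lambda>n. \<integral>x. \<zeta> x *\<^sub>R dir_deriv b (v n) x \<partial>lebesgue_on S) \<longlonglongrightarrow> (\<integral>x. \<zeta> x *\<^sub>R w x \<partial>lebesgue_on S)"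
  proof (rule integral_dominated_convergence[where w="\<lambda>x. Z * G x"])
    show "AE x in lebesgue_on S. (\<lambda>n. \<zeta> x *\<^sub>R dir_deriv b (v n) x) \<longlonglongrightarrow> \<zeta> x *\<^sub>R w x"
      using w by eventually_elim (intro tendsto_scaleR tendsto_const)
    show "AE x in lebesgue_on S. norm (\<zeta> x *\<^sub>R dir_deriv b (v n) x) \<le> Z * G x" for n
      using wG[of n]
    proof eventually_elim
      case (elim x)
      show ?case unfolding norm_scaleR using Z[of x] elim order_trans[OF norm_ge_zero Z]
        by (intro mult_mono) auto
    qed
  qed (use G mv m\<zeta> wm in auto)
  have 2: "(\<lambda>n. \<integral>x. dir_deriv b \<zeta> x *\<^sub>R v n x \<partial>lebesgue_on S) \<longlonglongrightarrow> (\<integral>x. dir_deriv b \<zeta> x *\<^sub>R 0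
      \<partial>lebesgue_on S)"
  proof (rule integral_dominated_convergence[where w="\<lambda>x. Z' * G x"])
    show "AE x in lebesgue_on S. (\<lambda>n. dir_deriv b \<zeta> x *\<^sub>R v n x) \<longlonglongrightarrow> dir_deriv b \<zeta> x *\<^sub>R 0"
      using v0 by eventually_elim (intro tendsto_scaleR tendsto_const)
    show "AE x in lebesgue_on S. norm (dir_deriv b \<zeta> x *\<^sub>R v n x) \<le> Z' * G x" for n
      using vG[of n]
    proof eventually_elim
      case (elim x)
      show ?case unfolding norm_scaleR using Z'[of x] elim order_trans[OF norm_ge_zero Z']
        by (intro mult_mono) auto
    qed
  qed (use G mv m\<zeta> in auto)
  have "(\<integral>x. dir_deriv b \<zeta> x *\<^sub>R v n x \<partial>lebesgue_on S) = - (\<integral>x. \<zeta> x *\<^sub>R dir_deriv b (v n) x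
      \<partial>lebesgue_on S)" for n
    by (rule integral_by_parts_test[OF S \<zeta> K v])
  then have "(\<lambda>n. - (\<integral>x. \<zeta> x *\<^sub>R dir_deriv b (v n) x \<partial>lebesgue_on S)) \<longlonglongrightarrow> 0"
    using 2 by simp
  from tendsto_minus[OF this]
  have "(\<lambda>n. \<integral>x. \<zeta> x *\<^sub>R dir_deriv b (v n) x \<partial>lebesgue_on S) \<longlonglongrightarrow> 0" by simp
  with 1 show "(\<integral>x. \<zeta> x *\<^sub>R w x \<partial>lebesgue_on S) = 0" by (rule LIMSEQ_unique)
qed

section \<open>Classical and weak derivatives\<close>

lemma norm_add_power2_le: "(norm (a + b))\<^sup>2 \<le> 2 * (norm a)\<^sup>2 + 2 * (norm (b::'b::real_normed_vector))\<^sup>2"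
proof -
  have "(norm (a + b))\<^sup>2 \<le> (norm a + norm b)\<^sup>2"
    by (intro power_mono norm_triangle_ineq) auto
  also have "\<dots> \<le> 2 * (norm a)\<^sup>2 + 2 * (norm b)\<^sup>2"
    using sum_squares_bound[of "norm a" "norm b"] by (simp add: power2_sum)
  finally show ?thesis .
qed

lemma L2_on_linear_comp:
  fixes f :: "real^3 \<Rightarrow> 'b::euclidean_space" and L :: "'b \<Rightarrow> 'c::euclidean_space"
  assumes L: "bounded_linear L" and f: "L2_on S f"
  shows "L2_on S (\<lambda>x. L (f x))"
proof -
  interpret L: bounded_linear L by (rule L)
  have "continuous_on UNIV L" using L.continuous_on continuous_on_id by blast
  then have mL: "L \<in> borel_measurable borel" by (rule borel_measurable_continuous_onI)
  then have m: "(\<lambda>x. L (f x)) \<in> borel_measurable (lebesgue_on S)"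
    using f measurable_compose[OF _ mL] unfolding L2_on_def by blast
  obtain C where C: "\<And>x. norm (L x) \<le> norm x * C" using L.bounded by blast
  have "integrable (lebesgue_on S) (\<lambda>x. (norm (L (f x)))\<^sup>2)"
  proof (rule Bochner_Integration.integrable_bound)
    show "integrable (lebesgue_on S) (\<lambda>x. C\<^sup>2 * (norm (f x))\<^sup>2)"
      using f by (simp add: L2_on_def)
    show "AE x in lebesgue_on S. norm ((norm (L (f x)))\<^sup>2) \<le> norm (C\<^sup>2 * (norm (f x))\<^sup>2)"
    proof (intro AE_I2)
      fix x
      have "(norm (L (f x)))\<^sup>2 \<le> (norm (f x) * C)\<^sup>2" by (intro power_mono C) auto
      then show "norm ((norm (L (f x)))\<^sup>2) \<le> norm (C\<^sup>2 * (norm (f x))\<^sup>2)"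
        by (simp add: power_mult_distrib mult.commute abs_mult)
    qed
  qed (use m in measurable)
  then show ?thesis using m by (simp add: L2_on_def)
qed

lemma L2_on_add:
  fixes f g :: "real^3 \<Rightarrow> 'b::euclidean_space"
  assumes f: "L2_on S f" and g: "L2_on S g"
  shows "L2_on S (\<lambda>x. f x + g x)"
proof -
  have m: "(\<lambda>x. f x + g x) \<in> borel_measurable (lebesgue_on S)"
    using f g unfolding L2_on_def by auto
  have "integrable (lebesgue_on S) (\<lambda>x. (norm (f x + g x))\<^sup>2)"
  proof (rule Bochner_Integration.integrable_bound)
    show "integrable (lebesgue_on S) (\<lambda>x. 2 * (norm (f x))\<^sup>2 + 2 * (norm (g x))\<^sup>2)"
      using f g by (simp add: L2_on_def)
    show "AE x in lebesgue_on S. norm ((norm (f x + g x))\<^sup>2) \<le> norm (2 * (norm (f x))\<^sup>2 + 2 * (norm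
        (g x))\<^sup>2)"
      by (intro AE_I2) (use norm_add_power2_le in force)
  qed (use m in measurable)
  then show ?thesis using m by (simp add: L2_on_def)
qed

lemma L2_on_cong:
  assumes "\<And>x. x \<in> S \<Longrightarrow> f x = g x"
  shows "L2_on S f \<longleftrightarrow> L2_on S g"
proof -
  have "f \<in> borel_measurable (lebesgue_on S) \<longleftrightarrow> g \<in> borel_measurable (lebesgue_on S)"
    by (rule measurable_cong) (use assms in simp)
  moreover have "integrable (lebesgue_on S) (\<lambda>x. (norm (f x))\<^sup>2) \<longleftrightarrow> integrable (lebesgue_on S) (\<lambda>x.
      (norm (g x))\<^sup>2)"
    by (rule Bochner_Integration.integrable_cong) (use assms in auto)
  ultimately show ?thesis by (simp add: L2_on_def)
qed

lemma L2_on_cong_AE: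
  assumes "AE x in lebesgue_on S. f x = g x" "g \<in> borel_measurable (lebesgue_on S)" "L2_on S f"
  shows "L2_on S g"
proof -
  have "integrable (lebesgue_on S) (\<lambda>x. (norm (f x))\<^sup>2) \<longleftrightarrow> integrable (lebesgue_on S) (\<lambda>x. (norm (g
      x))\<^sup>2)"
    by (rule integrable_cong_AE) (use assms in \<open>auto simp: L2_on_def\<close>)
  then show ?thesis using assms by (simp add: L2_on_def)
qed

lemma L2_on_subset:
  fixes f :: "real^3 \<Rightarrow> 'b::euclidean_space"
  assumes "L2_on S f" "T \<subseteq> S" "open S" "open T"
  shows "L2_on T f"
proof -
  have "f \<in> borel_measurable (lebesgue_on T)"
    using assms measurable_restrict_mono unfolding L2_on_def by blast
  moreover have "set_integrable lebesgue T (\<lambda>x. (norm (f x))\<^sup>2)"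
  proof (rule set_integrable_subset[of lebesgue S])
    show "set_integrable lebesgue S (\<lambda>x. (norm (f x))\<^sup>2)"
      using assms by (simp add: L2_on_def set_integrable_def integrable_restrict_space)
  qed (use assms in auto)
  ultimately show ?thesis
    using assms by (simp add: L2_on_def set_integrable_def integrable_restrict_space)
qed

text \<open>An H1 function whose weak derivatives are the classical ones. Working with values in
  place of equivalence classes makes the restriction to a single level above the graph
  meaningful.\<close>

definition H1_classical :: "(real^3) set \<Rightarrow> (real^3 \<Rightarrow> 'b::euclidean_space) \<Rightarrow> bool" where
  "H1_classical S f \<longleftrightarrow> Ck_on 1 S f \<and> L2_on S f \<and> (\<forall>b\<in>Basis. L2_on S (dir_deriv b f))"

lemma H1_classical_cong:
  assumes "open S" "\<And>x. x \<in> S \<Longrightarrow> f x = g x"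
  shows "H1_classical S f \<longleftrightarrow> H1_classical S g"
proof -
  have "L2_on S (dir_deriv b f) \<longleftrightarrow> L2_on S (dir_deriv b g)" for b
    by (rule L2_on_cong, rule dir_deriv_cong[OF assms(1)]) (use assms(2) in auto)
  moreover have "Ck_on 1 S f \<longleftrightarrow> Ck_on 1 S g" by (rule Ck_on_cong[OF assms])
  moreover have "L2_on S f \<longleftrightarrow> L2_on S g" by (rule L2_on_cong[OF assms(2)])
  ultimately show ?thesis unfolding H1_classical_def by (simp del: Ck_on.simps)
qed

lemma H1_classical_transform:
  assumes "open S" "H1_classical S g" "\<And>x. x \<in> S \<Longrightarrow> f x = g x"
  shows "H1_classical S f"
  using H1_classical_cong[OF assms(1,3)] assms(2) by simp

lemma H1_classical_linear_comp:
  fixes f :: "real^3 \<Rightarrow> 'b::euclidean_space" and L :: "'b \<Rightarrow> 'c::euclidean_space"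
  assumes L: "bounded_linear L" and S: "open S" and f: "H1_classical S f"
  shows "H1_classical S (\<lambda>x. L (f x))"
proof -
  have C: "Ck_on 1 S f" and d: "f differentiable_on S" using f by (auto simp: H1_classical_def)
  have "L2_on S (dir_deriv b (\<lambda>x. L (f x)))" if "b \<in> Basis" for b
    using L2_on_cong[of S "dir_deriv b (\<lambda>x. L (f x))" "\<lambda>x. L (dir_deriv b f x)"]
      dir_deriv_linear_comp[OF L d S] L2_on_linear_comp[OF L, of S "dir_deriv b f"] f that
    by (simp add: H1_classical_def)
  then show ?thesis
    using L2_on_linear_comp[OF L, of S f] Ck_on_linear_comp[OF L S C] f
    by (simp add: H1_classical_def)
qed

lemma H1_classical_add:
  fixes f g :: "real^3 \<Rightarrow> 'b::euclidean_space"
  assumes S: "open S" and f: "H1_classical S f" and g: "H1_classical S g"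
  shows "H1_classical S (\<lambda>x. f x + g x)"
proof -
  have C: "Ck_on 1 S f" "Ck_on 1 S g" and d: "f differentiable_on S" "g differentiable_on S"
    using f g by (auto simp: H1_classical_def)
  have "L2_on S (dir_deriv b (\<lambda>x. f x + g x))" if "b \<in> Basis" for b
    using L2_on_cong[of S "dir_deriv b (\<lambda>x. f x + g x)" "\<lambda>x. dir_deriv b f x + dir_deriv b g x"]
      dir_deriv_add[OF d S] L2_on_add[of S "dir_deriv b f" "dir_deriv b g"] f g that
    by (simp add: H1_classical_def)
  then show ?thesis
    using L2_on_add[of S f g] Ck_on_add[OF S C] f g by (simp add: H1_classical_def)
qed

lemma H1_classical_sum:
  fixes f :: "'i \<Rightarrow> real^3 \<Rightarrow> 'b::euclidean_space"
  assumes S: "open S" and "finite I" "I \<noteq> {}" and "\<And>i. i \<in> I \<Longrightarrow> H1_classical S (f i)"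
  shows "H1_classical S (\<lambda>x. \<Sum>i\<in>I. f i x)"
  using assms(2,3,4)
proof (induction rule: finite_ne_induct)
  case (insert i I)
  then show ?case using H1_classical_add[OF S, of "f i" "\<lambda>x. \<Sum>i\<in>I. f i x"] by simp
qed simp

lemma H1_classical_subset:
  assumes "H1_classical S f" "T \<subseteq> S" "open S" "open T"
  shows "H1_classical T f"
  using assms L2_on_subset Ck_on_subset unfolding H1_classical_def by blast

lemma H1_classical_Pair:
  fixes f :: "real^3 \<Rightarrow> 'b::euclidean_space" and g :: "real^3 \<Rightarrow> 'c::euclidean_space"
  assumes S: "open S" and f: "H1_classical S f" and g: "H1_classical S g"
  shows "H1_classical S (\<lambda>x. (f x, g x))"
proof -
  have "H1_classical S (\<lambda>x. (f x, 0) + (0, g x))"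
    by (intro H1_classical_add S H1_classical_linear_comp[OF _ S f, of "\<lambda>a. (a, 0)"]
        H1_classical_linear_comp[OF _ S g, of "\<lambda>a. (0, a)"] bounded_linear_Pair
        bounded_linear_ident bounded_linear_zero)
  then show ?thesis by simp
qed

lemma weak_deriv_classical:
  assumes "open S" "Ck_on 1 S f"
  shows "weak_deriv S b f (dir_deriv b f)"
  unfolding weak_deriv_def test_fun_def
  using integral_by_parts_test[OF assms(1) _ _ _ _ assms(2)] by blast

lemma integrable_on_finite_measure_L2:
  fixes g :: "real^3 \<Rightarrow> 'b::euclidean_space"
  assumes "L2_on S g" "bounded S" "open S"
  shows "integrable (lebesgue_on S) g"
proof (rule Bochner_Integration.integrable_bound)
  interpret finite_measure "lebesgue_on S"
    by (rule finite_measure_lebesgue_on[OF bounded_set_imp_lmeasurable])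
      (use assms in auto)
  show "integrable (lebesgue_on S) (\<lambda>x. 1 + (norm (g x))\<^sup>2)"
    using assms(1) by (simp add: L2_on_def)
  show "AE x in lebesgue_on S. norm (g x) \<le> norm (1 + (norm (g x))\<^sup>2)"
  proof (intro AE_I2)
    fix x
    show "norm (g x) \<le> norm (1 + (norm (g x))\<^sup>2)"
      using sum_squares_bound[of 1 "norm (g x)"] norm_ge_zero[of "g x"]
      by (simp add: abs_of_nonneg add_nonneg_nonneg del: norm_ge_zero)
  qed
qed (use assms in \<open>auto simp: L2_on_def\<close>)

text \<open>The fundamental lemma needs integrable functions, while the classical derivative need
  not be integrable up to the boundary of \<open>S\<close>. It is therefore applied in boxes whose
  closure lies in \<open>S\<close>; countably many of them suffice.\<close>

lemma weak_deriv_eq_classical: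
  fixes f g :: "real^3 \<Rightarrow> 'b::euclidean_space"
  assumes S: "open S" and f: "Ck_on 1 S f" and g: "L2_on S g" and w: "weak_deriv S b f g"
  shows "AE x in lebesgue_on S. g x = dir_deriv b f x"
proof -
  have box: "AE x in lebesgue. x \<in> box a c \<longrightarrow> g x = dir_deriv b f x" if ac: "cbox a c \<subseteq> S" for a c
  proof -
    let ?T = "box a c"
    have TS: "?T \<subseteq> S" using ac box_subset_cbox by blast
    have gT: "integrable (lebesgue_on ?T) g"
      by (intro integrable_on_finite_measure_L2 L2_on_subset[OF g TS S] bounded_box open_box)
    have c: "continuous_on S (dir_deriv b f)" by (rule continuous_on_dir_deriv[OF S f])
    have dT: "integrable (lebesgue_on ?T) (dir_deriv b f)"
    proof -
      have "integrable lborel (\<lambda>x. indicator (cbox a c) x *\<^sub>R dir_deriv b f x)"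
        using c ac by (intro borel_integrable_compact) (auto intro: continuous_on_subset)
      then have "set_integrable lebesgue (cbox a c) (dir_deriv b f)"
        unfolding set_integrable_def using borel_measurable_integrable integrable_completion by blast
      then have "set_integrable lebesgue ?T (dir_deriv b f)"
        by (rule set_integrable_subset) (auto simp: box_subset_cbox)
      then show ?thesis by (simp add: set_integrable_def integrable_restrict_space)
    qed
    have "AE x in lebesgue_on ?T. g x - dir_deriv b f x = 0"
    proof (rule AE_eq_0_if_test_integrals_0[OF open_box])
      show "integrable (lebesgue_on ?T) (\<lambda>x. g x - dir_deriv b f x)"
        using gT dT by auto
      fix \<zeta> :: "real^3 \<Rightarrow> real" and K
      assume \<zeta>: "Ck_on 1 UNIV \<zeta>" and K: "compact K" "K \<subseteq> ?T" "\<And>x. x \<notin> K \<Longrightarrow> \<zeta> x = 0"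
      have KS: "K \<subseteq> S" using K TS by blast
      have "test_fun S \<zeta>" using \<zeta> K KS unfolding test_fun_def by blast
      then have 1: "(\<integral>x. dir_deriv b \<zeta> x *\<^sub>R f x \<partial>lebesgue_on S) = - (\<integral>x. \<zeta> x *\<^sub>R g x \<partial>lebesgue_on S)"
        using w unfolding weak_deriv_def by blast
      have 2: "(\<integral>x. dir_deriv b \<zeta> x *\<^sub>R f x \<partial>lebesgue_on S) = - (\<integral>x. \<zeta> x *\<^sub>R dir_deriv b f x
          \<partial>lebesgue_on S)"
        by (rule integral_by_parts_test[OF S \<zeta> K(1) KS K(3) f])
      have sub: "(\<integral>x. \<zeta> x *\<^sub>R u x \<partial>lebesgue_on S) = (\<integral>x. \<zeta> x *\<^sub>R u x \<partial>lebesgue_on ?T)"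
        for u :: "real^3 \<Rightarrow> 'b"
      proof -
        have *: "(\<lambda>x. indicat_real S x *\<^sub>R (\<zeta> x *\<^sub>R u x)) = (\<lambda>x. indicator ?T x *\<^sub>R (\<zeta> x *\<^sub>R u x))"
        proof
          fix x
          show "indicat_real S x *\<^sub>R (\<zeta> x *\<^sub>R u x) = indicator ?T x *\<^sub>R (\<zeta> x *\<^sub>R u x)"
            using K TS by (cases "x \<in> K") (auto simp: indicator_def)
        qed
        have "S \<inter> space lebesgue \<in> sets lebesgue" "?T \<inter> space lebesgue \<in> sets lebesgue"
          using S by auto
        note ir = this[THEN integral_restrict_space, of "\<lambda>x. \<zeta> x *\<^sub>R u x"]
        show ?thesis unfolding ir * ..
      qed
      have \<zeta>c: "continuous_on UNIV \<zeta>" by (rule Ck_on_imp_continuous_on[OF \<zeta>])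
      have int: "integrable (lebesgue_on ?T) (\<lambda>x. \<zeta> x *\<^sub>R u x)"
        if "integrable (lebesgue_on ?T) u" for u :: "real^3 \<Rightarrow> 'b"
      proof -
        have "bounded (\<zeta> ` cbox a c)" using \<zeta>c
          by (intro compact_imp_bounded compact_continuous_image) (auto intro: continuous_on_subset)
        then obtain Z where Z: "\<And>x. x \<in> cbox a c \<Longrightarrow> norm (\<zeta> x) \<le> Z" by (auto simp: bounded_pos)
        show ?thesis
        proof (rule Bochner_Integration.integrable_bound)
          show "integrable (lebesgue_on ?T) (\<lambda>x. Z * norm (u x))" using that by simp
          have "\<zeta> \<in> borel_measurable (lebesgue_on ?T)"
            by (rule borel_measurable_lebesgue_on_continuous) (use \<zeta>c in \<open>auto intro:
                continuous_on_subset\<close>)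
          then show "(\<lambda>x. \<zeta> x *\<^sub>R u x) \<in> borel_measurable (lebesgue_on ?T)"
            using that by auto
          show "AE x in lebesgue_on ?T. norm (\<zeta> x *\<^sub>R u x) \<le> norm (Z * norm (u x))"
          proof (intro AE_I2)
            fix x assume "x \<in> space (lebesgue_on ?T)"
            then have "norm (\<zeta> x) \<le> \<bar>Z\<bar>" using Z[of x] box_subset_cbox[of a c] by fastforce
            then show "norm (\<zeta> x *\<^sub>R u x) \<le> norm (Z * norm (u x))"
              by (simp add: abs_mult mult_right_mono)
          qed
        qed
      qed
      have "(\<integral>x. \<zeta> x *\<^sub>R (g x - dir_deriv b f x) \<partial>lebesgue_on ?T)
        = (\<integral>x. \<zeta> x *\<^sub>R g x \<partial>lebesgue_on ?T) - (\<integral>x. \<zeta> x *\<^sub>R dir_deriv b f x \<partial>lebesgue_on ?T)"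
        unfolding scaleR_diff_right by (rule Bochner_Integration.integral_diff[OF int[OF gT] int[OF
            dT]])
      also have "\<dots> = 0" using 1 2 unfolding sub by simp
      finally show "(\<integral>x. \<zeta> x *\<^sub>R (g x - dir_deriv b f x) \<partial>lebesgue_on ?T) = 0" .
    qed
    then show ?thesis by (subst (asm) AE_restrict_space_iff) auto
  qed
  obtain D where D: "countable D" "\<And>X. X \<in> D \<Longrightarrow> X \<subseteq> S" "\<And>X. X \<in> D \<Longrightarrow> \<exists>a c. X = cbox a c" "\<Union>D = S"
    by (rule open_countable_Union_open_cbox[OF S]) blast
  have "AE x in lebesgue. \<forall>X\<in>D. x \<in> interior X \<longrightarrow> g x = dir_deriv b f x"
    unfolding AE_ball_countable[OF D(1)]
  proof
    fix X assume "X \<in> D"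
    then obtain a c where X: "X = cbox a c" "cbox a c \<subseteq> S" using D by blast
    show "AE x in lebesgue. x \<in> interior X \<longrightarrow> g x = dir_deriv b f x"
      unfolding X(1) interior_cbox by (rule box[OF X(2)])
  qed
  \<comment> \<open>The closed boxes cover \<open>S\<close>, but their interiors need not; the faces
    of countably many boxes are discarded as a null set.\<close>
  moreover have "AE x in lebesgue. \<forall>X\<in>D. x \<notin> X - interior X"
    unfolding AE_ball_countable[OF D(1)]
  proof
    fix X assume "X \<in> D"
    then obtain a c where X: "X = cbox a c" using D by blast
    show "AE x in lebesgue. x \<notin> X - interior X"
      unfolding X interior_cbox
      using null_sets_cbox_Diff_box by (intro AE_not_in null_sets_completionI) auto
  qed
  ultimately have "AE x in lebesgue. x \<in> S \<longrightarrow> g x = dir_deriv b f x"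
  proof eventually_elim
    case (elim x)
    show ?case
    proof
      assume "x \<in> S"
      then obtain X where "X \<in> D" "x \<in> X" using D(4) by blast
      with elim show "g x = dir_deriv b f x" by blast
    qed
  qed
  then show ?thesis using S by (subst AE_restrict_space_iff) auto
qed

primrec derivs_L2 :: "nat \<Rightarrow> (real^3) set \<Rightarrow> (real^3 \<Rightarrow> 'b::euclidean_space) \<Rightarrow> bool" where
  "derivs_L2 0 S f \<longleftrightarrow> L2_on S f"
| "derivs_L2 (Suc k) S f \<longleftrightarrow> L2_on S f \<and> (\<forall>b\<in>Basis. derivs_L2 k S (dir_deriv b f))"

text \<open>The induction carries a representative \<open>f'\<close> because \<open>Hk_on\<close>
  only provides some weak derivative \<open>g\<close>, which equals the classical derivative almost
  everywhere; \<open>g\<close> becomes the representative for the next order.\<close>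

lemma Hk_on_imp_derivs_L2:
  fixes f f' :: "real^3 \<Rightarrow> 'b::euclidean_space"
  assumes S: "open S"
  shows "Ck_on k S f \<Longrightarrow> AE x in lebesgue_on S. f' x = f x \<Longrightarrow> Hk_on k S f' \<Longrightarrow> derivs_L2 k S f"
proof (induction k arbitrary: f f')
  case 0
  have "f \<in> borel_measurable (lebesgue_on S)"
    using borel_measurable_lebesgue_on_continuous[OF S] 0 by simp
  then show ?case using L2_on_cong_AE[OF 0(2)] 0 by simp
next
  case (Suc k)
  have C1: "Ck_on 1 S f"
    by (rule Ck_on_mono[OF Suc.prems(1)]) simp
  have mf: "f \<in> borel_measurable (lebesgue_on S)"
    using borel_measurable_lebesgue_on_continuous[OF S Ck_on_imp_continuous_on[OF C1]] .
  have L2: "L2_on S f" "L2_on S f'" using L2_on_cong_AE[OF Suc.prems(2) mf] Suc.prems by auto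
  have "derivs_L2 k S (dir_deriv b f)" if b: "b \<in> Basis" for b
  proof -
    obtain g where g: "Hk_on k S g" "weak_deriv S b f' g" using Suc.prems(3) b by auto
    have "L2_on S g" using g(1) by (cases k) auto
    have "weak_deriv S b f g"
      unfolding weak_deriv_def
    proof (intro allI impI)
      fix \<eta> assume \<eta>: "test_fun S \<eta>"
      have "continuous_on UNIV (dir_deriv b \<eta>)"
        using \<eta> continuous_on_dir_deriv[OF open_UNIV] unfolding test_fun_def by blast
      then have m\<eta>: "dir_deriv b \<eta> \<in> borel_measurable (lebesgue_on S)"
        using S by (intro borel_measurable_lebesgue_on_continuous) (auto intro: continuous_on_subset)
      have "(\<integral>x. dir_deriv b \<eta> x *\<^sub>R f x \<partial>lebesgue_on S) = (\<integral>x. dir_deriv b \<eta> x *\<^sub>R f' x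
          \<partial>lebesgue_on S)"
        by (rule integral_cong_AE) (use Suc.prems(2) m\<eta> mf L2 in \<open>auto simp: L2_on_def\<close>)
      then show "(\<integral>x. dir_deriv b \<eta> x *\<^sub>R f x \<partial>lebesgue_on S) = - (\<integral>x. \<eta> x *\<^sub>R g x \<partial>lebesgue_on S)"
        using g(2) \<eta> unfolding weak_deriv_def by simp
    qed
    then have "AE x in lebesgue_on S. g x = dir_deriv b f x"
      by (rule weak_deriv_eq_classical[OF S C1 \<open>L2_on S g\<close>])
    then show ?thesis using Suc.IH[OF _ _ g(1)] Suc.prems(1) b by simp
  qed
  then show ?case using L2 by simp
qed

lemma derivs_L2_imp_H1_classical:
  assumes "Ck_on (Suc k) S f" "derivs_L2 (Suc k) S f"
  shows "H1_classical S f"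
proof -
  have "L2_on S (dir_deriv b f)" if "b \<in> Basis" for b
    using assms that by (cases k) auto
  moreover have "Ck_on 1 S f"
    by (rule Ck_on_mono[OF assms(1)]) simp
  ultimately show ?thesis using assms(2) by (simp add: H1_classical_def)
qed

section \<open>Volume in graph coordinates\<close>

text \<open>Fundamental theorem of calculus followed by Cauchy-Schwarz. The form in
  \<open>ennreal\<close> can afterwards be integrated over the base points of the fibres.\<close>

lemma norm_increment_power2_le:
  fixes u :: "real \<Rightarrow> 'b::euclidean_space"
  assumes ab: "a \<le> b" and u: "\<And>t. t \<in> {a..b} \<Longrightarrow> (u has_vector_derivative u' t) (at t within {a..b})"
    and c: "continuous_on {a..b} u'"
  shows "ennreal ((norm (u b - u a))\<^sup>2)
    \<le> ennreal (b - a) * (\<integral>\<^sup>+t. ennreal ((norm (u' t))\<^sup>2) * indicator {a..b} t \<partial>lborel)"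
proof -
  define I where "I = integral {a..b} (\<lambda>t. norm (u' t))"
  have "(u' has_integral (u b - u a)) {a..b}"
    by (rule fundamental_theorem_of_calculus[OF ab u])
  then have "u b - u a = integral {a..b} u'" by (simp add: integral_unique)
  moreover have cn: "continuous_on {a..b} (\<lambda>t. norm (u' t))" using c by (intro continuous_intros)
  ultimately have "norm (u b - u a) \<le> I" unfolding I_def
    using c by (auto intro!: integral_norm_bound_integral integrable_continuous_real)
  then have le: "(norm (u b - u a))\<^sup>2 \<le> I\<^sup>2" by (intro power_mono) auto
  have I0: "I \<ge> 0" using \<open>norm (u b - u a) \<le> I\<close> norm_ge_zero order_trans by blast
  have "((\<lambda>t. norm (u' t)) has_integral I) {a..b}"
    unfolding I_def by (intro integrable_integral integrable_continuous_real cn)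
  then have I: "(\<integral>\<^sup>+t. ennreal (norm (u' t)) * indicator {a..b} t \<partial>lborel) = ennreal I"
    by (intro nn_integral_has_integral_lebesgue') auto
  have m: "(\<lambda>t. ennreal (norm (u' t)) * indicator {a..b} t) \<in> borel_measurable lborel"
  proof -
    have "(\<lambda>t. indicator {a..b} t *\<^sub>R norm (u' t)) \<in> borel_measurable borel"
      by (rule borel_measurable_continuous_on_indicator[OF _ cn]) auto
    then have "(\<lambda>t. ennreal (indicator {a..b} t *\<^sub>R norm (u' t))) \<in> borel_measurable lborel"
      by (intro measurable_compose[OF _ measurable_ennreal]) auto
    moreover have "ennreal (indicator {a..b} t *\<^sub>R norm (u' t)) = ennreal (norm (u' t)) * indicator
        {a..b} t" for t
      by (auto simp: indicator_def)
    ultimately show ?thesis by (simp only:)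
  qed
  \<comment> \<open>The indicator is doubled so that one copy serves as the second factor in
    Cauchy-Schwarz; its square integral is \<open>b - a\<close>.\<close>
  have "(ennreal I)\<^sup>2 = (\<integral>\<^sup>+t. (ennreal (norm (u' t)) * indicator {a..b} t) * indicator {a..b} t
      \<partial>lborel)\<^sup>2"
    unfolding I[symmetric] by (intro arg_cong[where f="\<lambda>x. x\<^sup>2"] nn_integral_cong) (auto simp:
        indicator_def)
  also have "\<dots> \<le> (\<integral>\<^sup>+t. (ennreal (norm (u' t)) * indicator {a..b} t)\<^sup>2 \<partial>lborel)
      * (\<integral>\<^sup>+t. (indicator {a..b} t)\<^sup>2 \<partial>lborel)"
    by (rule Cauchy_Schwarz_nn_integral[OF m]) auto
  also have "(\<integral>\<^sup>+t. (indicator {a..b} t)\<^sup>2 \<partial>lborel) = (\<integral>\<^sup>+t. indicator {a..b} t \<partial>lborel)"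
    by (intro nn_integral_cong) (auto simp: indicator_def)
  also have "\<dots> = ennreal (b - a)" using ab by simp
  also have "(\<integral>\<^sup>+t. (ennreal (norm (u' t)) * indicator {a..b} t)\<^sup>2 \<partial>lborel)
      = (\<integral>\<^sup>+t. ennreal ((norm (u' t))\<^sup>2) * indicator {a..b} t \<partial>lborel)"
    by (intro nn_integral_cong) (auto simp: indicator_def ennreal_power)
  finally have "(ennreal I)\<^sup>2 \<le> (\<integral>\<^sup>+t. ennreal ((norm (u' t))\<^sup>2) * indicator {a..b} t \<partial>lborel) *
      ennreal (b - a)" .
  moreover have "ennreal ((norm (u b - u a))\<^sup>2) \<le> (ennreal I)\<^sup>2"
    using le I0 by (simp add: ennreal_power ennreal_leI)
  ultimately show ?thesis by (simp add: mult.commute)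
qed

section \<open>Linear isometries onto three-space preserve Lebesgue measure\<close>

lemma Basis_3: "(Basis :: (real^3) set) = {axis 1 1, axis 2 1, axis 3 1}"
  by (auto simp: Basis_vec_def UNIV_3)

lemma Basis_2: "(Basis :: (real^2) set) = {axis 1 1, axis 2 1}"
  by (auto simp: Basis_vec_def UNIV_2)

text \<open>A measure that gives boxes their volume is \<open>lborel\<close>, and the coordinate map
  pulls boxes of \<open>real^3\<close> back to boxes of the product type with the same side
  lengths.\<close>

lemma lborel_distr_coordinates:
  "distr lborel borel (\<lambda>z::(real^2) \<times> real. vector [fst z $ 1, fst z $ 2, snd z] :: real^3) = lborel"
proof (rule lborel_eqI[symmetric])
  let ?\<psi> = "\<lambda>z::(real^2) \<times> real. vector [fst z $ 1, fst z $ 2, snd z] :: real^3"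
  have "linear ?\<psi>"
    by (intro linearI) (simp_all add: vec_eq_iff forall_3)
  then have m: "?\<psi> \<in> borel_measurable lborel"
    using borel_measurable_continuous_onI[OF linear_continuous_on] by (simp add:
        linear_conv_bounded_linear)
  fix l u :: "real^3" assume lu: "\<And>b. b \<in> Basis \<Longrightarrow> l \<bullet> b \<le> u \<bullet> b"
  let ?l = "(vector [l$1, l$2], l$3) :: (real^2) \<times> real" and ?u = "(vector [u$1, u$2], u$3) ::
      (real^2) \<times> real"
  have *: "?\<psi> -` box l u = box ?l ?u"
    by (auto simp: mem_box Basis_prod_def Basis_3 Basis_2 inner_axis)
  have lu': "l$1 \<le> u$1" "l$2 \<le> u$2" "l$3 \<le> u$3"
    using lu[of "axis 1 1"] lu[of "axis 2 1"] lu[of "axis 3 1"] by (auto simp: Basis_3 inner_axis)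
  have "emeasure (distr lborel borel ?\<psi>) (box l u) = emeasure lborel (box ?l ?u)"
    using m by (simp add: emeasure_distr *)
  also have "\<dots> = (\<Prod>b\<in>Basis. (?u - ?l) \<bullet> b)"
    by (rule emeasure_lborel_box) (use lu' in \<open>auto simp: Basis_prod_def Basis_2 inner_axis\<close>)
  also have "(\<Prod>b\<in>Basis. (?u - ?l) \<bullet> b) = (u$1 - l$1) * (u$2 - l$2) * (u$3 - l$3)"
  proof -
    have B: "(Basis :: ((real^2) \<times> real) set) = {(axis 1 1, 0), (axis 2 1, 0), (0, 1)}"
      by (auto simp: Basis_prod_def Basis_2)
    show ?thesis unfolding B by (simp add: inner_axis axis_eq_axis)
  qed
  also have "\<dots> = (\<Prod>b\<in>Basis. (u - l) \<bullet> b)"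
    by (simp add: Basis_3 inner_axis axis_eq_axis inner_diff_left)
  finally show "emeasure (distr lborel borel ?\<psi>) (box l u) = (\<Prod>b\<in>Basis. (u - l) \<bullet> b)" .
qed simp

lemma lborel_distr_orthogonal_transformation:
  fixes A :: "real^'n::{finite,wellorder} \<Rightarrow> real^'n::_"
  assumes A: "orthogonal_transformation A"
  shows "distr lborel borel A = lborel"
proof (rule lborel_eqI[symmetric])
  have m: "A \<in> borel_measurable lborel"
    using borel_measurable_continuous_onI[OF linear_continuous_on]
        orthogonal_transformation_linear[OF A]
    by (simp add: linear_conv_bounded_linear)
  fix l u :: "real^'n::_" assume lu: "\<And>b. b \<in> Basis \<Longrightarrow> l \<bullet> b \<le> u \<bullet> b"
  have iA: "orthogonal_transformation (inv A)" using A by (rule orthogonal_transformation_inv)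
  have "A -` box l u = inv A ` box l u"
    using orthogonal_transformation_bij[OF A] by (simp add: bij_vimage_eq_inv_image)
  then have "emeasure (distr lborel borel A) (box l u) = emeasure lborel (A -` box l u)"
    using m by (simp add: emeasure_distr)
  also have "\<dots> = emeasure lebesgue (A -` box l u)"
    using measurable_sets[OF m, of "box l u"] by simp
  also have "\<dots> = emeasure lebesgue (inv A ` box l u)"
    using orthogonal_transformation_bij[OF A] by (simp add: bij_vimage_eq_inv_image)
  also have "\<dots> = ennreal (measure lebesgue (inv A ` box l u))"
    using measurable_orthogonal_image[OF iA lmeasurable_box] by (simp add: emeasure_eq_measure2)
  also have "\<dots> = ennreal (measure lebesgue (box l u))"
    by (simp add: measure_orthogonal_image[OF iA lmeasurable_box])
  also have "\<dots> = (\<Prod>b\<in>Basis. (u - l) \<bullet> b)"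
    using lu by (simp add: measure_lborel_box_eq)
  finally show "emeasure (distr lborel borel A) (box l u) = (\<Prod>b\<in>Basis. (u - l) \<bullet> b)" .
qed simp

text \<open>Source and target are different types. The map factors as the coordinate identification
  \<open>?\<psi>\<close> followed by an orthogonal transformation \<open>?A\<close> of
  \<open>real^3\<close>, and both preserve volume.\<close>

lemma lborel_distr_linear_isometry:
  fixes \<phi> :: "(real^2) \<times> real \<Rightarrow> real^3"
  assumes l: "linear \<phi>" and n: "\<And>z. norm (\<phi> z) = norm z"
  shows "distr lborel borel \<phi> = lborel"
proof -
  let ?\<psi> = "\<lambda>z::(real^2) \<times> real. vector [fst z $ 1, fst z $ 2, snd z] :: real^3"
  let ?\<theta> = "\<lambda>v::real^3. (vector [v$1, v$2], v$3) :: (real^2) \<times> real"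
  let ?A = "\<lambda>v. \<phi> (?\<theta> v)"
  have \<theta>: "linear ?\<theta>"
    by (intro linearI) (simp_all add: vec_eq_iff forall_2)
  have \<psi>: "linear ?\<psi>"
    by (intro linearI) (simp_all add: vec_eq_iff forall_3)
  have "linear ?A" using linear_compose[OF \<theta> l] by (simp add: o_def)
  moreover have "norm (?A v) = norm v" for v
    unfolding n by (simp add: norm_Pair norm_eq_sqrt_inner inner_vec_def sum_2 sum_3)
  ultimately have A: "orthogonal_transformation ?A" by (simp add: orthogonal_transformation)
  have eq: "?A \<circ> ?\<psi> = \<phi>"
  proof
    fix z :: "(real^2) \<times> real"
    have "?\<theta> (?\<psi> z) = z" by (auto simp: prod_eq_iff vec_eq_iff forall_2)
    then show "(?A \<circ> ?\<psi>) z = \<phi> z" by simp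
  qed
  have mA: "?A \<in> borel_measurable borel" "?\<psi> \<in> borel_measurable borel"
    using borel_measurable_continuous_onI[OF linear_continuous_on] \<open>linear ?A\<close> \<psi>
    by (simp_all add: linear_conv_bounded_linear)
  have "distr lborel borel (?A \<circ> ?\<psi>) = distr (distr lborel borel ?\<psi>) borel ?A"
    using mA by (intro distr_distr[symmetric]) auto
  then show ?thesis unfolding eq
    by (simp only: lborel_distr_coordinates lborel_distr_orthogonal_transformation[OF A])
qed

text \<open>For fixed \<open>y\<close> the inner integral is invariant under translation by
  \<open>h y\<close>, which removes \<open>h\<close>; what remains is Tonelli and the isometry.
  Arguing fibre by fibre lets \<open>h\<close> be an arbitrary function.\<close>

lemma nn_integral_graph_coordinates:
  fixes \<phi> :: "(real^2) \<times> real \<Rightarrow> real^3" and k :: "real^3 \<Rightarrow> ennreal"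
  assumes l: "linear \<phi>" and n: "\<And>z. norm (\<phi> z) = norm z" and k: "k \<in> borel_measurable borel"
  shows "(\<integral>\<^sup>+y. \<integral>\<^sup>+\<tau>. k (p + \<phi> (y, h y + \<tau>)) \<partial>lborel \<partial>lborel) = (\<integral>\<^sup>+x. k x \<partial>lborel)"
proof -
  have m\<phi>: "(\<lambda>z. p + \<phi> z) \<in> borel_measurable borel"
    using borel_measurable_continuous_onI[OF linear_continuous_on] l
    by (intro borel_measurable_add) (simp_all add: linear_conv_bounded_linear)
  have mk: "(\<lambda>z. k (p + \<phi> z)) \<in> borel_measurable borel"
    using measurable_compose[OF m\<phi> k] .
  have slice: "(\<lambda>t. k (p + \<phi> (y, t))) \<in> borel_measurable borel" for y
  proof (rule measurable_compose[OF _ mk])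
    show "(\<lambda>t. (y, t)) \<in> borel \<rightarrow>\<^sub>M borel"
      by (intro borel_measurable_continuous_onI continuous_intros)
  qed
  have "(\<integral>\<^sup>+\<tau>. k (p + \<phi> (y, h y + \<tau>)) \<partial>lborel) = (\<integral>\<^sup>+t. k (p + \<phi> (y, t)) \<partial>lborel)" for y
  proof -
    have "(\<integral>\<^sup>+t. k (p + \<phi> (y, t)) \<partial>lborel) = (\<integral>\<^sup>+t. k (p + \<phi> (y, t)) \<partial>distr lborel borel ((+) (h y)))"
      by (simp add: lborel_distr_plus)
    also have "\<dots> = (\<integral>\<^sup>+\<tau>. k (p + \<phi> (y, h y + \<tau>)) \<partial>lborel)"
      by (subst nn_integral_distr) (use slice in auto)
    finally show ?thesis ..
  qed
  then have "(\<integral>\<^sup>+y. \<integral>\<^sup>+\<tau>. k (p + \<phi> (y, h y + \<tau>)) \<partial>lborel \<partial>lborel) = (\<integral>\<^sup>+y. \<integral>\<^sup>+t. k (p + \<phi> (y, t))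
      \<partial>lborel \<partial>lborel)"
    by simp
  also have "\<dots> = (\<integral>\<^sup>+z. k (p + \<phi> z) \<partial>lborel)"
    using lborel.nn_integral_fst[of "\<lambda>z. k (p + \<phi> z)" "lborel :: (real^2) measure"] mk
    by (simp add: lborel_prod)
  also have "\<dots> = (\<integral>\<^sup>+x. k (p + x) \<partial>distr lborel borel \<phi>)"
    using k l by (subst nn_integral_distr)
      (auto simp: linear_conv_bounded_linear intro!: borel_measurable_continuous_onI
          linear_continuous_on
        measurable_compose[OF _ k])
  also have "\<dots> = (\<integral>\<^sup>+x. k (p + x) \<partial>lborel)"
    by (simp only: lborel_distr_linear_isometry[OF l n])
  also have "\<dots> = (\<integral>\<^sup>+x. k x \<partial>distr lborel borel ((+) p))"
    by (subst nn_integral_distr) (use k in auto)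
  also have "\<dots> = (\<integral>\<^sup>+x. k x \<partial>lborel)" by (simp only: lborel_distr_plus)
  finally show ?thesis .
qed

lemma nn_integral_lebesgue_on:
  assumes "open S"
  shows "(\<integral>\<^sup>+x. f x \<partial>lebesgue_on S) = (\<integral>\<^sup>+x. f x * indicator S x \<partial>lborel)"
proof -
  have S: "S \<inter> space lebesgue \<in> sets lebesgue" using assms by auto
  show ?thesis unfolding nn_integral_restrict_space[OF S] by (rule nn_integral_completion)
qed

section \<open>Traces as vertical limits\<close>

lemma open_above_graph:
  assumes l: "linear \<phi>" and n: "\<And>z. norm (\<phi> z) = norm z" and h: "continuous_on (ball 0 r) h"
  shows "open (above_graph p \<phi> r s h)"
proof -
  let ?A = "{z. fst z \<in> ball 0 r \<and> h (fst z) < snd z \<and> snd z < s} :: ((real^2) \<times> real) set"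
  have inj: "inj \<phi>"
    using n by (simp add: linear_injective_0[OF l]) (metis norm_eq_zero)
  have "surj \<phi>"
    by (rule linear_injective_imp_surjective[OF l inj]) simp
  have eq: "above_graph p \<phi> r s h = (+) p ` \<phi> ` ?A"
    unfolding above_graph_def by force
  have c: "continuous_on (ball 0 r \<times> UNIV) (\<lambda>z. snd z - h (fst z))"
    by (intro continuous_intros continuous_on_compose2[OF h]) auto
  have "open ((ball 0 r \<times> UNIV) \<inter> (\<lambda>z. snd z - h (fst z)) -` {0<..})"
    by (rule continuous_open_preimage[OF c]) (auto intro: open_Times)
  then have "open (((ball 0 r \<times> UNIV) \<inter> (\<lambda>z. snd z - h (fst z)) -` {0<..}) \<inter> (UNIV \<times> {..<s}))"
    by (rule open_Int) (auto intro!: open_Times)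
  also have "((ball 0 r \<times> UNIV) \<inter> (\<lambda>z. snd z - h (fst z)) -` {0<..}) \<inter> (UNIV \<times> {..<s}) = ?A"
    by auto
  finally show ?thesis unfolding eq
    by (intro open_translation open_surjective_linear_image l \<open>surj \<phi>\<close>)
qed

lemma L2_on_0: "L2_on S (\<lambda>x. 0)"
  by (simp add: L2_on_def)

lemma L2_on_sum:
  fixes f :: "'i \<Rightarrow> real^3 \<Rightarrow> 'b::euclidean_space"
  shows "(\<And>i. i \<in> I \<Longrightarrow> L2_on S (f i)) \<Longrightarrow> L2_on S (\<lambda>x. \<Sum>i\<in>I. f i x)"
  by (induction I rule: infinite_finite_induct) (simp_all add: L2_on_0 L2_on_add)

lemma H1_classical_L2_dir_deriv:
  fixes f :: "real^3 \<Rightarrow> 'b::euclidean_space"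
  assumes S: "open S" and f: "H1_classical S f"
  shows "L2_on S (dir_deriv v f)"
proof -
  have C: "Ck_on 1 S f" using f by (simp add: H1_classical_def)
  have "L2_on S (\<lambda>x. \<Sum>b\<in>Basis. (v \<bullet> b) *\<^sub>R dir_deriv b f x)"
    using f by (intro L2_on_sum L2_on_linear_comp[OF bounded_linear_scaleR_right]) (auto simp:
        H1_classical_def)
  then show ?thesis
    by (subst L2_on_cong[OF dir_deriv_eq_sum_Basis[OF S C]])
qed

lemma L2_on_nn_integral_finite:
  "L2_on S f \<Longrightarrow> (\<integral>\<^sup>+x. ennreal ((norm (f x))\<^sup>2) \<partial>lebesgue_on S) < \<infinity>"
  unfolding L2_on_def using integrableD(2)[of "lebesgue_on S" "\<lambda>x. (norm (f x))\<^sup>2"]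
  by (simp add: less_top)

lemma borel_measurable_ennreal_norm_power2_indicator:
  fixes u :: "'a::euclidean_space \<Rightarrow> 'b::euclidean_space"
  assumes "open S" "continuous_on S u"
  shows "(\<lambda>x. ennreal ((norm (u x))\<^sup>2) * indicator S x) \<in> borel_measurable borel"
proof -
  have "(\<lambda>x. indicator S x *\<^sub>R (norm (u x))\<^sup>2) \<in> borel_measurable borel"
    by (rule borel_measurable_continuous_on_indicator) (use assms in \<open>auto intro!: continuous_intros\<close>)
  then have "(\<lambda>x. ennreal (indicator S x *\<^sub>R (norm (u x))\<^sup>2)) \<in> borel_measurable borel"
    by (rule measurable_compose[OF _ measurable_ennreal])
  moreover have "ennreal (indicator S x *\<^sub>R (norm (u x))\<^sup>2) = ennreal ((norm (u x))\<^sup>2) * indicator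
      S x" for x
    by (auto simp: indicator_def)
  ultimately show ?thesis by (simp only:)
qed

text \<open>The given cylinder is shrunk to leave room above the graph. With
  \<open>\<bar>h y\<bar> < \<sigma>\<close>, the points less than \<open>2 * \<sigma>\<close> above
  the graph lie below \<open>3 * \<sigma> < s\<close>, and points below height
  \<open>\<sigma>\<close> remain below \<open>3 * \<sigma>\<close> when raised by at most
  \<open>\<sigma>\<close>. The strict \<open>r' < r\<close> makes the closed ball a compact subset
  of the domain of \<open>h\<close>.\<close>

locale boundary_chart =
  fixes D :: "(real^3) set" and p :: "real^3" and \<phi> :: "(real^2) \<times> real \<Rightarrow> real^3"
    and r s :: real and h :: "real^2 \<Rightarrow> real" and r' \<sigma> :: real
  assumes chart: "graph_chart D p \<phi> r s h" and C1_h: "Ck_on 1 (ball 0 r) h"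
    and r': "0 < r'" "r' < r" and \<sigma>: "0 < \<sigma>" "3 * \<sigma> < s"
    and h_less: "\<And>y. y \<in> cball 0 r' \<Longrightarrow> \<bar>h y\<bar> < \<sigma>"
begin

definition vert :: "real^3" where "vert = \<phi> (0, 1)"

definition lift :: "real^2 \<Rightarrow> real \<Rightarrow> real^3" where "lift y \<tau> = p + \<phi> (y, h y + \<tau>)"

abbreviation B :: "(real^2) set" where "B \<equiv> ball 0 r'"

abbreviation exterior :: "(real^3) set" where "exterior \<equiv> - closure D"

definition region :: "(real^3) set" where "region = above_graph p \<phi> r' (3 * \<sigma>) h"

lemma linear_\<phi>: "linear \<phi>" and norm_\<phi>: "norm (\<phi> z) = norm z"
  using chart unfolding graph_chart_def by blast+

lemma inner_\<phi>: "\<phi> z \<bullet> \<phi> w = z \<bullet> w"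
  using norm_\<phi>[of "z + w"] by (simp add: dot_norm norm_\<phi> flip: linear_add[OF linear_\<phi>])

lemma inj_\<phi>: "inj \<phi>"
  by (simp add: linear_injective_0[OF linear_\<phi>]) (metis norm_eq_zero norm_\<phi>)

lemma surj_\<phi>: "surj \<phi>"
  by (rule linear_injective_imp_surjective[OF linear_\<phi> inj_\<phi>]) simp

lemma continuous_on_h: "continuous_on (ball 0 r) h"
  by (rule Ck_on_imp_continuous_on[OF C1_h])

lemma continuous_on_\<phi>: "continuous_on S f \<Longrightarrow> continuous_on S (\<lambda>x. \<phi> (f x))"
  using linear_\<phi> bounded_linear.continuous_on linear_conv_bounded_linear by blast

lemma lift_add: "lift y (\<tau> + t) = lift y \<tau> + t *\<^sub>R vert"
proof -
  have "(y, h y + (\<tau> + t)) = (y, h y + \<tau>) + t *\<^sub>R (0, 1)" by simp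
  then show ?thesis unfolding lift_def vert_def
    by (simp only: linear_add[OF linear_\<phi>] linear_cmul[OF linear_\<phi>]) simp
qed

lemma lift_eq: "lift y \<tau> = lift y 0 + \<tau> *\<^sub>R vert"
  using lift_add[of y 0 \<tau>] by simp

lemma lift_fun_eq: "lift y = (\<lambda>\<tau>. lift y 0 + \<tau> *\<^sub>R vert)"
  using lift_eq by blast

lemma lift_0: "lift y 0 = graph_point p \<phi> h y"
  by (simp add: lift_def graph_point_def)

lemma B_subset: "B \<subseteq> ball 0 r" "cball 0 r' \<subseteq> ball 0 r" "B \<subseteq> cball 0 r'"
  using r' by auto

lemma continuous_on_lift: "continuous_on (ball 0 r \<times> UNIV) (\<lambda>z. lift (fst z) (snd z))"
  unfolding lift_def
  by (intro continuous_intros continuous_on_\<phi> continuous_on_compose2[OF continuous_on_h]) auto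

lemma continuous_on_lift_left: "continuous_on (ball 0 r) (\<lambda>y. lift y \<tau>)"
  unfolding lift_def by (intro continuous_intros continuous_on_\<phi> continuous_on_h)

text \<open>The chart only excludes \<open>D\<close>; since the set above the graph is open,
  disjointness from \<open>D\<close> gives disjointness from its closure.\<close>

lemma above_graph_subset_exterior:
  assumes "r1 \<le> r" "s1 \<le> s"
  shows "above_graph p \<phi> r1 s1 h \<subseteq> exterior"
proof -
  have sub: "above_graph p \<phi> r1 s1 h \<subseteq> above_graph p \<phi> r s h"
    using assms unfolding above_graph_def by force
  have "open (above_graph p \<phi> r s h)"
    by (rule open_above_graph[OF linear_\<phi> norm_\<phi> continuous_on_h])
  moreover have "above_graph p \<phi> r s h \<inter> D = {}"
  proof -
    have "p + \<phi> (y, t) \<notin> D" if "y \<in> ball 0 r" "h y < t" "t < s" for y t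
    proof -
      have "\<bar>h y\<bar> < s" using chart that by (auto simp: graph_chart_def)
      then have "t \<in> {-s<..<s}" using that by auto
      then show ?thesis using chart that unfolding graph_chart_def by fastforce
    qed
    then show ?thesis unfolding above_graph_def by blast
  qed
  ultimately have "above_graph p \<phi> r s h \<inter> closure D = {}"
    by (simp add: open_Int_closure_eq_empty)
  then show ?thesis using sub by blast
qed

lemma open_region: "open region"
  unfolding region_def using B_subset continuous_on_h
  by (intro open_above_graph[OF linear_\<phi> norm_\<phi>]) (auto intro: continuous_on_subset)

lemma region_subset: "region \<subseteq> exterior" "region \<subseteq> above_graph p \<phi> r s h"
  using above_graph_subset_exterior[of r' "3 * \<sigma>"] r' \<sigma>
  unfolding region_def above_graph_def by force+

lemma lift_in_above_graph: "y \<in> ball 0 r1 \<Longrightarrow> 0 < \<tau> \<Longrightarrow> h y + \<tau> < s1 \<Longrightarrow> lift y \<tau> \<in> above_graph p \<phi> r1 s1 h"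
  unfolding lift_def above_graph_def by force

lemma lift_in_region: "y \<in> B \<Longrightarrow> 0 < \<tau> \<Longrightarrow> \<tau> < 2 * \<sigma> \<Longrightarrow> lift y \<tau> \<in> region"
  unfolding region_def using h_less[of y] by (intro lift_in_above_graph) auto

lemma lift_in_exterior:
  "y \<in> ball 0 r \<Longrightarrow> 0 < \<tau> \<Longrightarrow> h y + \<tau> < s \<Longrightarrow> lift y \<tau> \<in> exterior"
  using lift_in_above_graph[of y r \<tau> s] above_graph_subset_exterior[of r s] by auto

lemma has_vector_derivative_lift:
  "((\<lambda>\<tau>. lift y \<tau>) has_vector_derivative vert) (at \<tau> within T)"
  by (subst lift_fun_eq) (auto intro!: derivative_eq_intros)

lemma fibre_increment_le:
  fixes f :: "real^3 \<Rightarrow> 'b::euclidean_space"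
  assumes V: "open V" and f: "Ck_on 1 V f" and t: "\<tau>1 \<le> \<tau>2" and sub: "\<And>\<tau>. \<tau> \<in> {\<tau>1..\<tau>2} \<Longrightarrow> lift y \<tau> \<in> V"
  shows "ennreal ((norm (f (lift y \<tau>2) - f (lift y \<tau>1)))\<^sup>2) \<le> ennreal (\<tau>2 - \<tau>1) *
    (\<integral>\<^sup>+\<tau>. ennreal ((norm (dir_deriv vert f (lift y \<tau>)))\<^sup>2) * indicator {\<tau>1..\<tau>2} \<tau> \<partial>lborel)"
proof (rule norm_increment_power2_le[OF t])
  fix \<tau> assume "\<tau> \<in> {\<tau>1..\<tau>2}"
  then have "(f has_derivative (\<lambda>b. dir_deriv b f (lift y \<tau>))) (at (lift y \<tau>))"
    by (intro Ck_on_1_has_derivative[OF V f] sub)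
  then have "(f has_derivative (\<lambda>b. dir_deriv b f (lift y \<tau>))) (at (lift y \<tau>) within lift y ` {\<tau>1..\<tau>2})"
    by (rule has_derivative_at_withinI)
  from vector_derivative_diff_chain_within[OF has_vector_derivative_lift this]
  show "((\<lambda>\<tau>. f (lift y \<tau>)) has_vector_derivative dir_deriv vert f (lift y \<tau>)) (at \<tau> within {\<tau>1..\<tau>2})"
    by (simp add: o_def)
next
  have "continuous_on {\<tau>1..\<tau>2} (lift y)"
    by (subst lift_fun_eq) (intro continuous_intros)
  then show "continuous_on {\<tau>1..\<tau>2} (\<lambda>\<tau>. dir_deriv vert f (lift y \<tau>))"
    using sub by (intro continuous_on_compose2[OF continuous_on_dir_deriv[OF V f]]) auto
qed

text \<open>The interval is open at 0 because the field is known only strictly above the graph. For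
  the vertical derivative this is the constant in the rate at which values along the fibre
  converge.\<close>

definition fibre_energy :: "(real^3 \<Rightarrow> 'b::euclidean_space) \<Rightarrow> real^2 \<Rightarrow> ennreal" where
  "fibre_energy u y = (\<integral>\<^sup>+\<tau>. ennreal ((norm (u (lift y \<tau>)))\<^sup>2) * indicator {0<..<\<sigma>} \<tau> \<partial>lborel)"

lemma borel_measurable_fibre_energy:
  fixes u :: "real^3 \<Rightarrow> 'b::euclidean_space"
  assumes u: "continuous_on region u"
  shows "fibre_energy u \<in> borel_measurable (lebesgue_on B)"
proof -
  have "(\<lambda>z. ennreal ((norm (u (lift (fst z) (snd z))))\<^sup>2) * indicator (B \<times> {0<..<\<sigma>}) z) \<in>
      borel_measurable borel"
  proof (rule borel_measurable_ennreal_norm_power2_indicator)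
    show "open (B \<times> {0<..<\<sigma>})" by (intro open_Times) auto
    have "continuous_on (B \<times> {0<..<\<sigma>}) (\<lambda>z. lift (fst z) (snd z))"
      by (rule continuous_on_subset[OF continuous_on_lift]) (use B_subset in auto)
    then show "continuous_on (B \<times> {0<..<\<sigma>}) (\<lambda>z. u (lift (fst z) (snd z)))"
      by (intro continuous_on_compose2[OF u]) (use \<sigma> in \<open>auto intro!: lift_in_region\<close>)
  qed
  then have "(\<lambda>(y, \<tau>). ennreal ((norm (u (lift y \<tau>)))\<^sup>2) * indicator (B \<times> {0<..<\<sigma>}) (y, \<tau>))
      \<in> borel_measurable (lborel \<Otimes>\<^sub>M lborel)"
    by (simp add: lborel_prod case_prod_unfold)
  then have "(\<lambda>y. \<integral>\<^sup>+\<tau>. ennreal ((norm (u (lift y \<tau>)))\<^sup>2) * indicator (B \<times> {0<..<\<sigma>}) (y, \<tau>) \<partial>lborel)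
      \<in> borel_measurable lborel"
    by (rule lborel.borel_measurable_nn_integral)
  moreover have "(\<integral>\<^sup>+\<tau>. ennreal ((norm (u (lift y \<tau>)))\<^sup>2) * indicator (B \<times> {0<..<\<sigma>}) (y, \<tau>) \<partial>lborel)
      = fibre_energy u y * indicator B y" for y
    by (cases "y \<in> B") (auto simp: fibre_energy_def indicator_def intro!: nn_integral_cong)
  ultimately have "(\<lambda>y. fibre_energy u y * indicator B y) \<in> borel_measurable lebesgue"
    by (auto intro: measurable_completion)
  then show ?thesis
    by (subst borel_measurable_restrict_space_iff_ennreal) auto
qed

text \<open>The fibres over \<open>B\<close> up to height \<open>\<sigma>\<close> lie in
  \<open>region\<close>, and graph coordinates preserve volume, so no Jacobian factor
  appears.\<close>

lemma nn_integral_fibre_energy_le: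
  fixes u :: "real^3 \<Rightarrow> 'b::euclidean_space"
  assumes u: "continuous_on region u"
  shows "(\<integral>\<^sup>+y. fibre_energy u y \<partial>lebesgue_on B) \<le> (\<integral>\<^sup>+x. ennreal ((norm (u x))\<^sup>2) \<partial>lebesgue_on region)"
proof -
  let ?k = "\<lambda>x. ennreal ((norm (u x))\<^sup>2) * indicator region x"
  have "(\<integral>\<^sup>+y. fibre_energy u y \<partial>lebesgue_on B) = (\<integral>\<^sup>+y. fibre_energy u y * indicator B y \<partial>lborel)"
    by (rule nn_integral_lebesgue_on) simp
  also have "\<dots> \<le> (\<integral>\<^sup>+y. \<integral>\<^sup>+\<tau>. ?k (p + \<phi> (y, h y + \<tau>)) \<partial>lborel \<partial>lborel)"
  proof (rule nn_integral_mono)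
    fix y
    show "fibre_energy u y * indicator B y \<le> (\<integral>\<^sup>+\<tau>. ?k (p + \<phi> (y, h y + \<tau>)) \<partial>lborel)"
    proof (cases "y \<in> B")
      case True
      have "fibre_energy u y \<le> (\<integral>\<^sup>+\<tau>. ?k (lift y \<tau>) \<partial>lborel)"
        unfolding fibre_energy_def
        by (intro nn_integral_mono) (use lift_in_region[OF True] \<sigma> in \<open>auto simp: indicator_def\<close>)
      then show ?thesis using True by (simp add: lift_def)
    qed simp
  qed
  also have "\<dots> = (\<integral>\<^sup>+x. ?k x \<partial>lborel)"
    by (rule nn_integral_graph_coordinates[OF linear_\<phi> norm_\<phi>])
      (rule borel_measurable_ennreal_norm_power2_indicator[OF open_region u])
  also have "\<dots> = (\<integral>\<^sup>+x. ennreal ((norm (u x))\<^sup>2) \<partial>lebesgue_on region)"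
    by (rule nn_integral_lebesgue_on[OF open_region, symmetric])
  finally show ?thesis .
qed

lemma fibre_increment_le_energy:
  fixes f :: "real^3 \<Rightarrow> 'b::euclidean_space"
  assumes V: "open V" and f: "Ck_on 1 V f" and t: "0 \<le> \<tau>1" "\<tau>1 \<le> \<tau>2" "\<tau>2 < \<sigma>"
    and sub: "\<And>\<tau>. \<tau> \<in> {\<tau>1..\<tau>2} \<Longrightarrow> lift y \<tau> \<in> V"
  shows "ennreal ((norm (f (lift y \<tau>2) - f (lift y \<tau>1)))\<^sup>2) \<le> ennreal (\<tau>2 - \<tau>1) * fibre_energy
      (dir_deriv vert f) y"
proof -
  note fibre_increment_le[OF V f t(2) sub]
  also have "(\<integral>\<^sup>+\<tau>. ennreal ((norm (dir_deriv vert f (lift y \<tau>)))\<^sup>2) * indicator {\<tau>1..\<tau>2} \<tau> \<partial>lborel)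
      \<le> fibre_energy (dir_deriv vert f) y"
    unfolding fibre_energy_def
  proof (rule nn_integral_mono_AE)
    have "AE \<tau> in lborel. \<tau> \<noteq> (0::real)" by (rule AE_lborel_singleton)
    then show "AE \<tau> in lborel. ennreal ((norm (dir_deriv vert f (lift y \<tau>)))\<^sup>2) * indicator {\<tau>1..\<tau>2} \<tau>
        \<le> ennreal ((norm (dir_deriv vert f (lift y \<tau>)))\<^sup>2) * indicator {0<..<\<sigma>} \<tau>"
      by eventually_elim (use t in \<open>auto simp: indicator_def\<close>)
  qed
  finally show ?thesis by (simp add: mult_left_mono)
qed

text \<open>One fixed sequence of levels tending to 0. The summand 2 puts the first level at
  \<open>\<sigma> / 2\<close>, strictly inside the fibre.\<close>

definition heights :: "nat \<Rightarrow> real" where "heights n = \<sigma> / (real n + 2)"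

lemma heights: "0 < heights n" "heights n < \<sigma>" "heights n \<le> \<sigma> / 2"
proof -
  have "0 \<le> real n * \<sigma>" using \<sigma> by simp
  then show "0 < heights n" "heights n < \<sigma>" "heights n \<le> \<sigma> / 2"
    using \<sigma> by (auto simp: heights_def field_simps add_pos_nonneg)
qed

lemma heights_tendsto_0: "heights \<longlonglongrightarrow> 0"
proof -
  have "filterlim (\<lambda>n. 2 + real n) at_top sequentially"
    by (rule filterlim_tendsto_add_at_top[OF tendsto_const filterlim_real_sequentially])
  then have "filterlim (\<lambda>n. real n + 2) at_infinity sequentially"
    by (simp add: add.commute filterlim_at_top_imp_at_infinity)
  then show ?thesis unfolding heights_def by (rule tendsto_divide_0[OF tendsto_const])
qed

text \<open>Taken along a sequence so that measurability in \<open>y\<close> follows from that of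
  sequential limits. Where the sequence diverges the value of \<open>lim\<close> carries no
  information, so later statements hold almost everywhere.\<close>

definition vertical_limit :: "(real^3 \<Rightarrow> 'b::euclidean_space) \<Rightarrow> real^2 \<Rightarrow> 'b" where
  "vertical_limit f y = lim (\<lambda>n. f (lift y (heights n)))"

text \<open>Finite energy makes the values along the fibre Cauchy: the squared increment between two
  levels is at most their distance times \<open>g\<close>. Letting one level tend to 0 gives the
  rate, also for heights \<open>\<tau>\<close> off the sequence.\<close>

lemma
  fixes f :: "real^3 \<Rightarrow> 'b::euclidean_space"
  assumes f: "Ck_on 1 region f" and y: "y \<in> B" and g: "fibre_energy (dir_deriv vert f) y = ennreal
      g" "0 \<le> g"
  shows vertical_limit_tendsto: "(\<lambda>n. f (lift y (heights n))) \<longlonglongrightarrow> vertical_limit f y"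
    and vertical_limit_dist: "0 < \<tau> \<Longrightarrow> \<tau> < \<sigma> \<Longrightarrow> (norm (f (lift y \<tau>) - vertical_limit f y))\<^sup>2 \<le> \<tau> * g"
proof -
  have le: "(norm (f (lift y \<tau>2) - f (lift y \<tau>1)))\<^sup>2 \<le> (\<tau>2 - \<tau>1) * g" if "0 < \<tau>1" "\<tau>1 \<le> \<tau>2" "\<tau>2 <
      \<sigma>" for \<tau>1 \<tau>2
  proof -
    have "ennreal ((norm (f (lift y \<tau>2) - f (lift y \<tau>1)))\<^sup>2) \<le> ennreal (\<tau>2 - \<tau>1) * ennreal g"
      unfolding g(1)[symmetric]
      by (rule fibre_increment_le_energy[OF open_region f]) (use that y \<sigma> in \<open>auto intro!:
          lift_in_region\<close>)
    also have "\<dots> = ennreal ((\<tau>2 - \<tau>1) * g)" using that g by (simp add: ennreal_mult)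
    finally show ?thesis using that g by (subst (asm) ennreal_le_iff) auto
  qed
  have le': "(norm (f (lift y \<tau>2) - f (lift y \<tau>1)))\<^sup>2 \<le> \<bar>\<tau>2 - \<tau>1\<bar> * g"
    if "0 < \<tau>1" "\<tau>1 < \<sigma>" "0 < \<tau>2" "\<tau>2 < \<sigma>" for \<tau>1 \<tau>2
    using le[of \<tau>1 \<tau>2] le[of \<tau>2 \<tau>1] that by (cases "\<tau>1 \<le> \<tau>2") (auto simp: norm_minus_commute)
  have "Cauchy (\<lambda>n. f (lift y (heights n)))"
  proof (rule metric_CauchyI)
    fix e :: real assume e: "e > 0"
    have "(\<lambda>n. heights n * g) \<longlonglongrightarrow> 0 * g"
      by (intro tendsto_intros heights_tendsto_0)
    then have "\<forall>\<^sub>F n in sequentially. heights n * g < e\<^sup>2"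
      using e by (intro order_tendstoD(2)[of _ "0 * g"]) auto
    then obtain N where N: "\<And>n. n \<ge> N \<Longrightarrow> heights n * g < e\<^sup>2"
      by (auto simp: eventually_sequentially)
    show "\<exists>M. \<forall>m\<ge>M. \<forall>n\<ge>M. dist (f (lift y (heights m))) (f (lift y (heights n))) < e"
    proof (intro exI allI impI)
      fix m n assume "N \<le> m" "N \<le> n"
      have "(norm (f (lift y (heights m)) - f (lift y (heights n))))\<^sup>2 \<le> \<bar>heights m - heights n\<bar> * g"
        by (rule le') (auto simp: heights)
      also have "\<dots> \<le> max (heights m) (heights n) * g"
        using heights(1)[of m] heights(1)[of n] g(2) by (intro mult_right_mono) auto
      also have "\<dots> < e\<^sup>2" using N[OF \<open>N \<le> m\<close>] N[OF \<open>N \<le> n\<close>] by (auto simp: max_def)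
      finally show "dist (f (lift y (heights m))) (f (lift y (heights n))) < e"
        using e power_less_imp_less_base[of _ 2 e] by (simp add: dist_norm)
    qed
  qed
  then show L: "(\<lambda>n. f (lift y (heights n))) \<longlonglongrightarrow> vertical_limit f y"
    unfolding vertical_limit_def using Cauchy_convergent convergent_LIMSEQ_iff by blast
  show "(norm (f (lift y \<tau>) - vertical_limit f y))\<^sup>2 \<le> \<tau> * g" if "0 < \<tau>" "\<tau> < \<sigma>"
  proof -
    have "(\<lambda>n. (norm (f (lift y \<tau>) - f (lift y (heights n))))\<^sup>2) \<longlonglongrightarrow> (norm (f (lift y \<tau>) -
        vertical_limit f y))\<^sup>2"
      by (intro tendsto_intros L)
    moreover have "(\<lambda>n. \<bar>\<tau> - heights n\<bar> * g) \<longlonglongrightarrow> \<bar>\<tau> - 0\<bar> * g"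
      by (intro tendsto_intros heights_tendsto_0)
    ultimately have "(norm (f (lift y \<tau>) - vertical_limit f y))\<^sup>2 \<le> \<bar>\<tau> - 0\<bar> * g"
      by (rule LIMSEQ_le) (use le' that heights in blast)
    then show ?thesis using that by simp
  qed
qed

lemma AE_fibre_energy_finite:
  fixes f :: "real^3 \<Rightarrow> 'b::euclidean_space"
  assumes f: "H1_classical region f"
  shows "AE y in lebesgue_on B. fibre_energy (dir_deriv vert f) y < \<infinity>"
proof -
  have "Ck_on 1 region f" using f by (simp add: H1_classical_def)
  then have c: "continuous_on region (dir_deriv vert f)" by (rule continuous_on_dir_deriv[OF
      open_region])
  have "(\<integral>\<^sup>+y. fibre_energy (dir_deriv vert f) y \<partial>lebesgue_on B) < \<infinity>"
    using nn_integral_fibre_energy_le[OF c]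
      L2_on_nn_integral_finite[OF H1_classical_L2_dir_deriv[OF open_region f, of vert]] by simp
  then show ?thesis
    using nn_integral_noteq_infinite[OF borel_measurable_fibre_energy[OF c]] by (simp add: less_top)
qed

lemma AE_vertical_limit_tendsto:
  fixes f :: "real^3 \<Rightarrow> 'b::euclidean_space"
  assumes f: "H1_classical region f"
  shows "AE y in lebesgue_on B. (\<lambda>n. f (lift y (heights n))) \<longlonglongrightarrow> vertical_limit f y"
  using AE_fibre_energy_finite[OF f] AE_space
proof eventually_elim
  case (elim y)
  then obtain g where "fibre_energy (dir_deriv vert f) y = ennreal g" "0 \<le> g"
    by (metis ennreal_cases less_irrefl infinity_ennreal_def)
  then show ?case using vertical_limit_tendsto[of f y g] f elim by (simp add: H1_classical_def)
qed

lemma AE_vertical_limit_dist: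
  fixes f :: "real^3 \<Rightarrow> 'b::euclidean_space"
  assumes f: "H1_classical region f"
  shows "AE y in lebesgue_on B. \<forall>\<tau>\<in>{0<..<\<sigma>}.
    ennreal ((norm (f (lift y \<tau>) - vertical_limit f y))\<^sup>2) \<le> ennreal \<tau> * fibre_energy (dir_deriv
        vert f) y"
  using AE_fibre_energy_finite[OF f] AE_space
proof eventually_elim
  case (elim y)
  then obtain g where g: "fibre_energy (dir_deriv vert f) y = ennreal g" "0 \<le> g"
    by (metis ennreal_cases less_irrefl infinity_ennreal_def)
  then show ?case using vertical_limit_dist[of f y g] f elim
    by (auto simp: H1_classical_def ennreal_leI simp flip: ennreal_mult)
qed

lemma borel_measurable_vertical_limit:
  fixes f :: "real^3 \<Rightarrow> 'b::euclidean_space"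
  assumes f: "continuous_on region f"
  shows "vertical_limit f \<in> borel_measurable (lebesgue_on B)"
  unfolding vertical_limit_def
proof (rule borel_measurable_lim_metric)
  fix n
  have "continuous_on B (\<lambda>y. lift y (heights n))"
    by (rule continuous_on_subset[OF continuous_on_lift_left B_subset(1)])
  then have "continuous_on B (\<lambda>y. f (lift y (heights n)))"
    using heights[of n] \<sigma> by (intro continuous_on_compose2[OF f]) (auto intro!: lift_in_region)
  then show "(\<lambda>y. f (lift y (heights n))) \<in> borel_measurable (lebesgue_on B)"
    by (intro borel_measurable_lebesgue_on_continuous) auto
qed

end

section \<open>Every trace agrees with the vertical limit\<close>

lemma nn_integral_lebesgue_on_mono:
  assumes "open S" "open T" "S \<subseteq> T"
  shows "(\<integral>\<^sup>+x. f x \<partial>lebesgue_on S) \<le> (\<integral>\<^sup>+x. f x \<partial>lebesgue_on T)"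
  unfolding nn_integral_lebesgue_on[OF assms(1)] nn_integral_lebesgue_on[OF assms(2)]
  by (intro nn_integral_mono) (use assms(3) in \<open>auto simp: indicator_def\<close>)

lemma norm_add4_power2_le:
  "(norm (a + b + c + d))\<^sup>2 \<le> 4 * ((norm a)\<^sup>2 + (norm b)\<^sup>2 + (norm c)\<^sup>2 + (norm
      (d::'b::real_normed_vector))\<^sup>2)"
  using norm_add_power2_le[of "a + b" "c + d"] norm_add_power2_le[of a b] norm_add_power2_le[of c d]
  by (simp add: add.assoc)

context boundary_chart
begin

lemma norm_vert: "norm vert = 1"
  by (simp add: vert_def norm_\<phi> norm_Pair)

text \<open>The constant is \<open>3 * 2\<close>: Cauchy-Schwarz over the three basis directions,
  and the split of each derivative into \<open>g b x\<close> and the error.\<close>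

lemma norm_dir_deriv_vert_power2_le:
  fixes F :: "real^3 \<Rightarrow> 'b::euclidean_space"
  assumes "open V" "Ck_on 1 V F" "x \<in> V"
  shows "(norm (dir_deriv vert F x))\<^sup>2 \<le> 6 * (\<Sum>b\<in>Basis. (norm (dir_deriv b F x - g b x))\<^sup>2 + (norm
      (g b x))\<^sup>2)"
proof -
  have "norm (dir_deriv vert F x) \<le> (\<Sum>b\<in>Basis. norm ((vert \<bullet> b) *\<^sub>R dir_deriv b F x))"
    by (subst dir_deriv_eq_sum_Basis[OF assms]) (rule norm_sum)
  also have "\<dots> \<le> (\<Sum>b\<in>Basis. norm (dir_deriv b F x))"
  proof (rule sum_mono)
    fix b :: "real^3" assume "b \<in> Basis"
    then have "\<bar>vert \<bullet> b\<bar> \<le> 1" using Basis_le_norm[of b vert] norm_vert by simp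
    then show "norm ((vert \<bullet> b) *\<^sub>R dir_deriv b F x) \<le> norm (dir_deriv b F x)"
      by (simp add: mult_left_le_one_le)
  qed
  finally have "(norm (dir_deriv vert F x))\<^sup>2 \<le> (\<Sum>b\<in>Basis. norm (dir_deriv b F x))\<^sup>2"
    by (intro power_mono) auto
  also have "\<dots> \<le> (\<Sum>b\<in>Basis. (norm (dir_deriv b F x))\<^sup>2) * card (Basis :: (real^3) set)"
    by (rule sum_squared_le_sum_of_squares)
  also have "\<dots> = 3 * (\<Sum>b\<in>Basis. (norm (dir_deriv b F x))\<^sup>2)" by simp
  also have "\<dots> \<le> 3 * (\<Sum>b\<in>Basis. 2 * ((norm (dir_deriv b F x - g b x))\<^sup>2 + (norm (g b x))\<^sup>2))"
  proof (intro mult_left_mono sum_mono)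
    fix b
    show "(norm (dir_deriv b F x))\<^sup>2 \<le> 2 * ((norm (dir_deriv b F x - g b x))\<^sup>2 + (norm (g b x))\<^sup>2)"
      using norm_add_power2_le[of "dir_deriv b F x - g b x" "g b x"] by simp
  qed simp
  also have "\<dots> = 6 * (\<Sum>b\<in>Basis. (norm (dir_deriv b F x - g b x))\<^sup>2 + (norm (g b x))\<^sup>2)"
    unfolding sum_distrib_left[symmetric] by simp
  finally show ?thesis .
qed

text \<open>For every height \<open>\<tau> < t\<close> the difference
  \<open>g y - vertical_limit f y\<close> splits into four parts: the trace error of
  \<open>F\<close> on the graph, the increment of \<open>F\<close> along the fibre, the difference
  of \<open>F\<close> and \<open>f\<close> at height \<open>\<tau>\<close>, and the increment of
  \<open>f\<close> down to the graph. The third is controlled only in the volume, so the inequality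
  is integrated over \<open>\<tau>\<close>, which produces the factor \<open>t\<close> on the
  left.\<close>

lemma trace_approximation_estimate:
  fixes f F :: "real^3 \<Rightarrow> 'b::euclidean_space"
  assumes f: "H1_classical region f" and V: "open V" "closure (above_graph p \<phi> r s h) \<subseteq> V" and F:
      "Ck_on 1 V F"
    and g: "g \<in> borel_measurable (lebesgue_on B)" and t: "0 < t" "t < \<sigma>"
  shows "ennreal t * (\<integral>\<^sup>+y. ennreal ((norm (g y - vertical_limit f y))\<^sup>2) \<partial>lebesgue_on B)
    \<le> 4 * (ennreal t * (\<integral>\<^sup>+y. ennreal ((norm (F (graph_point p \<phi> h y) - g y))\<^sup>2) \<partial>lebesgue_on B)
      + ennreal (t\<^sup>2) * (\<integral>\<^sup>+x. ennreal ((norm (dir_deriv vert F x))\<^sup>2) \<partial>lebesgue_on region)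
      + (\<integral>\<^sup>+x. ennreal ((norm (F x - f x))\<^sup>2) \<partial>lebesgue_on region)
      + ennreal (t\<^sup>2) * (\<integral>\<^sup>+x. ennreal ((norm (dir_deriv vert f x))\<^sup>2) \<partial>lebesgue_on region))"
proof -
  let ?Ef = "fibre_energy (dir_deriv vert f)" and ?EF = "fibre_energy (dir_deriv vert F)"
    and ?Ed = "fibre_energy (\<lambda>x. F x - f x)"
  let ?a = "\<lambda>y. ennreal ((norm (F (graph_point p \<phi> h y) - g y))\<^sup>2)"
    and ?q = "\<lambda>y. ennreal ((norm (g y - vertical_limit f y))\<^sup>2)"
  have RV: "region \<subseteq> V"
    by (rule order_trans[OF region_subset(2) order_trans[OF closure_subset V(2)]])
  have cf: "Ck_on 1 region f" using f by (simp add: H1_classical_def)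
  have FR: "Ck_on 1 region F" by (rule Ck_on_subset[OF F RV])
  have c1: "continuous_on region (dir_deriv vert f)" by (rule continuous_on_dir_deriv[OF
      open_region cf])
  have c2: "continuous_on region (dir_deriv vert F)" by (rule continuous_on_dir_deriv[OF
      open_region FR])
  have c3: "continuous_on region (\<lambda>x. F x - f x)"
    using Ck_on_imp_continuous_on[OF cf] Ck_on_imp_continuous_on[OF FR] by (intro continuous_on_diff)
  have lift_V: "lift y \<tau> \<in> V" if "y \<in> B" "0 \<le> \<tau>" "\<tau> < \<sigma>" for y \<tau>
  proof (cases "\<tau> = 0")
    case False
    then show ?thesis using lift_in_region[of y \<tau>] that RV \<sigma> by auto
  next
    case True
    \<comment> \<open>The graph lies in the closure of the set above it, so the neighbourhood
      \<open>V\<close> on which \<open>F\<close> is C1 contains it.\<close>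
    have "(\<lambda>n. lift y 0 + heights n *\<^sub>R vert) \<longlonglongrightarrow> lift y 0 + 0 *\<^sub>R vert"
      by (intro tendsto_intros heights_tendsto_0)
    moreover have "lift y 0 + heights n *\<^sub>R vert \<in> above_graph p \<phi> r s h" for n
    proof -
      have "lift y (heights n) \<in> region" using heights[of n] \<sigma> by (intro lift_in_region that) auto
      then show ?thesis using region_subset(2) lift_eq[of y "heights n"] by auto
    qed
    ultimately have "lift y 0 \<in> closure (above_graph p \<phi> r s h)"
      unfolding closure_sequential by (intro exI[of _ "\<lambda>n. lift y 0 + heights n *\<^sub>R vert"]) simp
    then show ?thesis using V(2) True by blast
  qed
  have fibre: "ennreal t * ?q y \<le> 4 * (ennreal t * ?a y + ennreal (t\<^sup>2) * ?EF y + ?Ed y + ennreal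
      (t\<^sup>2) * ?Ef y)"
    if y: "y \<in> B" and lim: "\<forall>\<tau>\<in>{0<..<\<sigma>}. ennreal ((norm (f (lift y \<tau>) - vertical_limit f y))\<^sup>2) \<le>
        ennreal \<tau> * ?Ef y" for y
  proof -
    let ?k = "\<lambda>\<tau>. ennreal ((norm (F (lift y \<tau>) - f (lift y \<tau>)))\<^sup>2)"
    have pt: "?q y \<le> 4 * (?a y + ennreal t * ?EF y + ennreal t * ?Ef y) + 4 * ?k \<tau>" if \<tau>: "\<tau> \<in>
        {0<..<t}" for \<tau>
    proof -
      have "(norm (g y - vertical_limit f y))\<^sup>2 = (norm ((g y - F (lift y 0)) + (F (lift y 0) - F
          (lift y \<tau>))
          + (F (lift y \<tau>) - f (lift y \<tau>)) + (f (lift y \<tau>) - vertical_limit f y)))\<^sup>2"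
        by simp
      also have "\<dots> \<le> 4 * ((norm (g y - F (lift y 0)))\<^sup>2 + (norm (F (lift y 0) - F (lift y \<tau>)))\<^sup>2
          + (norm (F (lift y \<tau>) - f (lift y \<tau>)))\<^sup>2 + (norm (f (lift y \<tau>) - vertical_limit f y))\<^sup>2)"
        by (rule norm_add4_power2_le)
      finally have "?q y \<le> ennreal (4 * ((norm (g y - F (lift y 0)))\<^sup>2 + (norm (F (lift y 0) - F
          (lift y \<tau>)))\<^sup>2
          + (norm (F (lift y \<tau>) - f (lift y \<tau>)))\<^sup>2 + (norm (f (lift y \<tau>) - vertical_limit f y))\<^sup>2))"
        by (rule ennreal_leI)
      also have "\<dots> = 4 * (?a y + ennreal ((norm (F (lift y \<tau>) - F (lift y 0)))\<^sup>2) + ?k \<tau>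
          + ennreal ((norm (f (lift y \<tau>) - vertical_limit f y))\<^sup>2))"
        by (simp add: ennreal_mult ennreal_plus lift_0 norm_minus_commute add.assoc)
      also have "\<dots> \<le> 4 * (?a y + ennreal t * ?EF y + ?k \<tau> + ennreal t * ?Ef y)"
      proof (intro mult_left_mono add_mono order_refl)
        have "ennreal ((norm (F (lift y \<tau>) - F (lift y 0)))\<^sup>2) \<le> ennreal (\<tau> - 0) * ?EF y"
          by (rule fibre_increment_le_energy[OF V(1) F]) (use \<tau> t lift_V[OF y] in auto)
        also have "\<dots> \<le> ennreal t * ?EF y" using \<tau> by (intro mult_right_mono ennreal_leI) auto
        finally show "ennreal ((norm (F (lift y \<tau>) - F (lift y 0)))\<^sup>2) \<le> ennreal t * ?EF y" .
        have "ennreal ((norm (f (lift y \<tau>) - vertical_limit f y))\<^sup>2) \<le> ennreal \<tau> * ?Ef y"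
          using lim \<tau> t by auto
        also have "\<dots> \<le> ennreal t * ?Ef y" using \<tau> by (intro mult_right_mono ennreal_leI) auto
        finally show "ennreal ((norm (f (lift y \<tau>) - vertical_limit f y))\<^sup>2) \<le> ennreal t * ?Ef y" .
      qed auto
      also have "\<dots> = 4 * (?a y + ennreal t * ?EF y + ennreal t * ?Ef y) + 4 * ?k \<tau>"
        by (simp add: distrib_left ac_simps)
      finally show ?thesis .
    qed
    have mk: "(\<lambda>\<tau>. ?k \<tau> * indicator {0<..<t} \<tau>) \<in> borel_measurable lborel"
    proof -
      have "continuous_on {0<..<t} (lift y)" by (subst lift_fun_eq) (intro continuous_intros)
      then have "continuous_on {0<..<t} (\<lambda>\<tau>. F (lift y \<tau>) - f (lift y \<tau>))"
        using y t by (intro continuous_on_compose2[OF c3]) (auto intro!: lift_in_region)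
      from borel_measurable_ennreal_norm_power2_indicator[OF _ this] show ?thesis by simp
    qed
    \<comment> \<open>Integrating over \<open>\<tau>\<close> turns the pointwise term
      \<open>?k \<tau>\<close> into the fibre energy of the difference of \<open>F\<close> and
      \<open>f\<close>.\<close>
    have "ennreal t * ?q y = (\<integral>\<^sup>+\<tau>. ?q y * indicator {0<..<t} \<tau> \<partial>lborel)"
      using t by (subst nn_integral_cmult_indicator) (auto simp: mult.commute)
    also have "\<dots> \<le> (\<integral>\<^sup>+\<tau>. (4 * (?a y + ennreal t * ?EF y + ennreal t * ?Ef y)) * indicator {0<..<t} \<tau>
        + 4 * (?k \<tau> * indicator {0<..<t} \<tau>) \<partial>lborel)"
      by (intro nn_integral_mono) (use pt in \<open>auto simp: indicator_def\<close>)
    also have "\<dots> = (4 * (?a y + ennreal t * ?EF y + ennreal t * ?Ef y)) * ennreal t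
        + 4 * (\<integral>\<^sup>+\<tau>. ?k \<tau> * indicator {0<..<t} \<tau> \<partial>lborel)"
      using t mk by (simp add: nn_integral_add nn_integral_cmult nn_integral_cmult_indicator)
    also have "\<dots> \<le> (4 * (?a y + ennreal t * ?EF y + ennreal t * ?Ef y)) * ennreal t + 4 * ?Ed y"
      unfolding fibre_energy_def using t
      by (intro add_left_mono mult_left_mono nn_integral_mono) (auto simp: indicator_def)
    also have "\<dots> = 4 * (ennreal t * ?a y + ennreal (t\<^sup>2) * ?EF y + ?Ed y + ennreal (t\<^sup>2) * ?Ef y)"
      using t by (simp add: power2_eq_square ennreal_mult distrib_left distrib_right ac_simps)
    finally show ?thesis .
  qed
  have ma: "?a \<in> borel_measurable (lebesgue_on B)"
  proof -
    have "continuous_on B (\<lambda>y. lift y 0)"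
      by (rule continuous_on_subset[OF continuous_on_lift_left B_subset(1)])
    then have "continuous_on B (\<lambda>y. F (lift y 0))"
      using lift_V \<sigma> by (intro continuous_on_compose2[OF Ck_on_imp_continuous_on[OF F]]) auto
    then have "(\<lambda>y. F (lift y 0)) \<in> borel_measurable (lebesgue_on B)"
      by (intro borel_measurable_lebesgue_on_continuous) auto
    then show ?thesis using g unfolding lift_0 by measurable
  qed
  have m: "?EF \<in> borel_measurable (lebesgue_on B)" "?Ef \<in> borel_measurable (lebesgue_on B)"
    "?Ed \<in> borel_measurable (lebesgue_on B)"
    using borel_measurable_fibre_energy c1 c2 c3 by blast+
  have mq: "?q \<in> borel_measurable (lebesgue_on B)"
    using g borel_measurable_vertical_limit[OF Ck_on_imp_continuous_on[OF cf]] by measurable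
  have "ennreal t * (\<integral>\<^sup>+y. ?q y \<partial>lebesgue_on B) = (\<integral>\<^sup>+y. ennreal t * ?q y \<partial>lebesgue_on B)"
    by (rule nn_integral_cmult[OF mq, symmetric])
  also have "\<dots> \<le> (\<integral>\<^sup>+y. 4 * (ennreal t * ?a y + ennreal (t\<^sup>2) * ?EF y + ?Ed y + ennreal (t\<^sup>2) * ?Ef
      y) \<partial>lebesgue_on B)"
  proof (rule nn_integral_mono_AE)
    show "AE y in lebesgue_on B. ennreal t * ?q y \<le> 4 * (ennreal t * ?a y + ennreal (t\<^sup>2) * ?EF y +
        ?Ed y + ennreal (t\<^sup>2) * ?Ef y)"
      using AE_vertical_limit_dist[OF f] AE_space by eventually_elim (rule fibre, auto)
  qed
  also have "\<dots> = 4 * (ennreal t * (\<integral>\<^sup>+y. ?a y \<partial>lebesgue_on B) + ennreal (t\<^sup>2) * (\<integral>\<^sup>+y. ?EF y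
      \<partial>lebesgue_on B)
     + (\<integral>\<^sup>+y. ?Ed y \<partial>lebesgue_on B) + ennreal (t\<^sup>2) * (\<integral>\<^sup>+y. ?Ef y \<partial>lebesgue_on B))"
    using ma m by (simp add: nn_integral_cmult nn_integral_add)
  also have "\<dots> \<le> 4 * (ennreal t * (\<integral>\<^sup>+y. ?a y \<partial>lebesgue_on B)
      + ennreal (t\<^sup>2) * (\<integral>\<^sup>+x. ennreal ((norm (dir_deriv vert F x))\<^sup>2) \<partial>lebesgue_on region)
      + (\<integral>\<^sup>+x. ennreal ((norm (F x - f x))\<^sup>2) \<partial>lebesgue_on region)
      + ennreal (t\<^sup>2) * (\<integral>\<^sup>+x. ennreal ((norm (dir_deriv vert f x))\<^sup>2) \<partial>lebesgue_on region))"
    by (intro mult_left_mono add_mono order_refl nn_integral_fibre_energy_le c1 c2 c3) auto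
  finally show ?thesis .
qed

text \<open>With \<open>t\<close> fixed the approximation errors vanish as \<open>n\<close> grows,
  while the energies of \<open>F n\<close> stay bounded. There remains
  \<open>t * X \<le> 4 * t\<^sup>2 * (c + k)\<close> for the squared distance \<open>X\<close> of
  the two candidates; dividing by \<open>t\<close> and letting \<open>t\<close> tend to 0 gives
  \<open>X = 0\<close>.\<close>

lemma trace_eq_vertical_limit:
  fixes f :: "real^3 \<Rightarrow> 'b::euclidean_space"
  assumes f: "H1_classical region f" and tr: "has_graph_trace p \<phi> r s h f g"
  shows "AE y in lebesgue_on B. g y = vertical_limit f y"
proof -
  let ?A = "above_graph p \<phi> r s h"
  obtain F where FV: "\<And>n. \<exists>V. open V \<and> closure ?A \<subseteq> V \<and> Ck_on 1 V (F n)"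
    and conv: "H1_tendsto ?A F f"
    and graph: "(\<lambda>n. \<integral>\<^sup>+y. ennreal ((norm (F n (graph_point p \<phi> h y) - g y))\<^sup>2 * area_element h y)
             \<partial>lebesgue_on (ball 0 r)) \<longlonglongrightarrow> 0"
    and g: "g \<in> borel_measurable (lebesgue_on (ball 0 r))"
    using tr unfolding has_graph_trace_def by blast
  have A: "open ?A" by (rule open_above_graph[OF linear_\<phi> norm_\<phi> continuous_on_h])
  obtain V where V: "\<And>n. open (V n)" "\<And>n. closure ?A \<subseteq> V n" "\<And>n. Ck_on 1 (V n) (F n)"
    using FV by metis
  have AV: "?A \<subseteq> V n" for n by (rule order_trans[OF closure_subset V(2)])
  have gB: "g \<in> borel_measurable (lebesgue_on B)"
    using measurable_restrict_mono[OF g B_subset(1)] .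
  let ?E = "\<lambda>n. \<integral>\<^sup>+y. ennreal ((norm (F n (graph_point p \<phi> h y) - g y))\<^sup>2) \<partial>lebesgue_on B"
    and ?H = "\<lambda>n. \<integral>\<^sup>+x. ennreal ((norm (F n x - f x))\<^sup>2) \<partial>lebesgue_on region"
    and ?C = "\<lambda>n. \<integral>\<^sup>+x. ennreal ((norm (dir_deriv vert (F n) x))\<^sup>2) \<partial>lebesgue_on region"
    and ?K = "\<integral>\<^sup>+x. ennreal ((norm (dir_deriv vert f x))\<^sup>2) \<partial>lebesgue_on region"
    and ?X = "\<integral>\<^sup>+y. ennreal ((norm (g y - vertical_limit f y))\<^sup>2) \<partial>lebesgue_on B"
  \<comment> \<open>The area element is at least 1, so dropping the surface weight only lowers the
    integral.\<close>
  have E0: "?E \<longlonglongrightarrow> 0"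
  proof (rule tendsto_sandwich[OF _ _ tendsto_const graph])
    show "\<forall>\<^sub>F n in sequentially. ?E n \<le> (\<integral>\<^sup>+y. ennreal ((norm (F n (graph_point p \<phi> h y) - g y))\<^sup>2
        * area_element h y)
             \<partial>lebesgue_on (ball 0 r))"
    proof (intro always_eventually allI)
      fix n
      have ae: "1 \<le> area_element h y" for y
        unfolding area_element_def using sum_nonneg[of Basis "\<lambda>b. (dir_deriv b h y)\<^sup>2"] by simp
      have "?E n \<le> (\<integral>\<^sup>+y. ennreal ((norm (F n (graph_point p \<phi> h y) - g y))\<^sup>2 * area_element h y)
          \<partial>lebesgue_on B)"
        using mult_left_mono[OF ae] by (intro nn_integral_mono ennreal_leI) force
      also have "\<dots> \<le> (\<integral>\<^sup>+y. ennreal ((norm (F n (graph_point p \<phi> h y) - g y))\<^sup>2 * area_element h y)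
          \<partial>lebesgue_on (ball 0 r))"
        by (rule nn_integral_lebesgue_on_mono) (use B_subset in auto)
      finally show "?E n \<le> \<dots>" .
    qed
  qed auto
  have H0: "?H \<longlonglongrightarrow> 0"
  proof (rule tendsto_sandwich[OF _ _ tendsto_const])
    show "(\<lambda>n. \<integral>\<^sup>+x. ennreal ((norm (F n x - f x))\<^sup>2) \<partial>lebesgue_on ?A) \<longlonglongrightarrow> 0"
      using conv by (simp add: H1_tendsto_def)
    show "\<forall>\<^sub>F n in sequentially. ?H n \<le> (\<integral>\<^sup>+x. ennreal ((norm (F n x - f x))\<^sup>2) \<partial>lebesgue_on ?A)"
      by (intro always_eventually allI nn_integral_lebesgue_on_mono open_region A region_subset)
  qed auto
  \<comment> \<open>An eventual bound for the vertical energies is extracted through the derivatives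
    in basis directions, which converge in mean square.\<close>
  have "\<exists>c\<ge>0. \<forall>\<^sub>F n in sequentially. ?C n \<le> ennreal c"
  proof -
    define Q where "Q b g \<longleftrightarrow> L2_on ?A g \<and> weak_deriv ?A b f g \<and>
        (\<lambda>n. \<integral>\<^sup>+x. ennreal ((norm (dir_deriv b (F n) x - g x))\<^sup>2) \<partial>lebesgue_on ?A) \<longlonglongrightarrow> 0"
      for b and g :: "real^3 \<Rightarrow> 'b"
    have "\<forall>b\<in>Basis. \<exists>g. Q b g"
      using conv unfolding H1_tendsto_def Q_def by (elim conjE)
    then obtain gd where "\<forall>b\<in>Basis. Q b (gd b)" by metis
    then have gd: "L2_on ?A (gd b)"
      "(\<lambda>n. \<integral>\<^sup>+x. ennreal ((norm (dir_deriv b (F n) x - gd b x))\<^sup>2) \<partial>lebesgue_on ?A) \<longlonglongrightarrow> 0"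
      if "b \<in> Basis" for b
      using that by (simp_all add: Q_def)
    let ?d = "\<lambda>n b. \<integral>\<^sup>+x. ennreal ((norm (dir_deriv b (F n) x - gd b x))\<^sup>2) \<partial>lebesgue_on ?A"
      and ?g = "\<lambda>b. \<integral>\<^sup>+x. ennreal ((norm (gd b x))\<^sup>2) \<partial>lebesgue_on ?A"
    have bound: "?C n \<le> 6 * (\<Sum>b\<in>Basis. ?d n b + ?g b)" for n
    proof -
      have md: "(\<lambda>x. ennreal ((norm (dir_deriv b (F n) x - gd b x))\<^sup>2)) \<in> borel_measurable
          (lebesgue_on ?A)"
        "(\<lambda>x. ennreal ((norm (gd b x))\<^sup>2)) \<in> borel_measurable (lebesgue_on ?A)" if b: "b \<in> Basis" for b
      proof -
        have 1: "dir_deriv b (F n) \<in> borel_measurable (lebesgue_on ?A)"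
          by (rule borel_measurable_lebesgue_on_continuous[OF A
                continuous_on_subset[OF continuous_on_dir_deriv[OF V(1,3)] AV]])
        have 2: "gd b \<in> borel_measurable (lebesgue_on ?A)" using gd(1)[OF b] by (simp add: L2_on_def)
        show "(\<lambda>x. ennreal ((norm (dir_deriv b (F n) x - gd b x))\<^sup>2)) \<in> borel_measurable
            (lebesgue_on ?A)"
          "(\<lambda>x. ennreal ((norm (gd b x))\<^sup>2)) \<in> borel_measurable (lebesgue_on ?A)"
          using 1 2 by measurable
      qed
      have "?C n \<le> (\<integral>\<^sup>+x. ennreal ((norm (dir_deriv vert (F n) x))\<^sup>2) \<partial>lebesgue_on ?A)"
        by (intro nn_integral_lebesgue_on_mono open_region A region_subset)
      also have "\<dots> \<le> (\<integral>\<^sup>+x. 6 * (\<Sum>b\<in>Basis. ennreal ((norm (dir_deriv b (F n) x - gd b x))\<^sup>2) +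
          ennreal ((norm (gd b x))\<^sup>2)) \<partial>lebesgue_on ?A)"
      proof (rule nn_integral_mono)
        fix x assume "x \<in> space (lebesgue_on ?A)"
        then have "x \<in> V n" using AV by auto
        then have "ennreal ((norm (dir_deriv vert (F n) x))\<^sup>2)
            \<le> ennreal (6 * (\<Sum>b\<in>Basis. (norm (dir_deriv b (F n) x - gd b x))\<^sup>2 + (norm (gd b x))\<^sup>2))"
          by (intro ennreal_leI norm_dir_deriv_vert_power2_le[OF V(1,3)])
        also have "\<dots> = 6 * (\<Sum>b\<in>Basis. ennreal ((norm (dir_deriv b (F n) x - gd b x))\<^sup>2) + ennreal
            ((norm (gd b x))\<^sup>2))"
          by (simp add: ennreal_mult sum_nonneg flip: ennreal_plus sum_ennreal)
        finally show "ennreal ((norm (dir_deriv vert (F n) x))\<^sup>2) \<le> \<dots>" .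
      qed
      also have "\<dots> = 6 * (\<Sum>b\<in>Basis. ?d n b + ?g b)"
        using md by (simp add: nn_integral_cmult nn_integral_sum nn_integral_add)
      finally show ?thesis .
    qed
    have lim: "(\<lambda>n. 6 * (\<Sum>b\<in>Basis. ?d n b + ?g b)) \<longlonglongrightarrow> 6 * (\<Sum>b\<in>Basis. 0 + ?g b)"
      by (intro ennreal_tendsto_cmult tendsto_sum tendsto_add gd(2) tendsto_const) auto
    have "(\<Sum>b\<in>Basis. 0 + ?g b) < top"
      using L2_on_nn_integral_finite[OF gd(1)] by (subst ennreal_sum_less_top) auto
    then have "6 * (\<Sum>b\<in>Basis. 0 + ?g b) < top"
      by (simp only: ennreal_mult_less_top) simp
    then obtain c where c: "0 \<le> c" "6 * (\<Sum>b\<in>Basis. 0 + ?g b) = ennreal c"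
      unfolding less_top_ennreal by blast
    have "ennreal c < ennreal (c + 1)" using c(1) by (simp add: ennreal_less_iff)
    from order_tendstoD(2)[OF lim[unfolded c(2)] this]
    have "\<forall>\<^sub>F n in sequentially. ?C n \<le> ennreal (c + 1)"
    proof eventually_elim
      case (elim n)
      show ?case by (rule order_trans[OF bound less_imp_le[OF elim]])
    qed
    then show ?thesis using c(1) by (intro exI[of _ "c + 1"]) auto
  qed
  then obtain c where c: "c \<ge> 0" "\<forall>\<^sub>F n in sequentially. ?C n \<le> ennreal c" by blast
  have "?K < top" using L2_on_nn_integral_finite[OF H1_classical_L2_dir_deriv[OF open_region f, of
      vert]] by simp
  then obtain k where k: "k \<ge> 0" "?K = ennreal k" unfolding less_top_ennreal by blast
  have main: "ennreal t * ?X \<le> ennreal (4 * (t\<^sup>2 * (c + k)))" if t: "0 < t" "t < \<sigma>" for t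
  proof -
    have lim: "(\<lambda>n. 4 * (ennreal t * ?E n + ennreal (t\<^sup>2) * ennreal c + ?H n + ennreal (t\<^sup>2) * ?K))
        \<longlonglongrightarrow> 4 * (ennreal t * 0 + ennreal (t\<^sup>2) * ennreal c + 0 + ennreal (t\<^sup>2) * ?K)"
      by (intro ennreal_tendsto_cmult tendsto_add tendsto_const E0 H0) auto
    have "ennreal t * ?X \<le> 4 * (ennreal t * 0 + ennreal (t\<^sup>2) * ennreal c + 0 + ennreal (t\<^sup>2) * ?K)"
    proof (rule tendsto_lowerbound[OF lim])
      show "\<forall>\<^sub>F n in sequentially. ennreal t * ?X \<le> 4 * (ennreal t * ?E n + ennreal (t\<^sup>2) * ennreal
          c + ?H n + ennreal (t\<^sup>2) * ?K)"
        using c(2)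
      proof eventually_elim
        case (elim n)
        have "ennreal t * ?X \<le> 4 * (ennreal t * ?E n + ennreal (t\<^sup>2) * ?C n + ?H n + ennreal (t\<^sup>2)
            * ?K)"
          by (rule trace_approximation_estimate[OF f V gB t])
        also have "\<dots> \<le> 4 * (ennreal t * ?E n + ennreal (t\<^sup>2) * ennreal c + ?H n + ennreal (t\<^sup>2) * ?K)"
          using elim by (intro mult_left_mono add_mono order_refl) auto
        finally show ?case .
      qed
    qed simp
    also have "\<dots> = ennreal (4 * (t\<^sup>2 * (c + k)))"
      using c(1) k by (simp add: ennreal_mult ennreal_plus distrib_left)
    finally show ?thesis .
  qed
  have X0: "X = 0" if main: "\<And>t. 0 < t \<Longrightarrow> t < \<sigma> \<Longrightarrow> ennreal t * X \<le> ennreal (4 * (t\<^sup>2 * (c + k)))"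
    for X :: ennreal
  proof (cases X rule: ennreal_cases)
    case (real x)
    have le: "x \<le> 4 * (c + k) * t" if "0 < t" "t < \<sigma>" for t
    proof -
      have "ennreal (t * x) \<le> ennreal (4 * (t\<^sup>2 * (c + k)))"
        using main[OF that] that real by (simp add: ennreal_mult)
      moreover have "0 \<le> 4 * (t\<^sup>2 * (c + k))" using c(1) k by simp
      ultimately have "t * x \<le> 4 * (t\<^sup>2 * (c + k))" by (simp only: ennreal_le_iff)
      then have "t * x \<le> t * (4 * (c + k) * t)" by (simp add: power2_eq_square algebra_simps)
      then show ?thesis using that by simp
    qed
    have "(\<lambda>n. 4 * (c + k) * heights n) \<longlonglongrightarrow> 4 * (c + k) * 0"
      by (intro tendsto_intros heights_tendsto_0)
    then have "x \<le> 4 * (c + k) * 0"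
      by (rule tendsto_lowerbound) (use le heights in auto)
    then show ?thesis using real by simp
  next
    \<comment> \<open>An infinite \<open>X\<close> would make the left side infinite already for
      \<open>t = \<sigma> / 2\<close>.\<close>
    case top
    then show ?thesis using main[of "\<sigma> / 2"] \<sigma> by (simp add: ennreal_mult_top top_unique)
  qed
  have "?X = 0" by (rule X0[OF main])
  moreover have "(\<lambda>y. ennreal ((norm (g y - vertical_limit f y))\<^sup>2)) \<in> borel_measurable (lebesgue_on B)"
  proof -
    have "vertical_limit f \<in> borel_measurable (lebesgue_on B)"
      by (rule borel_measurable_vertical_limit[OF Ck_on_imp_continuous_on[of 1]])
        (use f in \<open>simp add: H1_classical_def\<close>)
    then show ?thesis using gB by measurable
  qed
  ultimately have "AE y in lebesgue_on B. ennreal ((norm (g y - vertical_limit f y))\<^sup>2) = 0"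
    by (simp add: nn_integral_0_iff_AE)
  then show ?thesis by eventually_elim simp
qed

section \<open>Vertical translates realise the vertical limit as a trace\<close>

lemma mem_above_graph_iff:
  "p + \<phi> (y, t) \<in> above_graph p \<phi> r1 s1 h \<longleftrightarrow> y \<in> ball 0 r1 \<and> h y < t \<and> t < s1"
  unfolding above_graph_def using inj_\<phi> by (auto dest: injD)

lemma above_graphE:
  assumes "x \<in> above_graph p \<phi> r1 s1 h"
  obtains y t where "x = p + \<phi> (y, t)" "y \<in> ball 0 r1" "h y < t" "t < s1"
  using assms unfolding above_graph_def by blast

lemma add_vert: "p + \<phi> (y, t) + \<tau> *\<^sub>R vert = p + \<phi> (y, t + \<tau>)"
proof -
  have "(y, t + \<tau>) = (y, t) + \<tau> *\<^sub>R (0, 1)" by simp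
  then show ?thesis unfolding vert_def
    by (simp only: linear_add[OF linear_\<phi>] linear_cmul[OF linear_\<phi>]) simp
qed

text \<open>The domain of the new trace. It ends below the top of \<open>region\<close>, so that
  upward translates by \<open>heights n\<close> remain where the gradient is square
  integrable.\<close>

definition lower_region :: "(real^3) set" where "lower_region = above_graph p \<phi> r' \<sigma> h"

lemma open_lower_region: "open lower_region"
  unfolding lower_region_def
  by (rule open_above_graph[OF linear_\<phi> norm_\<phi> continuous_on_subset[OF continuous_on_h B_subset(1)]])

lemma shift_lower_region:
  assumes "x \<in> lower_region" "0 \<le> \<tau>" "\<tau> \<le> \<sigma>"
  shows "x + \<tau> *\<^sub>R vert \<in> region"
  using assms \<sigma> unfolding lower_region_def region_def
  by (elim above_graphE) (auto simp: add_vert mem_above_graph_iff)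

lemma lower_region_subset: "lower_region \<subseteq> region"
  using shift_lower_region[of _ 0] \<sigma> by auto

text \<open>Translation invariance moves the shift from the integrand to the indicator, after which
  \<open>k\<close> itself dominates. Within \<open>region\<close> the shifted indicators converge
  except on the top face of \<open>lower_region\<close>.\<close>

lemma nn_integral_shift_tendsto:
  fixes u :: "real^3 \<Rightarrow> 'b::euclidean_space"
  assumes c: "continuous_on region u" and L2: "L2_on region u"
  shows "(\<lambda>n. \<integral>\<^sup>+x. ennreal ((norm (u (x + heights n *\<^sub>R vert)))\<^sup>2) \<partial>lebesgue_on lower_region)
    \<longlonglongrightarrow> (\<integral>\<^sup>+x. ennreal ((norm (u x))\<^sup>2) \<partial>lebesgue_on lower_region)"
proof -
  define k where "k x = ennreal ((norm (u x))\<^sup>2) * indicator region x" for x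
  have mk: "k \<in> borel_measurable borel"
    unfolding k_def by (rule borel_measurable_ennreal_norm_power2_indicator[OF open_region c])
  have ml: "(indicator lower_region :: real^3 \<Rightarrow> ennreal) \<in> borel_measurable borel"
    using open_lower_region by auto
  have mls: "(\<lambda>x. indicator lower_region (x - heights n *\<^sub>R vert) :: ennreal) \<in> borel_measurable
      borel" for n
    by (rule measurable_compose[OF _ ml]) measurable
  have fin: "(\<integral>\<^sup>+x. k x \<partial>lborel) < \<infinity>"
    using L2_on_nn_integral_finite[OF L2] unfolding nn_integral_lebesgue_on[OF open_region] k_def .
  have shift: "(\<integral>\<^sup>+x. ennreal ((norm (u (x + heights n *\<^sub>R vert)))\<^sup>2) \<partial>lebesgue_on lower_region)
      = (\<integral>\<^sup>+x. k x * indicator lower_region (x - heights n *\<^sub>R vert) \<partial>lborel)" for n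
  proof -
    have "(\<integral>\<^sup>+x. k x * indicator lower_region (x - heights n *\<^sub>R vert) \<partial>lborel)
      = (\<integral>\<^sup>+x. k x * indicator lower_region (x - heights n *\<^sub>R vert) \<partial>distr lborel borel ((+)
          (heights n *\<^sub>R vert)))"
      by (simp add: lborel_distr_plus)
    also have "\<dots> = (\<integral>\<^sup>+x. k (heights n *\<^sub>R vert + x) * indicator lower_region (heights n *\<^sub>R vert +
        x - heights n *\<^sub>R vert) \<partial>lborel)"
      by (rule nn_integral_distr) (use mk mls in auto)
    also have "\<dots> = (\<integral>\<^sup>+x. ennreal ((norm (u (x + heights n *\<^sub>R vert)))\<^sup>2) * indicator lower_region
        x \<partial>lborel)"
    proof (rule nn_integral_cong)
      fix x
      show "k (heights n *\<^sub>R vert + x) * indicator lower_region (heights n *\<^sub>R vert + x - heights n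
          *\<^sub>R vert)
        = ennreal ((norm (u (x + heights n *\<^sub>R vert)))\<^sup>2) * indicator lower_region x"
        using shift_lower_region[of x "heights n"] heights[of n]
        by (cases "x \<in> lower_region") (simp_all add: k_def add.commute)
    qed
    also have "\<dots> = (\<integral>\<^sup>+x. ennreal ((norm (u (x + heights n *\<^sub>R vert)))\<^sup>2) \<partial>lebesgue_on lower_region)"
      by (rule nn_integral_lebesgue_on[OF open_lower_region, symmetric])
    finally show ?thesis ..
  qed
  have "(\<lambda>n. \<integral>\<^sup>+x. k x * indicator lower_region (x - heights n *\<^sub>R vert) \<partial>lborel)
      \<longlonglongrightarrow> (\<integral>\<^sup>+x. k x * indicator lower_region x \<partial>lborel)"
  proof (rule nn_integral_dominated_convergence[where w=k])
    show "(\<lambda>x. k x * indicator lower_region (x - heights n *\<^sub>R vert)) \<in> borel_measurable lborel" for n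
      using mk mls by auto
    show "(\<lambda>x. k x * indicator lower_region x) \<in> borel_measurable lborel" "k \<in> borel_measurable lborel"
      using mk ml by auto
    show "AE x in lborel. k x * indicator lower_region (x - heights n *\<^sub>R vert) \<le> k x" for n
      by (intro AE_I2) (auto simp: indicator_def)
    show "(\<integral>\<^sup>+x. k x \<partial>lborel) < \<infinity>" by (rule fin)
    \<comment> \<open>This hyperplane contains the top face at height \<open>\<sigma>\<close>. The
      lateral boundary causes no trouble because a vertical shift keeps \<open>y\<close>, and a
      point above the graph stays above it under small downward shifts.\<close>
    have "negligible {x. vert \<bullet> x = vert \<bullet> p + \<sigma>}"
      using norm_vert by (intro negligible_hyperplane) auto
    then have "AE x in lebesgue. vert \<bullet> x \<noteq> vert \<bullet> p + \<sigma>"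
      using AE_not_in[of "{x. vert \<bullet> x = vert \<bullet> p + \<sigma>}" lebesgue] by (simp add:
          negligible_iff_null_sets)
    then have "AE x in lborel. vert \<bullet> x \<noteq> vert \<bullet> p + \<sigma>"
      by (simp add: AE_completion_iff)
    then show "AE x in lborel. (\<lambda>n. k x * indicator lower_region (x - heights n *\<^sub>R vert)) \<longlonglongrightarrow> k x *
        indicator lower_region x"
    proof eventually_elim
      case (elim x)
      show ?case
      proof (cases "x \<in> region")
        case False
        then show ?thesis by (simp add: k_def)
      next
        case True
        then obtain y t where x: "x = p + \<phi> (y, t)" "y \<in> B" "h y < t" "t < 3 * \<sigma>"
          unfolding region_def by (rule above_graphE)
        have "vert \<bullet> x = vert \<bullet> p + t"
          unfolding x(1) vert_def by (simp add: inner_add_right inner_\<phi>)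
        then have "t \<noteq> \<sigma>" using elim by auto
        have sh: "x - heights n *\<^sub>R vert = p + \<phi> (y, t - heights n)" for n
          using add_vert[of y t "- heights n"] x by simp
        have "\<forall>\<^sub>F n in sequentially. indicator lower_region (x - heights n *\<^sub>R vert) = (indicator
            lower_region x :: ennreal)"
        proof (cases "t < \<sigma>")
          case True
          have "\<forall>\<^sub>F n in sequentially. heights n < t - h y"
            using x by (intro order_tendstoD(2)[OF heights_tendsto_0]) auto
          then show ?thesis
          proof eventually_elim
            case (elim n)
            then show ?case using x True heights[of n] unfolding sh unfolding x(1) lower_region_def
              by (simp add: indicator_def mem_above_graph_iff)
          qed
        next
          case False
          then have "\<forall>\<^sub>F n in sequentially. heights n < t - \<sigma>"
            using \<open>t \<noteq> \<sigma>\<close> by (intro order_tendstoD(2)[OF heights_tendsto_0]) auto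
          then show ?thesis
          proof eventually_elim
            case (elim n)
            then show ?case using x False heights[of n] unfolding sh unfolding x(1) lower_region_def
              by (simp add: indicator_def mem_above_graph_iff)
          qed
        qed
        then have "\<forall>\<^sub>F n in sequentially. k x * indicator lower_region x = k x * indicator
            lower_region (x - heights n *\<^sub>R vert)"
          by eventually_elim simp
        then show ?thesis by (rule Lim_transform_eventually[OF tendsto_const])
      qed
    qed
  qed
  moreover have "k x * indicator lower_region x = ennreal ((norm (u x))\<^sup>2) * indicator lower_region
      x" for x
    using lower_region_subset by (auto simp: k_def indicator_def)
  ultimately show ?thesis
    unfolding shift by (simp add: nn_integral_lebesgue_on[OF open_lower_region])
qed

text \<open>Pointwise convergence and convergence of the norms give convergence in mean square, by
  Fatou's lemma for \<open>2\<bar>u\<^sub>n\<bar>\<^sup>2 + 2\<bar>u\<bar>\<^sup>2 - \<bar>u\<^sub>n - u\<bar>\<^sup>2\<close>.\<close>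

lemma shift_tendsto_L2:
  fixes u :: "real^3 \<Rightarrow> 'b::euclidean_space"
  assumes c: "continuous_on region u" and L2: "L2_on region u"
  shows "(\<lambda>n. \<integral>\<^sup>+x. ennreal ((norm (u (x + heights n *\<^sub>R vert) - u x))\<^sup>2) \<partial>lebesgue_on
      lower_region) \<longlonglongrightarrow> 0"
proof -
  let ?M = "lebesgue_on lower_region"
  define a where "a n x = (norm (u (x + heights n *\<^sub>R vert)))\<^sup>2" for n x
  define a' where "a' x = (norm (u x))\<^sup>2" for x
  define d where "d n x = (norm (u (x + heights n *\<^sub>R vert) - u x))\<^sup>2" for n x
  define b where "b n x = 2 * a n x + 2 * a' x - d n x" for n x
  have nonneg: "0 \<le> a n x" "0 \<le> a' x" "0 \<le> d n x" for n x by (auto simp: a_def a'_def d_def)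
  have b0: "0 \<le> b n x" for n x
    using norm_add_power2_le[of "u (x + heights n *\<^sub>R vert)" "- u x"] by (simp add: b_def a_def
        a'_def d_def)
  have mus: "(\<lambda>x. u (x + heights n *\<^sub>R vert)) \<in> borel_measurable ?M" for n
  proof (rule borel_measurable_lebesgue_on_continuous[OF open_lower_region])
    show "continuous_on lower_region (\<lambda>x. u (x + heights n *\<^sub>R vert))"
      by (intro continuous_on_compose2[OF c] continuous_intros)
        (use shift_lower_region heights less_imp_le in \<open>auto simp: less_imp_le\<close>)
  qed
  have mu: "u \<in> borel_measurable ?M"
    by (rule borel_measurable_lebesgue_on_continuous[OF open_lower_region continuous_on_subset[OF c
        lower_region_subset]])
  have m: "a n \<in> borel_measurable ?M" "a' \<in> borel_measurable ?M" "d n \<in> borel_measurable ?M" "b n \<in>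
      borel_measurable ?M" for n
    using mus mu unfolding a_def a'_def d_def b_def by measurable
  let ?A = "\<lambda>n. \<integral>\<^sup>+x. ennreal (a n x) \<partial>?M" and ?A' = "\<integral>\<^sup>+x. ennreal (a' x) \<partial>?M"
    and ?D = "\<lambda>n. \<integral>\<^sup>+x. ennreal (d n x) \<partial>?M" and ?B = "\<lambda>n. \<integral>\<^sup>+x. ennreal (b n x) \<partial>?M"
  have A: "?A \<longlonglongrightarrow> ?A'"
    using nn_integral_shift_tendsto[OF c L2] unfolding a_def a'_def .
  have "?A' \<le> (\<integral>\<^sup>+x. ennreal ((norm (u x))\<^sup>2) \<partial>lebesgue_on region)"
    unfolding a'_def by (rule nn_integral_lebesgue_on_mono[OF open_lower_region open_region
        lower_region_subset])
  also have "\<dots> < \<infinity>" by (rule L2_on_nn_integral_finite[OF L2])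
  finally have "?A' < top" by simp
  then obtain \<alpha> where \<alpha>: "\<alpha> \<ge> 0" "?A' = ennreal \<alpha>" unfolding less_top_ennreal by blast
  have sum: "?D n + ?B n = 2 * ?A n + 2 * ?A'" for n
  proof -
    have "?D n + ?B n = (\<integral>\<^sup>+x. ennreal (d n x) + ennreal (b n x) \<partial>?M)"
      using m by (intro nn_integral_add[symmetric]) auto
    also have "\<dots> = (\<integral>\<^sup>+x. 2 * ennreal (a n x) + 2 * ennreal (a' x) \<partial>?M)"
    proof (rule nn_integral_cong)
      fix x
      have "ennreal (d n x) + ennreal (b n x) = ennreal (d n x + b n x)"
        using nonneg b0 by (simp add: ennreal_plus)
      also have "d n x + b n x = 2 * a n x + 2 * a' x" by (simp add: b_def)
      also have "ennreal (2 * a n x + 2 * a' x) = 2 * ennreal (a n x) + 2 * ennreal (a' x)"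
        using nonneg by (simp add: ennreal_plus ennreal_mult)
      finally show "ennreal (d n x) + ennreal (b n x) = 2 * ennreal (a n x) + 2 * ennreal (a' x)" .
    qed
    also have "\<dots> = 2 * ?A n + 2 * ?A'"
      using m by (simp add: nn_integral_add nn_integral_cmult)
    finally show ?thesis .
  qed
  have Fatou: "4 * ?A' \<le> liminf ?B"
  proof -
    have "4 * ?A' = (\<integral>\<^sup>+x. 4 * ennreal (a' x) \<partial>?M)"
      using m by (intro nn_integral_cmult[symmetric]) auto
    also have "\<dots> = (\<integral>\<^sup>+x. liminf (\<lambda>n. ennreal (b n x)) \<partial>?M)"
    proof (rule nn_integral_cong)
      fix x assume "x \<in> space ?M"
      then have x: "x \<in> region" using lower_region_subset by auto
      have "isCont u x" using c x open_region by (simp add: continuous_on_eq_continuous_at)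
      moreover have "(\<lambda>n. x + heights n *\<^sub>R vert) \<longlonglongrightarrow> x + 0 *\<^sub>R vert"
        by (intro tendsto_intros heights_tendsto_0)
      ultimately have us: "(\<lambda>n. u (x + heights n *\<^sub>R vert)) \<longlonglongrightarrow> u x"
        by (intro isCont_tendsto_compose[of x u]) auto
      have "(\<lambda>n. b n x) \<longlonglongrightarrow> 2 * (norm (u x))\<^sup>2 + 2 * (norm (u x))\<^sup>2 - (norm (u x - u x))\<^sup>2"
        unfolding b_def a_def a'_def d_def by (intro tendsto_intros us)
      then have "(\<lambda>n. ennreal (b n x)) \<longlonglongrightarrow> ennreal (4 * a' x)"
        by (intro tendsto_ennrealI) (simp add: a'_def)
      then have "liminf (\<lambda>n. ennreal (b n x)) = ennreal (4 * a' x)"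
        by (intro lim_imp_Liminf) auto
      then show "4 * ennreal (a' x) = liminf (\<lambda>n. ennreal (b n x))"
        using nonneg by (simp add: ennreal_mult)
    qed
    also have "\<dots> \<le> liminf ?B"
      by (rule nn_integral_liminf) (use m in auto)
    finally show ?thesis .
  qed
  have "(\<lambda>n. ?D n) \<longlonglongrightarrow> 0"
  proof (rule order_tendstoI)
    fix \<epsilon> :: ennreal assume "0 < \<epsilon>"
    \<comment> \<open>The factor 3 balances the errors: an excess \<open>e\<close> of
      \<open>?A n\<close> counts twice and a deficit \<open>e\<close> of \<open>?B n\<close>
      once.\<close>
    then obtain e :: real where e: "0 < e" "ennreal (3 * e) \<le> \<epsilon>"
    proof (cases \<epsilon> rule: ennreal_cases)
      case (real r)
      then show ?thesis using \<open>0 < \<epsilon>\<close> by (intro that[of "r / 3"]) auto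
    next
      case top
      then show ?thesis by (intro that[of 1]) auto
    qed
    have "?A' < ennreal (\<alpha> + e)" using \<alpha> e by (simp add: ennreal_less_iff)
    then have evA: "\<forall>\<^sub>F n in sequentially. ?A n < ennreal (\<alpha> + e)"
      by (rule order_tendstoD(2)[OF A])
    have evB: "\<forall>\<^sub>F n in sequentially. ennreal (4 * \<alpha>) \<le> ?B n + ennreal e"
    proof (cases "4 * \<alpha> \<le> e")
      case True
      then show ?thesis by (intro always_eventually allI) (simp add: add_increasing ennreal_leI)
    next
      case False
      have "ennreal (4 * \<alpha> - e) < liminf ?B"
      proof (rule less_le_trans[OF _ Fatou])
        have "4 * ?A' = ennreal (4 * \<alpha>)" using \<alpha> by (simp add: ennreal_mult)
        then show "ennreal (4 * \<alpha> - e) < 4 * ?A'" using False e by (simp add: ennreal_less_iff)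
      qed
      then have "\<forall>\<^sub>F n in sequentially. ennreal (4 * \<alpha> - e) < ?B n"
        by (rule less_LiminfD)
      then show ?thesis
      proof eventually_elim
        case (elim n)
        have "ennreal (4 * \<alpha>) = ennreal (4 * \<alpha> - e) + ennreal e"
          using False e by (simp flip: ennreal_plus)
        also have "\<dots> \<le> ?B n + ennreal e" using elim by (intro add_right_mono) auto
        finally show ?case .
      qed
    qed
    show "\<forall>\<^sub>F n in sequentially. ?D n < \<epsilon>"
      using evA evB
    proof eventually_elim
      case (elim n)
      obtain \<alpha>n where \<alpha>n: "\<alpha>n \<ge> 0" "?A n = ennreal \<alpha>n" "\<alpha>n < \<alpha> + e"
        using elim(1) \<alpha> e by (cases "?A n" rule: ennreal_cases) (auto simp: ennreal_less_iff simp
            del: ennreal_plus)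
      have S: "?D n + ?B n = ennreal (2 * \<alpha>n + 2 * \<alpha>)"
        unfolding sum \<alpha>n(2) \<alpha>(2) using \<alpha>n(1) \<alpha>(1) by (simp add: ennreal_plus ennreal_mult)
      then obtain \<delta> \<beta> where r: "\<delta> \<ge> 0" "\<beta> \<ge> 0" "?D n = ennreal \<delta>" "?B n = ennreal \<beta>"
        by (cases "?D n" rule: ennreal_cases; cases "?B n" rule: ennreal_cases) auto
      have "\<delta> + \<beta> = 2 * \<alpha>n + 2 * \<alpha>"
        using S r \<alpha>n \<alpha> by (simp flip: ennreal_plus)
      moreover have "4 * \<alpha> \<le> \<beta> + e"
        using elim(2) r e \<alpha> by (simp flip: ennreal_plus)
      ultimately have "\<delta> < 3 * e" using \<alpha>n by linarith
      then have "?D n < ennreal (3 * e)" using r by (simp add: ennreal_less_iff)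
      then show ?case using e(2) by simp
    qed
  qed simp
  then show ?thesis unfolding d_def .
qed

lemma
  fixes f :: "real^3 \<Rightarrow> 'b::real_normed_vector"
  assumes S: "open S" and f: "Ck_on 1 S f"
  shows Ck_on_1_shift: "Ck_on 1 {x. x + c \<in> S} (\<lambda>x. f (x + c))"
    and dir_deriv_shift: "x + c \<in> S \<Longrightarrow> dir_deriv b (\<lambda>x. f (x + c)) x = dir_deriv b f (x + c)"
proof -
  have "{x. x + c \<in> S} = (\<lambda>x. x + c) -` S" by auto
  then have o: "open {x. x + c \<in> S}"
    using S by (auto intro!: open_vimage continuous_intros)
  have D: "((\<lambda>x. f (x + c)) has_derivative (\<lambda>b. dir_deriv b f (x + c))) (at x)" if "x + c \<in> S" for x
    by (rule has_derivative_compose[where g=f and f="\<lambda>x. x + c", OF _ Ck_on_1_has_derivative[OF S f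
        that]])
      (auto intro!: derivative_eq_intros)
  show "dir_deriv b (\<lambda>x. f (x + c)) x = dir_deriv b f (x + c)" if "x + c \<in> S"
    by (rule dir_deriv_eqI[OF D[OF that]])
  show "Ck_on 1 {x. x + c \<in> S} (\<lambda>x. f (x + c))"
    unfolding Ck_on_1_iff[OF o]
  proof (intro exI conjI ballI)
    show "((\<lambda>x. f (x + c)) has_derivative (\<lambda>b. dir_deriv b f (x + c))) (at x)" if "x \<in> {x. x + c \<in>
        S}" for x
      using D that by simp
    show "continuous_on {x. x + c \<in> S} (\<lambda>x. dir_deriv b f (x + c))" for b
      by (intro continuous_on_compose2[OF continuous_on_dir_deriv[OF S f]] continuous_intros) auto
  qed
qed

text \<open>The closure lies in the image of the compact set between the graph and the level
  \<open>\<sigma>\<close> over the closed ball. A positive shift moves it strictly above the graph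
  and, being at most \<open>\<sigma>\<close>, keeps it below \<open>s\<close>. This supplies the
  neighbourhood of the closure on which the approximants of a trace must be C1.\<close>

lemma closure_lower_region_shift:
  assumes "x \<in> closure lower_region" "0 < \<tau>" "\<tau> \<le> \<sigma>"
  shows "x + \<tau> *\<^sub>R vert \<in> exterior"
proof -
  let ?K = "{z \<in> cball 0 r' \<times> {- \<sigma>..\<sigma>}. h (fst z) \<le> snd z}"
  have c: "continuous_on (cball 0 r' \<times> {- \<sigma>..\<sigma>}) (\<lambda>z. snd z - h (fst z))"
    by (intro continuous_intros continuous_on_compose2[OF continuous_on_h]) (use B_subset in auto)
  have "closed ((cball 0 r' \<times> {- \<sigma>..\<sigma>}) \<inter> (\<lambda>z. snd z - h (fst z)) -` {0..})"
    by (rule continuous_closed_preimage[OF c]) (auto intro!: closed_Times)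
  moreover have "(cball 0 r' \<times> {- \<sigma>..\<sigma>}) \<inter> (\<lambda>z. snd z - h (fst z)) -` {0..} = ?K" by auto
  ultimately have "closed ?K" by simp
  moreover have "bounded ?K"
    by (rule bounded_subset[OF bounded_Times[OF bounded_cball[of 0 r'] bounded_closed_interval[of
        "-\<sigma>" \<sigma>]]]) auto
  ultimately have "compact ?K" by (simp add: compact_eq_bounded_closed)
  moreover have "continuous_on ?K (\<lambda>z. p + \<phi> z)"
    by (intro continuous_intros continuous_on_\<phi>)
  ultimately have "compact ((\<lambda>z. p + \<phi> z) ` ?K)" by (rule compact_continuous_image[rotated])
  then have "closed ((\<lambda>z. p + \<phi> z) ` ?K)" by (rule compact_imp_closed)
  moreover have "lower_region \<subseteq> (\<lambda>z. p + \<phi> z) ` ?K"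
  proof
    fix x assume "x \<in> lower_region"
    then obtain y t where "x = p + \<phi> (y, t)" "y \<in> B" "h y < t" "t < \<sigma>"
      unfolding lower_region_def by (rule above_graphE)
    then show "x \<in> (\<lambda>z. p + \<phi> z) ` ?K"
      using h_less[of y] by (intro image_eqI[of _ _ "(y, t)"]) auto
  qed
  ultimately have "x \<in> (\<lambda>z. p + \<phi> z) ` ?K" using assms(1) closure_minimal by blast
  then obtain y t where x: "x = p + \<phi> (y, t)" "y \<in> cball 0 r'" "t \<le> \<sigma>" "h y \<le> t" by auto
  have "lift y (t + \<tau> - h y) \<in> exterior"
    using x assms r' \<sigma> by (intro lift_in_exterior) auto
  then show ?thesis unfolding x(1) add_vert by (simp add: lift_def)
qed

lemma area_element_bounded: "\<exists>C>0. \<forall>y\<in>B. area_element h y \<le> C"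
proof -
  have "continuous_on (cball 0 r') (area_element h)"
    unfolding area_element_def
    by (intro continuous_intros continuous_on_subset[OF continuous_on_dir_deriv[OF open_ball C1_h]
        B_subset(2)])
  then have "bounded (area_element h ` cball 0 r')"
    by (intro compact_imp_bounded compact_continuous_image) auto
  then obtain C where "C > 0" "\<forall>y\<in>cball 0 r'. norm (area_element h y) \<le> C" by (auto simp: bounded_pos)
  moreover have "area_element h y \<le> norm (area_element h y)" for y by simp
  ultimately show ?thesis using B_subset(3) by (meson order_trans subsetD)
qed

text \<open>The approximants are the translates of \<open>f\<close> by \<open>heights n\<close>,
  which are C1 past the graph. They converge in H1 by continuity of translation in mean square, and
  on the graph their squared error is at most the height times the fibre energy.\<close>

lemma has_graph_trace_vertical_limit:
  fixes f :: "real^3 \<Rightarrow> 'b::euclidean_space"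
  assumes f: "H1_classical region f" and ext: "Ck_on 1 exterior f"
  shows "has_graph_trace p \<phi> r' \<sigma> h f (vertical_limit f)"
  unfolding has_graph_trace_def
proof (intro conjI exI)
  have cf: "Ck_on 1 region f" using f by (simp add: H1_classical_def)
  have oe: "open exterior" by (simp add: open_Compl)
  let ?F = "\<lambda>n x. f (x + heights n *\<^sub>R vert)"
  have fl: "H1_classical lower_region f"
    by (rule H1_classical_subset[OF f lower_region_subset open_region open_lower_region])
  show "vertical_limit f \<in> borel_measurable (lebesgue_on B)"
    by (rule borel_measurable_vertical_limit[OF Ck_on_imp_continuous_on[OF cf]])
  show "\<forall>n. \<exists>V. open V \<and> closure (above_graph p \<phi> r' \<sigma> h) \<subseteq> V \<and> Ck_on 1 V (?F n)"
  proof
    fix n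
    have "{x. x + heights n *\<^sub>R vert \<in> exterior} = (\<lambda>x. x + heights n *\<^sub>R vert) -` exterior" by auto
    then have "open {x. x + heights n *\<^sub>R vert \<in> exterior}"
      using oe by (auto intro!: open_vimage continuous_intros)
    moreover have "closure (above_graph p \<phi> r' \<sigma> h) \<subseteq> {x. x + heights n *\<^sub>R vert \<in> exterior}"
      using closure_lower_region_shift heights[of n] unfolding lower_region_def by auto
    ultimately show "\<exists>V. open V \<and> closure (above_graph p \<phi> r' \<sigma> h) \<subseteq> V \<and> Ck_on 1 V (?F n)"
      using Ck_on_1_shift[OF oe ext] by blast
  qed
  show "H1_tendsto (above_graph p \<phi> r' \<sigma> h) ?F f"
    unfolding H1_tendsto_def lower_region_def[symmetric]
  proof (intro conjI ballI)
    show "L2_on lower_region f" using fl by (simp add: H1_classical_def)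
    show "(\<lambda>n. \<integral>\<^sup>+x. ennreal ((norm (?F n x - f x))\<^sup>2) \<partial>lebesgue_on lower_region) \<longlonglongrightarrow> 0"
      using f by (intro shift_tendsto_L2 Ck_on_imp_continuous_on[OF cf]) (simp add: H1_classical_def)
    fix b :: "real^3" assume b: "b \<in> Basis"
    show "\<exists>g. L2_on lower_region g \<and> weak_deriv lower_region b f g \<and>
        (\<lambda>n. \<integral>\<^sup>+x. ennreal ((norm (dir_deriv b (?F n) x - g x))\<^sup>2) \<partial>lebesgue_on lower_region) \<longlonglongrightarrow> 0"
    proof (intro exI conjI)
      show "L2_on lower_region (dir_deriv b f)" using fl b by (simp add: H1_classical_def)
      show "weak_deriv lower_region b f (dir_deriv b f)"
        using fl by (intro weak_deriv_classical open_lower_region) (simp add: H1_classical_def)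
      have "(\<lambda>n. \<integral>\<^sup>+x. ennreal ((norm (dir_deriv b f (x + heights n *\<^sub>R vert) - dir_deriv b f
          x))\<^sup>2) \<partial>lebesgue_on lower_region) \<longlonglongrightarrow> 0"
        using f b by (intro shift_tendsto_L2 continuous_on_dir_deriv[OF open_region cf]) (simp add:
            H1_classical_def)
      moreover have "(\<integral>\<^sup>+x. ennreal ((norm (dir_deriv b f (x + heights n *\<^sub>R vert) - dir_deriv b f
          x))\<^sup>2) \<partial>lebesgue_on lower_region)
        = (\<integral>\<^sup>+x. ennreal ((norm (dir_deriv b (?F n) x - dir_deriv b f x))\<^sup>2) \<partial>lebesgue_on
            lower_region)" for n
      proof (rule nn_integral_cong)
        fix x assume "x \<in> space (lebesgue_on lower_region)"
        then have "x + heights n *\<^sub>R vert \<in> region"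
          using heights[of n] by (intro shift_lower_region) auto
        then show "ennreal ((norm (dir_deriv b f (x + heights n *\<^sub>R vert) - dir_deriv b f x))\<^sup>2)
          = ennreal ((norm (dir_deriv b (?F n) x - dir_deriv b f x))\<^sup>2)"
          by (simp add: dir_deriv_shift[OF open_region cf])
      qed
      ultimately show "(\<lambda>n. \<integral>\<^sup>+x. ennreal ((norm (dir_deriv b (?F n) x - dir_deriv b f x))\<^sup>2)
          \<partial>lebesgue_on lower_region) \<longlonglongrightarrow> 0"
        by simp
    qed
  qed
  obtain C where C: "C > 0" "\<And>y. y \<in> B \<Longrightarrow> area_element h y \<le> C" using area_element_bounded by blast
  let ?G = "fibre_energy (dir_deriv vert f)"
  have c: "continuous_on region (dir_deriv vert f)" by (rule continuous_on_dir_deriv[OF open_region cf])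
  have G: "(\<integral>\<^sup>+y. ?G y \<partial>lebesgue_on B) < top"
    using nn_integral_fibre_energy_le[OF c]
      L2_on_nn_integral_finite[OF H1_classical_L2_dir_deriv[OF open_region f, of vert]] by simp
  have "(\<lambda>n. (\<integral>\<^sup>+y. ?G y \<partial>lebesgue_on B) * ennreal (C * heights n)) \<longlonglongrightarrow> (\<integral>\<^sup>+y. ?G y \<partial>lebesgue_on B) *
      ennreal (C * 0)"
    by (intro ennreal_tendsto_cmult[OF G] tendsto_ennrealI tendsto_intros heights_tendsto_0)
  then have lim: "(\<lambda>n. (\<integral>\<^sup>+y. ?G y \<partial>lebesgue_on B) * ennreal (C * heights n)) \<longlonglongrightarrow> 0" by simp
  show "(\<lambda>n. \<integral>\<^sup>+y. ennreal ((norm (?F n (graph_point p \<phi> h y) - vertical_limit f y))\<^sup>2 *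
      area_element h y)
      \<partial>lebesgue_on B) \<longlonglongrightarrow> 0"
  proof (rule tendsto_sandwich[OF _ _ tendsto_const lim])
    show "\<forall>\<^sub>F n in sequentially. (\<integral>\<^sup>+y. ennreal ((norm (?F n (graph_point p \<phi> h y) - vertical_limit
        f y))\<^sup>2 * area_element h y)
      \<partial>lebesgue_on B) \<le> (\<integral>\<^sup>+y. ?G y \<partial>lebesgue_on B) * ennreal (C * heights n)"
    proof (intro always_eventually allI)
      fix n
      have "(\<integral>\<^sup>+y. ennreal ((norm (?F n (graph_point p \<phi> h y) - vertical_limit f y))\<^sup>2 *
          area_element h y) \<partial>lebesgue_on B)
        \<le> (\<integral>\<^sup>+y. ?G y * ennreal (C * heights n) \<partial>lebesgue_on B)"
      proof (rule nn_integral_mono_AE)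
        show "AE y in lebesgue_on B. ennreal ((norm (?F n (graph_point p \<phi> h y) - vertical_limit f
            y))\<^sup>2 * area_element h y)
          \<le> ?G y * ennreal (C * heights n)"
          using AE_vertical_limit_dist[OF f] AE_space
        proof eventually_elim
          case (elim y)
          have "graph_point p \<phi> h y + heights n *\<^sub>R vert = lift y (heights n)"
            using lift_eq[of y "heights n"] by (simp add: lift_0)
          then have "ennreal ((norm (?F n (graph_point p \<phi> h y) - vertical_limit f y))\<^sup>2 *
              area_element h y)
            \<le> ennreal ((norm (f (lift y (heights n)) - vertical_limit f y))\<^sup>2 * C)"
            using C(2)[of y] elim by (intro ennreal_leI) (auto intro!: mult_left_mono)
          also have "\<dots> = ennreal ((norm (f (lift y (heights n)) - vertical_limit f y))\<^sup>2) * ennreal C"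
            using C by (simp add: ennreal_mult)
          also have "\<dots> \<le> (ennreal (heights n) * ?G y) * ennreal C"
            using elim heights[of n] by (intro mult_right_mono) auto
          also have "\<dots> = ?G y * ennreal (C * heights n)"
            using C heights[of n] by (simp add: ennreal_mult ac_simps less_imp_le)
          finally show ?case .
        qed
      qed
      also have "\<dots> = (\<integral>\<^sup>+y. ?G y \<partial>lebesgue_on B) * ennreal (C * heights n)"
        by (rule nn_integral_multc[OF borel_measurable_fibre_energy[OF c]])
      finally show "(\<integral>\<^sup>+y. ennreal ((norm (?F n (graph_point p \<phi> h y) - vertical_limit f y))\<^sup>2 *
          area_element h y)
        \<partial>lebesgue_on B) \<le> \<dots>" .
    qed
  qed auto
qed

end

section \<open>Second derivatives and vector calculus\<close>

text \<open>Two mean value theorems, in the direction \<open>a\<close> and then in the direction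
  \<open>b\<close>; their order decides which mixed derivative appears.\<close>

lemma mixed_difference_eq:
  fixes f :: "'a::euclidean_space \<Rightarrow> real"
  assumes S: "open S" and f: "Ck_on 2 S f" and a: "a \<in> Basis" and t: "t > 0"
    and sub: "\<And>s s'. s \<in> {0..t} \<Longrightarrow> s' \<in> {0..t} \<Longrightarrow> x + s *\<^sub>R a + s' *\<^sub>R b \<in> S"
  shows "\<exists>\<theta>\<in>{0..t}. \<exists>\<eta>\<in>{0..t}. f (x + t *\<^sub>R a + t *\<^sub>R b) - f (x + t *\<^sub>R a) - (f (x + t *\<^sub>R b) - f x)
    = t\<^sup>2 * dir_deriv b (dir_deriv a f) (x + \<theta> *\<^sub>R a + \<eta> *\<^sub>R b)"
proof -
  have f1: "Ck_on 1 S f" by (rule Ck_on_mono[OF f]) simp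
  have f2: "Ck_on 1 S (dir_deriv a f)" using f a by (simp add: numeral_2_eq_2)
  have D: "((\<lambda>s. g (z + s *\<^sub>R v)) has_real_derivative dir_deriv v g (z + s *\<^sub>R v)) (at s)"
    if g: "Ck_on 1 S g" and z: "z + s *\<^sub>R v \<in> S" for g :: "'a \<Rightarrow> real" and z v s
  proof -
    have h: "(g has_derivative (\<lambda>b. dir_deriv b g (z + s *\<^sub>R v))) (at (z + s *\<^sub>R v))"
      by (rule Ck_on_1_has_derivative[OF S g z])
    have "((\<lambda>s. g (z + s *\<^sub>R v)) has_derivative (\<lambda>h. dir_deriv (h *\<^sub>R v) g (z + s *\<^sub>R v))) (at s)"
      by (rule has_derivative_compose[where g=g and f="\<lambda>s. z + s *\<^sub>R v", OF _ h])
        (auto intro!: derivative_eq_intros)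
    moreover have "dir_deriv (h *\<^sub>R v) g (z + s *\<^sub>R v) = h * dir_deriv v g (z + s *\<^sub>R v)" for h
      using linear_cmul[OF has_derivative_linear[OF h]] by simp
    ultimately show ?thesis by (simp add: has_field_derivative_def mult.commute[of _ "dir_deriv v g
        (z + s *\<^sub>R v)"])
  qed
  define u where "u s = f (x + t *\<^sub>R b + s *\<^sub>R a) - f (x + s *\<^sub>R a)" for s
  have "\<exists>\<theta>. 0 < \<theta> \<and> \<theta> < t \<and> u t - u 0 = (t - 0) * (dir_deriv a f (x + t *\<^sub>R b + \<theta> *\<^sub>R a) -
      dir_deriv a f (x + \<theta> *\<^sub>R a))"
  proof (rule MVT2[OF t])
    fix s assume s: "0 \<le> s" "s \<le> t"
    have "x + t *\<^sub>R b + s *\<^sub>R a \<in> S" "x + s *\<^sub>R a \<in> S"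
      using sub[of s t] sub[of s 0] s t by (auto simp: ac_simps)
    then show "(u has_real_derivative dir_deriv a f (x + t *\<^sub>R b + s *\<^sub>R a) - dir_deriv a f (x + s
        *\<^sub>R a)) (at s)"
      unfolding u_def by (intro DERIV_diff D f1)
  qed
  then obtain \<theta> where \<theta>: "0 < \<theta>" "\<theta> < t"
    "u t - u 0 = t * (dir_deriv a f (x + t *\<^sub>R b + \<theta> *\<^sub>R a) - dir_deriv a f (x + \<theta> *\<^sub>R a))" by auto
  have "\<exists>\<eta>. 0 < \<eta> \<and> \<eta> < t \<and> dir_deriv a f (x + \<theta> *\<^sub>R a + t *\<^sub>R b) - dir_deriv a f (x + \<theta> *\<^sub>R a + 0
      *\<^sub>R b)
      = (t - 0) * dir_deriv b (dir_deriv a f) (x + \<theta> *\<^sub>R a + \<eta> *\<^sub>R b)"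
    by (rule MVT2[OF t], rule D[OF f2]) (use sub \<theta> in auto)
  then obtain \<eta> where \<eta>: "0 < \<eta>" "\<eta> < t" "dir_deriv a f (x + \<theta> *\<^sub>R a + t *\<^sub>R b) - dir_deriv a f (x
      + \<theta> *\<^sub>R a)
      = t * dir_deriv b (dir_deriv a f) (x + \<theta> *\<^sub>R a + \<eta> *\<^sub>R b)" by auto
  have "f (x + t *\<^sub>R a + t *\<^sub>R b) - f (x + t *\<^sub>R a) - (f (x + t *\<^sub>R b) - f x) = u t - u 0"
    by (simp add: u_def ac_simps)
  also have "\<dots> = t * (dir_deriv a f (x + \<theta> *\<^sub>R a + t *\<^sub>R b) - dir_deriv a f (x + \<theta> *\<^sub>R a))"
    unfolding \<theta>(3) by (simp add: ac_simps)
  also have "\<dots> = t\<^sup>2 * dir_deriv b (dir_deriv a f) (x + \<theta> *\<^sub>R a + \<eta> *\<^sub>R b)"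
    unfolding \<eta>(3) by (simp add: power2_eq_square)
  finally show ?thesis using \<theta> \<eta> by (intro bexI[of _ \<theta>] bexI[of _ \<eta>]) auto
qed

text \<open>The second difference is symmetric in \<open>a\<close> and \<open>b\<close>, so after
  division by the squared step both mixed derivatives agree at points that converge to
  \<open>x\<close>, and they are continuous there.\<close>

lemma dir_deriv_commute_real:
  fixes f :: "'a::euclidean_space \<Rightarrow> real"
  assumes S: "open S" and f: "Ck_on 2 S f" and ab: "a \<in> Basis" "b \<in> Basis" and x: "x \<in> S"
  shows "dir_deriv a (dir_deriv b f) x = dir_deriv b (dir_deriv a f) x"
proof -
  obtain \<epsilon> where \<epsilon>: "\<epsilon> > 0" "ball x \<epsilon> \<subseteq> S" using S x open_contains_ball by blast
  \<comment> \<open>Less than half of \<open>\<epsilon>\<close> in each direction keeps the whole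
    square of side \<open>t n\<close> inside the ball.\<close>
  define t where "t n = \<epsilon> / 2 / (real n + 2)" for n
  have "0 \<le> real n * \<epsilon>" for n using \<epsilon> by simp
  then have t: "0 < t n" "t n < \<epsilon> / 2" for n
    using \<epsilon> by (auto simp: t_def field_simps add_pos_nonneg)
  have "filterlim (\<lambda>n. 2 + real n) at_top sequentially"
    by (rule filterlim_tendsto_add_at_top[OF tendsto_const filterlim_real_sequentially])
  then have "filterlim (\<lambda>n. real n + 2) at_infinity sequentially"
    by (simp add: add.commute filterlim_at_top_imp_at_infinity)
  then have t0: "t \<longlonglongrightarrow> 0" unfolding t_def by (rule tendsto_divide_0[OF tendsto_const])
  have near: "x + s *\<^sub>R v + s' *\<^sub>R w \<in> S"
    if "s \<in> {0..t n}" "s' \<in> {0..t n}" "v \<in> Basis" "w \<in> Basis" for n s s' v w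
  proof -
    have "norm (s *\<^sub>R v + s' *\<^sub>R w) \<le> s + s'"
      using norm_triangle_ineq[of "s *\<^sub>R v" "s' *\<^sub>R w"] that by auto
    also have "\<dots> < \<epsilon>" using that t[of n] by auto
    finally have "dist (x + (s *\<^sub>R v + s' *\<^sub>R w)) x < \<epsilon>" by (simp add: dist_norm)
    then have "x + (s *\<^sub>R v + s' *\<^sub>R w) \<in> ball x \<epsilon>" by (simp only: mem_ball dist_commute)
    then show ?thesis using \<epsilon>(2) by (auto simp: add.assoc)
  qed
  have lim: "(\<lambda>n. dir_deriv w (dir_deriv v f) (x + \<theta> n *\<^sub>R v + \<eta> n *\<^sub>R w)) \<longlonglongrightarrow> dir_deriv w (dir_deriv
      v f) x"
    if v: "v \<in> Basis" "w \<in> Basis" and r: "\<And>n. \<theta> n \<in> {0..t n}" "\<And>n. \<eta> n \<in> {0..t n}" for v w \<theta> \<eta>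
  proof -
    have "Ck_on 1 S (dir_deriv v f)" using f v by (simp add: numeral_2_eq_2)
    then have "isCont (dir_deriv w (dir_deriv v f)) x"
      using continuous_on_dir_deriv[OF S, of "dir_deriv v f" w] S x by (simp add:
          continuous_on_eq_continuous_at)
    moreover have "\<theta> \<longlonglongrightarrow> 0" "\<eta> \<longlonglongrightarrow> 0"
      by (rule tendsto_sandwich[OF _ _ tendsto_const t0]; use r in auto)+
    then have "(\<lambda>n. x + \<theta> n *\<^sub>R v + \<eta> n *\<^sub>R w) \<longlonglongrightarrow> x + 0 *\<^sub>R v + 0 *\<^sub>R w"
      by (intro tendsto_intros)
    ultimately show ?thesis by (intro isCont_tendsto_compose[of x "dir_deriv w (dir_deriv v f)"]) auto
  qed
  define \<Delta> where "\<Delta> n = f (x + t n *\<^sub>R a + t n *\<^sub>R b) - f (x + t n *\<^sub>R a) - (f (x + t n *\<^sub>R b) - f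
      x)" for n
  define Q where "Q v w n \<theta> \<eta> \<longleftrightarrow> \<theta> \<in> {0..t n} \<and> \<eta> \<in> {0..t n} \<and>
    \<Delta> n = (t n)\<^sup>2 * dir_deriv w (dir_deriv v f) (x + \<theta> *\<^sub>R v + \<eta> *\<^sub>R w)" for v w n \<theta> \<eta>
  have Qab: "\<exists>\<theta> \<eta>. Q a b n \<theta> \<eta>" for n
  proof -
    have "\<exists>\<theta>\<in>{0..t n}. \<exists>\<eta>\<in>{0..t n}. \<Delta> n = (t n)\<^sup>2 * dir_deriv b (dir_deriv a f) (x + \<theta> *\<^sub>R a + \<eta> *\<^sub>R b)"
      unfolding \<Delta>_def by (rule mixed_difference_eq[OF S f ab(1) t(1)], rule near[OF _ _ ab],
          assumption+)
    then obtain \<theta> \<eta> where "\<theta> \<in> {0..t n}" "\<eta> \<in> {0..t n}"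
      "\<Delta> n = (t n)\<^sup>2 * dir_deriv b (dir_deriv a f) (x + \<theta> *\<^sub>R a + \<eta> *\<^sub>R b)"
      by (elim bexE)
    then show ?thesis unfolding Q_def by (intro exI[of _ \<theta>] exI[of _ \<eta>] conjI)
  qed
  have Qba: "\<exists>\<theta> \<eta>. Q b a n \<theta> \<eta>" for n
  proof -
    have \<Delta>: "\<Delta> n = f (x + t n *\<^sub>R b + t n *\<^sub>R a) - f (x + t n *\<^sub>R b) - (f (x + t n *\<^sub>R a) - f x)"
      by (simp add: \<Delta>_def ac_simps)
    have "\<exists>\<theta>\<in>{0..t n}. \<exists>\<eta>\<in>{0..t n}. \<Delta> n = (t n)\<^sup>2 * dir_deriv a (dir_deriv b f) (x + \<theta> *\<^sub>R b + \<eta> *\<^sub>R a)"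
      unfolding \<Delta> by (rule mixed_difference_eq[OF S f ab(2) t(1)], rule near[OF _ _ ab(2,1)],
          assumption+)
    then obtain \<theta> \<eta> where "\<theta> \<in> {0..t n}" "\<eta> \<in> {0..t n}"
      "\<Delta> n = (t n)\<^sup>2 * dir_deriv a (dir_deriv b f) (x + \<theta> *\<^sub>R b + \<eta> *\<^sub>R a)"
      by (elim bexE)
    then show ?thesis unfolding Q_def by (intro exI[of _ \<theta>] exI[of _ \<eta>] conjI)
  qed
  obtain \<theta> \<eta> where "\<And>n. Q a b n (\<theta> n) (\<eta> n)" using Qab by metis
  then have 1: "\<theta> n \<in> {0..t n}" "\<eta> n \<in> {0..t n}"
    "\<Delta> n = (t n)\<^sup>2 * dir_deriv b (dir_deriv a f) (x + \<theta> n *\<^sub>R a + \<eta> n *\<^sub>R b)" for n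
    unfolding Q_def by blast+
  obtain \<theta>' \<eta>' where "\<And>n. Q b a n (\<theta>' n) (\<eta>' n)" using Qba by metis
  then have 2: "\<theta>' n \<in> {0..t n}" "\<eta>' n \<in> {0..t n}"
    "\<Delta> n = (t n)\<^sup>2 * dir_deriv a (dir_deriv b f) (x + \<theta>' n *\<^sub>R b + \<eta>' n *\<^sub>R a)" for n
    unfolding Q_def by blast+
  have "dir_deriv b (dir_deriv a f) (x + \<theta> n *\<^sub>R a + \<eta> n *\<^sub>R b) = dir_deriv a (dir_deriv b f) (x +
      \<theta>' n *\<^sub>R b + \<eta>' n *\<^sub>R a)" for n
    using 1(3)[of n] 2(3)[of n] t(1)[of n] by simp
  then show ?thesis
    using lim[OF ab 1(1,2)] lim[OF ab(2,1) 2(1,2)] LIMSEQ_unique by simp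
qed

lemma dir_deriv_commute:
  fixes f :: "'a::euclidean_space \<Rightarrow> 'b::euclidean_space"
  assumes S: "open S" and f: "Ck_on 2 S f" and ab: "a \<in> Basis" "b \<in> Basis" and x: "x \<in> S"
  shows "dir_deriv a (dir_deriv b f) x = dir_deriv b (dir_deriv a f) x"
proof (rule euclidean_eqI)
  fix i :: 'b
  have bl: "bounded_linear (\<lambda>v. v \<bullet> i)" by (rule bounded_linear_inner_left)
  have d: "f differentiable_on S" and dd: "\<And>b. b \<in> Basis \<Longrightarrow> dir_deriv b f differentiable_on S"
    using f by (auto simp: numeral_2_eq_2)
  have c: "dir_deriv v (dir_deriv w (\<lambda>x. f x \<bullet> i)) x = dir_deriv v (dir_deriv w f) x \<bullet> i"
    if w: "w \<in> Basis" for v w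
  proof -
    have "dir_deriv v (dir_deriv w (\<lambda>x. f x \<bullet> i)) x = dir_deriv v (\<lambda>x. dir_deriv w f x \<bullet> i) x"
      by (rule dir_deriv_cong[OF S x dir_deriv_linear_comp[OF bl d S]])
    also have "\<dots> = dir_deriv v (dir_deriv w f) x \<bullet> i"
      by (rule dir_deriv_linear_comp[OF bl dd[OF w] S x])
    finally show ?thesis .
  qed
  show "dir_deriv a (dir_deriv b f) x \<bullet> i = dir_deriv b (dir_deriv a f) x \<bullet> i"
    using dir_deriv_commute_real[OF S Ck_on_linear_comp[OF bl S f] ab x] c ab by simp
qed

text \<open>Writes the Jacobian as a sum of linear images of the partial derivatives, so that
  smoothness, square integrability and limits of the Jacobian, and with it of divergence and curl,
  follow from linearity.\<close>

definition column_matrix :: "3 \<Rightarrow> complex^3 \<Rightarrow> complex^3^3" where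
  "column_matrix i v = (\<chi> j k. if k = i then v $ j else 0)"

lemma bounded_linear_column_matrix: "bounded_linear (column_matrix i)"
  unfolding linear_conv_bounded_linear[symmetric] column_matrix_def
  by (intro linearI) (auto simp: vec_eq_iff)

lemma bounded_linear_trace: "bounded_linear (trace :: complex^3^3 \<Rightarrow> complex)"
  unfolding linear_conv_bounded_linear[symmetric] trace_def
  by (intro linearI) (auto simp: sum.distrib scaleR_right.sum)

lemma bounded_linear_curl_of_jacobian: "bounded_linear curl_of_jacobian"
  unfolding linear_conv_bounded_linear[symmetric] curl_of_jacobian_def
  by (intro linearI) (auto simp: vec_eq_iff forall_3 scaleR_right_diff_distrib)

lemma jacobian_eq_sum: "jacobian U x = (\<Sum>i\<in>UNIV. column_matrix i (pd i U x))"
  by (auto simp: jacobian_def column_matrix_def vec_eq_iff sum_3 exhaust_3)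
    (metis exhaust_3)

lemma dir_deriv_sum:
  assumes S: "open S" and "finite I" and "\<And>i. i \<in> I \<Longrightarrow> f i differentiable_on S" and x: "x \<in> S"
  shows "dir_deriv b (\<lambda>x. \<Sum>i\<in>I. f i x) x = (\<Sum>i\<in>I. dir_deriv b (f i) x)"
  by (rule dir_deriv_eqI) (intro has_derivative_sum differentiable_on_open_has_derivative[OF
      assms(3) S x])

lemma pd_jacobian:
  assumes S: "open S" and U: "Ck_on 2 S U" and x: "x \<in> S"
  shows "dir_deriv b (jacobian U) x = (\<Sum>i\<in>UNIV. column_matrix i (dir_deriv b (pd i U) x))"
proof -
  have d: "pd i U differentiable_on S" for i
    using U by (simp add: numeral_2_eq_2 pd_def)
  have "jacobian U = (\<lambda>x. \<Sum>i\<in>UNIV. column_matrix i (pd i U x))" using jacobian_eq_sum by blast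
  then have "dir_deriv b (jacobian U) x = (\<Sum>i\<in>UNIV. dir_deriv b (\<lambda>x. column_matrix i (pd i U x)) x)"
    using dir_deriv_sum[OF S finite differentiable_on_linear_comp[OF bounded_linear_column_matrix
        d] x] by simp
  then show ?thesis
    by (simp add: dir_deriv_linear_comp[OF bounded_linear_column_matrix d S x])
qed

lemma Ck_on_sum:
  fixes f :: "3 \<Rightarrow> 'a::euclidean_space \<Rightarrow> 'b::real_normed_vector"
  assumes S: "open S" and f: "\<And>i. Ck_on k S (f i)"
  shows "Ck_on k S (\<lambda>x. \<Sum>i\<in>UNIV. f i x)"
  unfolding sum_3 by (intro Ck_on_add S f)

lemma Ck_on_jacobian:
  assumes S: "open S" and U: "\<And>i. Ck_on k S (pd i U)"
  shows "Ck_on k S (jacobian U)"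
proof -
  have "jacobian U = (\<lambda>x. \<Sum>i\<in>UNIV. column_matrix i (pd i U x))" using jacobian_eq_sum by blast
  then show ?thesis
    using Ck_on_sum[OF S Ck_on_linear_comp[OF bounded_linear_column_matrix S U]] by simp
qed

lemma dir_deriv_divergence:
  assumes S: "open S" and U: "Ck_on 2 S U" and x: "x \<in> S"
  shows "dir_deriv b (divergence U) x = trace (dir_deriv b (jacobian U) x)"
proof -
  have "Ck_on 1 S (pd i U)" for i using U by (simp add: numeral_2_eq_2 pd_def)
  then have "Ck_on 1 S (jacobian U)" by (rule Ck_on_jacobian[OF S])
  then have "jacobian U differentiable_on S" by simp
  from dir_deriv_linear_comp[OF bounded_linear_trace this S x, of b] show ?thesis
    unfolding divergence_def[abs_def] .
qed

lemma dir_deriv_curl: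
  assumes S: "open S" and U: "Ck_on 2 S U" and x: "x \<in> S"
  shows "dir_deriv b (curl U) x = curl_of_jacobian (dir_deriv b (jacobian U) x)"
proof -
  have "Ck_on 1 S (pd i U)" for i using U by (simp add: numeral_2_eq_2 pd_def)
  then have "Ck_on 1 S (jacobian U)" by (rule Ck_on_jacobian[OF S])
  then have "jacobian U differentiable_on S" by simp
  from dir_deriv_linear_comp[OF bounded_linear_curl_of_jacobian this S x, of b] show ?thesis
    unfolding curl_def[abs_def] .
qed

text \<open>The vector Laplacian is the gradient of the divergence minus the double curl, by
  symmetry of second derivatives. This isolates the two quantities between which the boundary
  conditions have to be traded.\<close>

lemma lame_operator_eq:
  assumes S: "open S" and U: "Ck_on 2 S U" and x: "x \<in> S"
  shows "lame_operator lam \<mu> U x = (lam + 2 * \<mu>) *\<^sub>R gradient (divergence U) x - \<mu> *\<^sub>R curl (curl U) x"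
proof -
  define P where "P i j k = pd i (pd j U) x $ k" for i j k
  have sym: "P i j k = P j i k" for i j k
    unfolding P_def pd_def using dir_deriv_commute[OF S U _ _ x] by simp
  have div: "pd i (divergence U) x = P i 1 1 + P i 2 2 + P i 3 3" for i
    using dir_deriv_divergence[OF S U x] pd_jacobian[OF S U x]
    by (simp add: pd_def[of i] P_def trace_def sum_3 column_matrix_def)
  have curl: "pd i (curl U) x = vector [P i 2 3 - P i 3 2, P i 3 1 - P i 1 3, P i 1 2 - P i 2 1]" for i
    using dir_deriv_curl[OF S U x] pd_jacobian[OF S U x]
    by (simp add: pd_def[of i] P_def curl_of_jacobian_def sum_3 column_matrix_def)
  have cc: "curl (curl U) x = vector [P 2 1 2 - P 2 2 1 - (P 3 3 1 - P 3 1 3),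
      P 3 2 3 - P 3 3 2 - (P 1 1 2 - P 1 2 1), P 1 3 1 - P 1 1 3 - (P 2 2 3 - P 2 3 2)]"
    unfolding curl_def[of "curl U"] curl_of_jacobian_def jacobian_def by (simp add: curl)
  have lap: "laplacian U x $ k = P 1 1 k + P 2 2 k + P 3 3 k" for k
    by (simp add: laplacian_def P_def sum_3)
  show ?thesis
    unfolding lame_operator_def vec_eq_iff forall_3
    by (simp add: cc lap gradient_def div sym[of 2 1] sym[of 3 1] sym[of 3 2] scaleR_conv_of_real
        algebra_simps)
qed

context boundary_chart
begin

text \<open>Square integrability in \<open>region\<close> gives convergence along fibres. The C1
  property in the whole exterior is for the translates, which must be C1 near the closure of
  \<open>lower_region\<close>, lateral faces included, and for bounds on compact pieces of a
  level.\<close>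

definition regular :: "(real^3 \<Rightarrow> 'b::euclidean_space) \<Rightarrow> bool" where
  "regular f \<longleftrightarrow> Ck_on 1 exterior f \<and> H1_classical region f"

lemma open_exterior: "open exterior" by (simp add: open_Compl)

lemma regular_transform:
  fixes f g :: "real^3 \<Rightarrow> 'b::euclidean_space"
  assumes "regular g" "\<And>x. x \<in> exterior \<Longrightarrow> f x = g x"
  shows "regular f"
proof -
  have "Ck_on 1 exterior f"
    by (rule Ck_on_transform[OF open_exterior _ assms(2)]) (use assms(1) in \<open>auto simp only:
        regular_def\<close>)
  moreover have "H1_classical region f"
    by (rule H1_classical_transform[OF open_region, of g]) (use assms region_subset in \<open>auto simp:
        regular_def\<close>)
  ultimately show ?thesis by (simp only: regular_def)
qed

lemma regular_linear_comp:
  fixes f :: "real^3 \<Rightarrow> 'b::euclidean_space" and L :: "'b \<Rightarrow> 'c::euclidean_space"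
  assumes L: "bounded_linear L" and f: "regular f"
  shows "regular (\<lambda>x. L (f x))"
  using Ck_on_linear_comp[OF L open_exterior, of 1 f] H1_classical_linear_comp[OF L open_region, of f] f
  by (simp only: regular_def)

lemma regular_sum:
  fixes f :: "3 \<Rightarrow> real^3 \<Rightarrow> 'b::euclidean_space"
  assumes "\<And>i. regular (f i)"
  shows "regular (\<lambda>x. \<Sum>i\<in>UNIV. f i x)"
proof -
  have "Ck_on 1 exterior (\<lambda>x. \<Sum>i\<in>UNIV. f i x)"
    by (rule Ck_on_sum[OF open_exterior]) (use assms in \<open>simp only: regular_def\<close>)
  moreover have "H1_classical region (\<lambda>x. \<Sum>i\<in>UNIV. f i x)"
    by (rule H1_classical_sum[OF open_region]) (use assms in \<open>auto simp: regular_def\<close>)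
  ultimately show ?thesis by (simp only: regular_def)
qed

lemma regular_Pair:
  fixes f :: "real^3 \<Rightarrow> 'b::euclidean_space" and g :: "real^3 \<Rightarrow> 'c::euclidean_space"
  assumes f: "regular f" and g: "regular g"
  shows "regular (\<lambda>x. (f x, g x))"
proof -
  have "Ck_on 1 exterior (\<lambda>x. (f x, 0) + (0, g x))"
    using f g by (intro Ck_on_add open_exterior Ck_on_linear_comp[of "\<lambda>a. (a, 0)"]
        Ck_on_linear_comp[of "\<lambda>a. (0, a)"]
        bounded_linear_Pair bounded_linear_ident bounded_linear_zero) (simp_all only: regular_def)
  then have "Ck_on 1 exterior (\<lambda>x. (f x, g x))" by simp
  then show ?thesis
    using f g H1_classical_Pair[OF open_region, of f g] by (simp only: regular_def)
qed

lemma regular_jacobian: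
  assumes "\<And>i. regular (pd i U)"
  shows "regular (jacobian U)"
proof -
  have "jacobian U = (\<lambda>x. \<Sum>i\<in>UNIV. column_matrix i (pd i U x))" using jacobian_eq_sum by blast
  then show ?thesis
    using regular_sum[OF regular_linear_comp[OF bounded_linear_column_matrix assms]] by simp
qed

lemma regular_divergence: "(\<And>i. regular (pd i U)) \<Longrightarrow> regular (divergence U)"
  unfolding divergence_def[abs_def]
  by (rule regular_linear_comp[OF bounded_linear_trace regular_jacobian])

lemma regular_dir_deriv_jacobian:
  assumes "Ck_on 2 exterior U" "\<And>i. regular (dir_deriv b (pd i U))"
  shows "regular (dir_deriv b (jacobian U))"
  by (rule regular_transform[OF regular_sum[OF regular_linear_comp[OF bounded_linear_column_matrix
      assms(2)]]])
    (rule pd_jacobian[OF open_exterior assms(1)])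

lemma regular_dir_deriv_divergence:
  assumes "Ck_on 2 exterior U" "\<And>i. regular (dir_deriv b (pd i U))"
  shows "regular (dir_deriv b (divergence U))"
  by (rule regular_transform[OF regular_linear_comp[OF bounded_linear_trace
      regular_dir_deriv_jacobian[OF assms]]])
    (rule dir_deriv_divergence[OF open_exterior assms(1)])

lemma regular_curl_curl:
  assumes U: "Ck_on 2 exterior U" and r: "\<And>i j. regular (pd j (pd i U))"
  shows "regular (curl (curl U))"
proof -
  have "regular (pd j (curl U))" for j
    unfolding pd_def
  proof (rule regular_transform)
    show "regular (\<lambda>x. curl_of_jacobian (dir_deriv (axis j 1) (jacobian U) x))"
      by (rule regular_linear_comp[OF bounded_linear_curl_of_jacobian regular_dir_deriv_jacobian[OF U]])
        (use r[of j] in \<open>simp only: pd_def[of j]\<close>)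
    show "dir_deriv (axis j 1) (curl U) x = curl_of_jacobian (dir_deriv (axis j 1) (jacobian U) x)"
      if "x \<in> exterior" for x
      by (rule dir_deriv_curl[OF open_exterior U that])
  qed
  then show ?thesis
    unfolding curl_def[of "curl U", abs_def]
    by (intro regular_linear_comp[OF bounded_linear_curl_of_jacobian] regular_jacobian)
qed

end

section \<open>Tangential derivatives of traces\<close>

text \<open>Trades a square for a linear bound, so that the fibre energy itself, and not its root,
  can serve in an integrable majorant.\<close>

lemma le_1_add_if_power2_le:
  fixes x c :: real
  assumes "x\<^sup>2 \<le> c"
  shows "x \<le> 1 + c"
proof -
  have "2 * x \<le> 1 + x\<^sup>2" using sum_squares_bound[of 1 x] by simp
  moreover have "0 \<le> x\<^sup>2" by simp
  ultimately show ?thesis using assms by linarith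
qed

context boundary_chart
begin

lemma lift_heights_in_region: "y \<in> B \<Longrightarrow> lift y (heights n) \<in> region"
  using heights[of n] \<sigma> by (intro lift_in_region) auto

text \<open>On the level \<open>heights 0\<close> the closed ball lifts to a compact subset of the
  exterior, where \<open>f\<close> is bounded by \<open>M\<close>. Any other level differs from it
  by two distances to the vertical limit, each at most 1 plus \<open>\<sigma>\<close> times the
  energy.\<close>

lemma dominated_along_fibres:
  fixes f :: "real^3 \<Rightarrow> 'b::euclidean_space"
  assumes f: "regular f"
  shows "\<exists>g. integrable (lebesgue_on B) g \<and> (\<forall>n. AE y in lebesgue_on B. norm (f (lift y (heights
      n))) \<le> g y)"
proof -
  have f': "Ck_on 1 exterior f" "H1_classical region f" using f by (auto simp only: regular_def)
  let ?G = "fibre_energy (dir_deriv vert f)"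
  have "continuous_on (cball 0 r') (\<lambda>y. f (lift y (heights 0)))"
  proof (rule continuous_on_compose2[OF Ck_on_imp_continuous_on[OF f'(1)]])
    show "continuous_on (cball 0 r') (\<lambda>y. lift y (heights 0))"
      by (rule continuous_on_subset[OF continuous_on_lift_left B_subset(2)])
    show "(\<lambda>y. lift y (heights 0)) ` cball 0 r' \<subseteq> exterior"
    proof
      fix x assume "x \<in> (\<lambda>y. lift y (heights 0)) ` cball 0 r'"
      then obtain y where y: "x = lift y (heights 0)" "y \<in> cball 0 r'" by blast
      have "lift y (heights 0) \<in> exterior"
        using y(2) h_less[OF y(2)] heights[of 0] \<sigma> r' by (intro lift_in_exterior) auto
      then show "x \<in> exterior" using y(1) by simp
    qed
  qed
  then have "bounded ((\<lambda>y. f (lift y (heights 0))) ` cball 0 r')"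
    by (intro compact_imp_bounded compact_continuous_image) auto
  then obtain M where M: "M > 0" "\<And>y. y \<in> cball 0 r' \<Longrightarrow> norm (f (lift y (heights 0))) \<le> M"
    by (auto simp: bounded_pos)
  define g where "g y = M + 2 * (1 + \<sigma> * enn2real (?G y))" for y
  have cf: "Ck_on 1 region f" using f'(2) by (simp only: H1_classical_def)
  have c: "continuous_on region (dir_deriv vert f)" by (rule continuous_on_dir_deriv[OF open_region cf])
  have mG: "?G \<in> borel_measurable (lebesgue_on B)" by (rule borel_measurable_fibre_energy[OF c])
  have "(\<integral>\<^sup>+y. ?G y \<partial>lebesgue_on B) < \<infinity>"
    using nn_integral_fibre_energy_le[OF c]
      L2_on_nn_integral_finite[OF H1_classical_L2_dir_deriv[OF open_region f'(2), of vert]] by simp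
  moreover have "ennreal (enn2real x) \<le> x" for x by (cases x) auto
  then have "(\<integral>\<^sup>+y. ennreal (enn2real (?G y)) \<partial>lebesgue_on B) \<le> (\<integral>\<^sup>+y. ?G y \<partial>lebesgue_on B)"
    by (intro nn_integral_mono)
  ultimately have "integrable (lebesgue_on B) (\<lambda>y. enn2real (?G y))"
    using mG by (intro integrableI_nonneg) auto
  moreover have "integrable (lebesgue_on B) (\<lambda>y. 1 :: real)"
  proof -
    interpret finite_measure "lebesgue_on B"
      by (rule finite_measure_lebesgue_on) auto
    show ?thesis by simp
  qed
  ultimately have "integrable (lebesgue_on B) (\<lambda>y. (M + 2) * 1 + (2 * \<sigma>) * enn2real (?G y))"
    by (intro Bochner_Integration.integrable_add integrable_mult_right)
  then have "integrable (lebesgue_on B) g" by (simp add: g_def[abs_def] algebra_simps)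
  moreover have "AE y in lebesgue_on B. norm (f (lift y (heights n))) \<le> g y" for n
    using AE_fibre_energy_finite[OF f'(2)] AE_space
  proof eventually_elim
    case (elim y)
    then obtain e where e: "?G y = ennreal e" "0 \<le> e" by (cases "?G y" rule: ennreal_cases) auto
    have y: "y \<in> B" using elim by simp
    have le: "norm (f (lift y (heights m)) - vertical_limit f y) \<le> 1 + \<sigma> * e" for m
    proof -
      have "(norm (f (lift y (heights m)) - vertical_limit f y))\<^sup>2 \<le> heights m * e"
        by (rule vertical_limit_dist[OF cf y e heights(1,2)])
      also have "\<dots> \<le> \<sigma> * e" using heights[of m] e by (intro mult_right_mono) auto
      finally have "(norm (f (lift y (heights m)) - vertical_limit f y))\<^sup>2 \<le> \<sigma> * e" .
      then show ?thesis by (rule le_1_add_if_power2_le)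
    qed
    have "norm (f (lift y (heights n))) \<le> norm (f (lift y (heights 0)))
        + norm (f (lift y (heights n)) - vertical_limit f y) + norm (f (lift y (heights 0)) -
            vertical_limit f y)"
      using norm_triangle_ineq[of "f (lift y (heights 0))" "f (lift y (heights n)) - f (lift y
          (heights 0))"]
        norm_triangle_ineq4[of "f (lift y (heights n)) - vertical_limit f y" "f (lift y (heights
            0)) - vertical_limit f y"]
      by simp
    also have "\<dots> \<le> M + (1 + \<sigma> * e) + (1 + \<sigma> * e)"
      using M(2)[of y] y by (intro add_mono le) auto
    also have "\<dots> = g y" using e by (simp add: g_def)
    finally show ?case .
  qed
  ultimately show ?thesis by blast
qed

text \<open>All levels are vertical translates of the graph, so the same vector is tangent at every
  height.\<close>

definition tangent :: "real^2 \<Rightarrow> real^2 \<Rightarrow> real^3" where "tangent y a = \<phi> (a, dir_deriv a h y)"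

lemma has_derivative_lift:
  assumes "y \<in> ball 0 r"
  shows "((\<lambda>y. lift y \<tau>) has_derivative tangent y) (at y)"
proof -
  have h: "(h has_derivative (\<lambda>a. dir_deriv a h y)) (at y)"
    by (rule Ck_on_1_has_derivative[OF open_ball C1_h assms])
  have "((\<lambda>y. (y, h y + \<tau>)) has_derivative (\<lambda>a. (a, dir_deriv a h y))) (at y)"
    by (rule has_derivative_Pair[OF has_derivative_ident has_derivative_add_const[OF h]])
  then have "((\<lambda>y. \<phi> (y, h y + \<tau>)) has_derivative (\<lambda>a. \<phi> (a, dir_deriv a h y))) (at y)"
    by (rule bounded_linear.has_derivative[OF linear_\<phi>[unfolded linear_conv_bounded_linear]])
  from has_derivative_add[OF has_derivative_const[of p] this] show ?thesis
    unfolding lift_def tangent_def[abs_def] by simp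
qed

lemma linear_tangent: "y \<in> ball 0 r \<Longrightarrow> linear (tangent y)"
  using has_derivative_lift has_derivative_linear by blast

lemma tangent_eq: "tangent y a = \<phi> (a, 0) + dir_deriv a h y *\<^sub>R vert"
proof -
  have "(a, dir_deriv a h y) = (a, 0) + dir_deriv a h y *\<^sub>R (0, 1)" by simp
  then show ?thesis unfolding tangent_def vert_def
    by (simp only: linear_add[OF linear_\<phi>] linear_cmul[OF linear_\<phi>])
qed

lemma continuous_on_tangent: "continuous_on (ball 0 r) (\<lambda>y. tangent y a)"
  unfolding tangent_eq by (intro continuous_intros continuous_on_dir_deriv[OF open_ball C1_h])

lemma has_derivative_along_lift:
  fixes f :: "real^3 \<Rightarrow> 'b::euclidean_space"
  assumes f: "Ck_on 1 region f" and y: "y \<in> B"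
  shows "((\<lambda>y. f (lift y (heights n))) has_derivative (\<lambda>a. dir_deriv (tangent y a) f (lift y
      (heights n)))) (at y)"
  by (rule has_derivative_compose[where g=f, OF has_derivative_lift
        Ck_on_1_has_derivative[OF open_region f lift_heights_in_region[OF y]]]) (use y r' in auto)

text \<open>On each level the product is C1 and the product rule applies. Its values tend to 0 by
  \<open>zero\<close> and its derivatives tend to the asserted expression, so
  \<open>limit_of_derivatives_eq_0\<close> applies. The bilinear map is left general: it is
  \<open>cdot\<close> with a tangent for the displacement, and scaling by the constant 1 for the
  divergence.\<close>

lemma tangential_derivative_eq_0:
  fixes f :: "real^3 \<Rightarrow> 'b::euclidean_space" and c :: "real^2 \<Rightarrow> 'c::euclidean_space"
    and \<beta> :: "'c \<Rightarrow> 'b \<Rightarrow> 'd::euclidean_space"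
  assumes \<beta>: "bounded_bilinear \<beta>" and c: "Ck_on 1 (ball 0 r) c"
    and f: "regular f" and df: "\<And>j. j \<in> Basis \<Longrightarrow> regular (dir_deriv j f)"
    and zero: "AE y in lebesgue_on B. \<beta> (c y) (vertical_limit f y) = 0"
  shows "AE y in lebesgue_on B. \<beta> (c y) (\<Sum>j\<in>Basis. (tangent y b \<bullet> j) *\<^sub>R vertical_limit (dir_deriv
      j f) y)
      + \<beta> (dir_deriv b c y) (vertical_limit f y) = 0"
proof -
  interpret \<beta>: bounded_bilinear \<beta> by (rule \<beta>)
  have f': "Ck_on 1 region f" "H1_classical region f"
    using f by (auto simp only: regular_def H1_classical_def)
  have df': "Ck_on 1 region (dir_deriv j f)" "H1_classical region (dir_deriv j f)" if "j \<in> Basis" for j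
    using df[OF that] by (auto simp only: regular_def H1_classical_def)
  have cB: "Ck_on 1 B c" by (rule Ck_on_subset[OF c B_subset(1)])
  have lift_c: "continuous_on B (\<lambda>y. u (lift y (heights n)))" if "continuous_on region u" for u ::
      "real^3 \<Rightarrow> 'b" and n
    by (rule continuous_on_compose2[OF that continuous_on_subset[OF continuous_on_lift_left
        B_subset(1)]])
      (use lift_heights_in_region in auto)
  have oB: "open B" by simp
  have D: "((\<lambda>y. \<beta> (c y) (f (lift y (heights n)))) has_derivative
      (\<lambda>a. \<beta> (c y) (\<Sum>j\<in>Basis. (tangent y a \<bullet> j) *\<^sub>R dir_deriv j f (lift y (heights n)))
        + \<beta> (dir_deriv a c y) (f (lift y (heights n))))) (at y)" if y: "y \<in> B" for y n
  proof -
    have "((\<lambda>y. \<beta> (c y) (f (lift y (heights n)))) has_derivative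
      (\<lambda>a. \<beta> (c y) (dir_deriv (tangent y a) f (lift y (heights n)))
        + \<beta> (dir_deriv a c y) (f (lift y (heights n))))) (at y)"
      by (rule \<beta>.FDERIV[OF Ck_on_1_has_derivative[OF oB cB y] has_derivative_along_lift[OF f'(1) y]])
    then show ?thesis
      by (subst (asm) dir_deriv_eq_sum_Basis[OF open_region f'(1) lift_heights_in_region[OF y]])
  qed
  have v_C1: "Ck_on 1 B (\<lambda>y. \<beta> (c y) (f (lift y (heights n))))" for n
    unfolding Ck_on_1_iff[OF oB]
  proof (intro exI conjI ballI)
    show "((\<lambda>y. \<beta> (c y) (f (lift y (heights n)))) has_derivative
      (\<lambda>a. \<beta> (c y) (\<Sum>j\<in>Basis. (tangent y a \<bullet> j) *\<^sub>R dir_deriv j f (lift y (heights n)))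
        + \<beta> (dir_deriv a c y) (f (lift y (heights n))))) (at y)" if "y \<in> B" for y
      by (rule D[OF that])
    show "continuous_on B (\<lambda>y. \<beta> (c y) (\<Sum>j\<in>Basis. (tangent y a \<bullet> j) *\<^sub>R dir_deriv j f (lift y
        (heights n)))
        + \<beta> (dir_deriv a c y) (f (lift y (heights n))))" for a
      by (intro continuous_on_add \<beta>.continuous_on continuous_on_sum continuous_on_scaleR
          continuous_on_inner
          Ck_on_imp_continuous_on[OF cB] continuous_on_dir_deriv[OF oB cB] lift_c
          continuous_on_dir_deriv[OF open_region f'(1)] Ck_on_imp_continuous_on[OF f'(1)]
          continuous_on_subset[OF continuous_on_tangent B_subset(1)] continuous_on_const)
  qed
  have v_lim: "AE y in lebesgue_on B. (\<lambda>n. \<beta> (c y) (f (lift y (heights n)))) \<longlonglongrightarrow> 0"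
    using AE_vertical_limit_tendsto[OF f'(2)] zero
  proof eventually_elim
    case (elim y)
    have "(\<lambda>n. \<beta> (c y) (f (lift y (heights n)))) \<longlonglongrightarrow> \<beta> (c y) (vertical_limit f y)"
      by (intro \<beta>.tendsto tendsto_const elim)
    then show ?case using elim by simp
  qed
  have AEj: "AE y in lebesgue_on B. \<forall>j\<in>Basis. (\<lambda>n. dir_deriv j f (lift y (heights n))) \<longlonglongrightarrow>
      vertical_limit (dir_deriv j f) y"
    by (rule AE_finite_allI) (auto intro: AE_vertical_limit_tendsto df')
  have w_lim: "AE y in lebesgue_on B. (\<lambda>n. dir_deriv b (\<lambda>y. \<beta> (c y) (f (lift y (heights n)))) y) \<longlonglongrightarrow>
      \<beta> (c y) (\<Sum>j\<in>Basis. (tangent y b \<bullet> j) *\<^sub>R vertical_limit (dir_deriv j f) y)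
      + \<beta> (dir_deriv b c y) (vertical_limit f y)"
    using AE_vertical_limit_tendsto[OF f'(2)] AEj AE_space
  proof eventually_elim
    case (elim y)
    then have y: "y \<in> B" by simp
    show ?case unfolding dir_deriv_eqI[OF D[OF y]]
      using elim by (intro tendsto_add \<beta>.tendsto tendsto_sum tendsto_scaleR tendsto_const) auto
  qed
  have m\<beta>: "(\<lambda>y. \<beta> (u y) (w y)) \<in> borel_measurable (lebesgue_on B)"
    if "u \<in> borel_measurable (lebesgue_on B)" "w \<in> borel_measurable (lebesgue_on B)" for u w
    by (rule borel_measurable_continuous_Pair[OF that])
      (intro \<beta>.continuous_on continuous_intros)
  have mt: "(\<lambda>y. tangent y b) \<in> borel_measurable (lebesgue_on B)"
    by (rule borel_measurable_lebesgue_on_continuous[OF oB continuous_on_subset[OF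
        continuous_on_tangent B_subset(1)]])
  have w_meas: "(\<lambda>y. \<beta> (c y) (\<Sum>j\<in>Basis. (tangent y b \<bullet> j) *\<^sub>R vertical_limit (dir_deriv j f) y)
      + \<beta> (dir_deriv b c y) (vertical_limit f y)) \<in> borel_measurable (lebesgue_on B)"
    by (intro borel_measurable_add m\<beta> borel_measurable_sum borel_measurable_scaleR
        borel_measurable_inner mt
        borel_measurable_const borel_measurable_vertical_limit
        borel_measurable_lebesgue_on_continuous[OF oB Ck_on_imp_continuous_on[OF cB]]
        borel_measurable_lebesgue_on_continuous[OF oB continuous_on_dir_deriv[OF oB cB]]
        Ck_on_imp_continuous_on[OF f'(1)] Ck_on_imp_continuous_on[OF df'(1)])
  have bd: "\<exists>C\<ge>0. \<forall>y\<in>B. norm (u y) \<le> C" if "continuous_on (ball 0 r) u" for u :: "real^2 \<Rightarrow>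
      'e::euclidean_space"
  proof -
    have "bounded (u ` cball 0 r')"
      by (intro compact_imp_bounded compact_continuous_image continuous_on_subset[OF that
          B_subset(2)]) auto
    then obtain C where "C > 0" "\<forall>y\<in>cball 0 r'. norm (u y) \<le> C" by (auto simp: bounded_pos)
    then show ?thesis using B_subset(3) by (intro exI[of _ C]) auto
  qed
  obtain Kc where Kc: "Kc \<ge> 0" "\<And>y. y \<in> B \<Longrightarrow> norm (c y) \<le> Kc"
    using bd[OF Ck_on_imp_continuous_on[OF c]] by blast
  obtain Kd where Kd: "Kd \<ge> 0" "\<And>y. y \<in> B \<Longrightarrow> norm (dir_deriv b c y) \<le> Kd"
    using bd[OF continuous_on_dir_deriv[OF open_ball c]] by blast
  obtain Kt where Kt: "Kt \<ge> 0" "\<And>y. y \<in> B \<Longrightarrow> norm (tangent y b) \<le> Kt"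
    using bd[OF continuous_on_tangent] by blast
  obtain K where K: "K > 0" "\<And>a u. norm (\<beta> a u) \<le> norm a * norm u * K"
    using \<beta>.pos_bounded by blast
  obtain g where g: "integrable (lebesgue_on B) g" "\<And>n. AE y in lebesgue_on B. norm (f (lift y
      (heights n))) \<le> g y"
    using dominated_along_fibres[OF f] by blast
  define Q where "Q j g \<longleftrightarrow> integrable (lebesgue_on B) g \<and> (\<forall>n. AE y in lebesgue_on B. norm
      (dir_deriv j f (lift y (heights n))) \<le> g y)"
    for j g
  have "\<forall>j\<in>Basis. \<exists>g. Q j g" unfolding Q_def using dominated_along_fibres[OF df] by blast
  then obtain gj where "\<forall>j\<in>Basis. Q j (gj j)" by metis
  then have gj: "integrable (lebesgue_on B) (gj j)"
    "AE y in lebesgue_on B. norm (dir_deriv j f (lift y (heights n))) \<le> gj j y" if "j \<in> Basis" for j n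
    using that unfolding Q_def by blast+
  have gjn: "AE y in lebesgue_on B. \<forall>j\<in>Basis. norm (dir_deriv j f (lift y (heights n))) \<le> gj j y" for n
    by (rule AE_finite_allI) (auto intro: gj)
  \<comment> \<open>One majorant for both sequences: the first term bounds the values, the other two
    bound the terms of the product rule.\<close>
  let ?H = "\<lambda>y. (Kc * g y * K + Kd * g y * K) + Kc * (\<Sum>j\<in>Basis. Kt * gj j y) * K"
  have H: "integrable (lebesgue_on B) ?H"
    using g(1) gj(1) by (intro Bochner_Integration.integrable_add integrable_mult_right
        integrable_mult_left
        Bochner_Integration.integrable_sum)
  have part1: "norm (\<beta> (c y) (f (lift y (heights n)))) \<le> Kc * g y * K"
    "norm (\<beta> (dir_deriv b c y) (f (lift y (heights n)))) \<le> Kd * g y * K"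
    if "y \<in> B" "norm (f (lift y (heights n))) \<le> g y" for y n
  proof -
    have "0 \<le> g y" using that(2) norm_ge_zero order_trans by blast
    then show "norm (\<beta> (c y) (f (lift y (heights n)))) \<le> Kc * g y * K"
      using Kc that K(1) by (intro order_trans[OF K(2)] mult_right_mono mult_mono) auto
    show "norm (\<beta> (dir_deriv b c y) (f (lift y (heights n)))) \<le> Kd * g y * K"
      using Kd that K(1) \<open>0 \<le> g y\<close> by (intro order_trans[OF K(2)] mult_right_mono mult_mono) auto
  qed
  have part2: "norm (\<beta> (c y) (\<Sum>j\<in>Basis. (tangent y b \<bullet> j) *\<^sub>R dir_deriv j f (lift y (heights n))))
      \<le> Kc * (\<Sum>j\<in>Basis. Kt * gj j y) * K"
    if y: "y \<in> B" and le: "\<forall>j\<in>Basis. norm (dir_deriv j f (lift y (heights n))) \<le> gj j y" for y n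
  proof -
    have "norm (\<Sum>j\<in>Basis. (tangent y b \<bullet> j) *\<^sub>R dir_deriv j f (lift y (heights n))) \<le> (\<Sum>j\<in>Basis. Kt
        * gj j y)"
    proof (rule sum_norm_le)
      fix j :: "real^3" assume j: "j \<in> Basis"
      have "\<bar>tangent y b \<bullet> j\<bar> \<le> Kt" using Basis_le_norm[OF j, of "tangent y b"] Kt(2)[OF y] by linarith
      then show "norm ((tangent y b \<bullet> j) *\<^sub>R dir_deriv j f (lift y (heights n))) \<le> Kt * gj j y"
        using le j Kt(1) by (auto intro!: mult_mono)
    qed
    then show ?thesis
      using Kc y K(1) by (intro order_trans[OF K(2)] mult_right_mono mult_mono) auto
  qed
  have v_le: "AE y in lebesgue_on B. norm (\<beta> (c y) (f (lift y (heights n)))) \<le> ?H y" for n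
    using g(2)[of n] gjn[of n] AE_space
  proof eventually_elim
    case (elim y)
    then have y: "y \<in> B" by simp
    have "0 \<le> Kd * g y * K" "0 \<le> Kc * (\<Sum>j\<in>Basis. Kt * gj j y) * K"
      using part1(2)[OF y elim(1)] part2[OF y elim(2)] norm_ge_zero order_trans by blast+
    then show ?case using part1(1)[OF y elim(1)] by linarith
  qed
  have w_le: "AE y in lebesgue_on B. norm (dir_deriv b (\<lambda>y. \<beta> (c y) (f (lift y (heights n)))) y) \<le>
      ?H y" for n
    using g(2)[of n] gjn[of n] AE_space
  proof eventually_elim
    case (elim y)
    then have y: "y \<in> B" by simp
    have "0 \<le> Kc * g y * K"
      using part1(1)[OF y elim(1)] norm_ge_zero order_trans by blast
    then show ?case unfolding dir_deriv_eqI[OF D[OF y]]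
      using part1(2)[OF y elim(1)] part2[OF y elim(2)] norm_triangle_mono by fastforce
  qed
  show ?thesis
    by (rule limit_of_derivatives_eq_0[OF oB v_C1 v_lim w_lim w_meas H v_le w_le])
qed

end

section \<open>Algebra of complexified real vectors\<close>

lemma bounded_linear_cvec: "bounded_linear cvec"
  unfolding linear_conv_bounded_linear[symmetric] cvec_def
  by (intro linearI) (auto simp: vec_eq_iff complex_eq_iff)

lemma bounded_bilinear_cdot: "bounded_bilinear cdot"
proof -
  have "bounded_bilinear (\<lambda>a b. \<Sum>i\<in>UNIV. a $ i * b $ i :: complex)"
    unfolding bilinear_conv_bounded_bilinear[symmetric] bilinear_def
    by (intro conjI allI linearI) (auto simp: sum.distrib distrib_left distrib_right scaleR_right.sum)
  then show ?thesis unfolding cdot_def[abs_def] .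
qed

lemma bounded_bilinear_cdot_cvec: "bounded_bilinear (\<lambda>t u. cdot (cvec t) u)"
  by (rule bounded_bilinear.comp1[OF bounded_bilinear_cdot bounded_linear_cvec])

text \<open>Turns the cross product conditions into conditions on tangential components, to which
  tangential differentiation applies with the tangents of the graph as coefficients.\<close>

lemma ccross_cvec_eq_0_iff:
  assumes n: "norm n = 1"
  shows "ccross (cvec n) u = 0 \<longleftrightarrow> (\<forall>t. n \<bullet> t = 0 \<longrightarrow> cdot (cvec t) u = 0)"
proof (intro iffI allI impI)
  fix t assume c: "ccross (cvec n) u = 0" and t: "n \<bullet> t = 0"
  \<comment> \<open>The Binet-Cauchy identity for the cross products of \<open>n\<close> with
    \<open>t\<close> and of \<open>n\<close> with \<open>u\<close>.\<close>
  have "cdot (cvec t) u * of_real (n \<bullet> n) = of_real (n \<bullet> t) * cdot (cvec n) u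
      + cdot (ccross (cvec n) (cvec t)) (ccross (cvec n) u)"
    by (simp add: cdot_def ccross_def cvec_def inner_vec_def sum_3 algebra_simps)
  then show "cdot (cvec t) u = 0"
    using c t n by (auto simp: norm_eq_1 bounded_bilinear.zero_right[OF bounded_bilinear_cdot])
next
  assume t: "\<forall>t. n \<bullet> t = 0 \<longrightarrow> cdot (cvec t) u = 0"
  \<comment> \<open>The products of \<open>u\<close> with these tangential vectors are, up to sign
    conventions of the listing, the three components of the cross product.\<close>
  have "n \<bullet> vector [0, - n$3, n$2] = 0" "n \<bullet> vector [n$3, 0, - n$1] = 0" "n \<bullet> vector [- n$2, n$1,
      0] = 0"
    by (simp_all add: inner_vec_def sum_3)
  then have "cdot (cvec (vector [0, - n$3, n$2])) u = 0" "cdot (cvec (vector [n$3, 0, - n$1])) u = 0"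
    "cdot (cvec (vector [- n$2, n$1, 0])) u = 0"
    using t by blast+
  then show "ccross (cvec n) u = 0"
    by (simp add: cdot_def ccross_def cvec_def vec_eq_iff forall_3 sum_3 algebra_simps)
qed

text \<open>The matrix \<open>E\<close> with the three vectors as rows is orthogonal, so its columns
  are orthonormal too; this is the identity \<open>\<delta>\<close>, which collapses the double sum
  to the diagonal.\<close>

lemma trace_eq_sum_orthonormal:
  fixes J :: "complex^3^3"
  assumes o: "norm e1 = 1" "norm e2 = 1" "norm n = 1" "e1 \<bullet> e2 = 0" "e1 \<bullet> n = 0" "e2 \<bullet> n = 0"
  shows "trace J = cdot (cvec e1) (J *v cvec e1) + cdot (cvec e2) (J *v cvec e2) + cdot (cvec n) (J
      *v cvec n)"
proof -
  define E :: "real^3^3" where "E = vector [e1, e2, n]"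
  have "E ** transpose E = mat 1"
    using o by (simp add: E_def matrix_matrix_mult_def transpose_def vec_eq_iff forall_3 mat_def
        inner_vec_def sum_3 norm_eq_1 mult.commute)
  then have "transpose E ** E = mat 1" by (rule matrix_left_right_inverse[THEN iffD1])
  then have \<delta>: "e1 $ i * e1 $ j + e2 $ i * e2 $ j + n $ i * n $ j = (if i = j then 1 else 0)" for i j
    by (auto simp: E_def matrix_matrix_mult_def transpose_def vec_eq_iff mat_def sum_3)
  have q: "cdot (cvec v) (J *v cvec v) = (\<Sum>i\<in>UNIV. \<Sum>j\<in>UNIV. of_real (v $ i * v $ j) * J $ i $ j)" for v
    by (simp add: cdot_def cvec_def matrix_vector_mult_def sum_distrib_left ac_simps)
  have "cdot (cvec e1) (J *v cvec e1) + cdot (cvec e2) (J *v cvec e2) + cdot (cvec n) (J *v cvec n)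
    = (\<Sum>i\<in>UNIV. \<Sum>j\<in>UNIV. of_real (e1 $ i * e1 $ j + e2 $ i * e2 $ j + n $ i * n $ j) * J $ i $ j)"
    unfolding q by (simp only: sum.distrib[symmetric] of_real_add distrib_right)
  also have "\<dots> = trace J"
    unfolding \<delta> trace_def by (simp add: if_distrib[of "\<lambda>x. of_real x * _"] cong: if_cong)
  finally show ?thesis ..
qed

text \<open>The curl term is orthogonal to \<open>n\<close>, so the normal traction sees only the
  normal derivative and the divergence.\<close>

lemma cdot_traction:
  assumes n: "norm n = 1"
  shows "cdot (cvec n) (traction lam \<mu> n J) = of_real (2 * \<mu>) * cdot (cvec n) (J *v cvec n) +
      of_real lam * trace J"
proof -
  interpret c: bounded_linear "cdot (cvec n)"
    by (rule bounded_bilinear.bounded_linear_right[OF bounded_bilinear_cdot])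
  have "cdot (cvec n) (ccross (cvec n) w) = 0" for w
    by (simp add: cdot_def ccross_def sum_3 algebra_simps)
  moreover have "cdot (cvec n) (z *s cvec n) = z" for z
  proof -
    have "cdot (cvec n) (z *s cvec n) = z * of_real (n \<bullet> n)"
      by (simp add: cdot_def cvec_def inner_vec_def sum_3 algebra_simps)
    then show ?thesis using n by (simp add: norm_eq_1)
  qed
  ultimately show ?thesis unfolding traction_def
    by (simp add: c.add c.scaleR scaleR_conv_of_real[where 'a=complex])
qed

section \<open>Minimal pieces of the boundary\<close>

lemma Ck1_on_imp_Ck_on: "Ck1_on k S f \<Longrightarrow> Ck_on k S f"
  by (induction k arbitrary: f) (auto intro: lipschitz_on_continuous_on)

context boundary_chart
begin

lemma lift_inj: "lift y \<tau> = lift z \<tau> \<Longrightarrow> y = z"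
  using inj_\<phi> unfolding lift_def by (auto dest: injD)

text \<open>\<open>outward_unit_normal\<close> expresses tangency by a quotient that tends to 0
  along the surface. On secants in the direction \<open>a\<close>, this quotient times the length of
  the scaled secant is the inner product of the scaled secant with \<open>n\<close>, which tends to
  that of the tangent.\<close>

lemma tangent_orthogonal_normal:
  assumes y: "y \<in> ball 0 r" and sub: "\<And>z. z \<in> ball 0 r \<Longrightarrow> lift z 0 \<in> S"
    and n: "((\<lambda>z. ((z - lift y 0) \<bullet> n) / norm (z - lift y 0)) \<longlongrightarrow> 0) (at (lift y 0) within S)"
  shows "n \<bullet> tangent y a = 0"
proof (cases "a = 0")
  case True
  then show ?thesis using linear_0[OF linear_tangent[OF y]] by simp
next
  case False
  obtain \<epsilon> where \<epsilon>: "\<epsilon> > 0" "ball y \<epsilon> \<subseteq> ball 0 r" using y open_ball open_contains_ball by blast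
  \<comment> \<open>Normalised by \<open>norm a\<close> so that every displacement
    \<open>t k *\<^sub>R a\<close> has length at most \<open>\<epsilon> / 2\<close>.\<close>
  define t where "t k = inverse (real (Suc k)) * (\<epsilon> / (2 * norm a))" for k
  have t: "0 < t k" "t k \<noteq> 0" for k using \<epsilon> False by (simp_all add: t_def)
  have t0: "t \<longlonglongrightarrow> 0"
    unfolding t_def using tendsto_mult_left_zero[OF LIMSEQ_inverse_real_of_nat] .
  have ta: "y + t k *\<^sub>R a \<in> ball 0 r" for k
  proof -
    have "inverse (real (Suc k)) * (\<epsilon> / 2) \<le> 1 * (\<epsilon> / 2)"
      using \<epsilon> by (intro mult_right_mono) (auto simp: field_simps)
    moreover have "norm (t k *\<^sub>R a) = inverse (real (Suc k)) * (\<epsilon> / 2)"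
      using False \<epsilon> by (simp add: t_def)
    ultimately have "norm (t k *\<^sub>R a) < \<epsilon>" using \<epsilon> by linarith
    then have "dist y (y + t k *\<^sub>R a) < \<epsilon>" by (simp add: dist_norm)
    then show ?thesis using \<epsilon>(2) by (meson mem_ball subsetD)
  qed
  define z where "z k = lift (y + t k *\<^sub>R a) 0" for k
  have zx: "z k \<noteq> lift y 0" for k
    using lift_inj[of "y + t k *\<^sub>R a" 0 y] t[of k] False by (auto simp: z_def)
  have q: "(\<lambda>k. (z k - lift y 0) /\<^sub>R t k) \<longlonglongrightarrow> tangent y a"
    unfolding z_def by (rule has_derivative_imp_difference_quotients[OF has_derivative_lift[OF y]
        t0 t(2)])
  have "(\<lambda>k. t k *\<^sub>R ((z k - lift y 0) /\<^sub>R t k)) \<longlonglongrightarrow> 0 *\<^sub>R tangent y a"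
    by (intro tendsto_scaleR t0 q)
  moreover have "t k *\<^sub>R ((z k - lift y 0) /\<^sub>R t k) = z k - lift y 0" for k using t[of k] by simp
  ultimately have "(\<lambda>k. z k - lift y 0) \<longlonglongrightarrow> 0" by simp
  then have "z \<longlonglongrightarrow> lift y 0" by (rule Lim_null[THEN iffD2])
  then have "filterlim z (at (lift y 0) within S) sequentially"
    unfolding filterlim_at using zx sub[OF ta] by (auto simp: z_def)
  from filterlim_compose[OF n this]
  have "(\<lambda>k. ((z k - lift y 0) \<bullet> n) / norm (z k - lift y 0) * norm ((z k - lift y 0) /\<^sub>R t k)) \<longlonglongrightarrow> 0
      * norm (tangent y a)"
    by (intro tendsto_mult tendsto_norm q)
  moreover have "((z k - lift y 0) \<bullet> n) / norm (z k - lift y 0) * norm ((z k - lift y 0) /\<^sub>R t k)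
      = ((z k - lift y 0) /\<^sub>R t k) \<bullet> n" for k
    using zx[of k] t[of k] by (simp add: divide_simps)
  ultimately have "(\<lambda>k. ((z k - lift y 0) /\<^sub>R t k) \<bullet> n) \<longlonglongrightarrow> 0" by simp
  moreover have "(\<lambda>k. ((z k - lift y 0) /\<^sub>R t k) \<bullet> n) \<longlonglongrightarrow> tangent y a \<bullet> n"
    by (intro tendsto_inner q tendsto_const)
  ultimately have "0 = tangent y a \<bullet> n" by (rule LIMSEQ_unique)
  then show ?thesis by (simp add: inner_commute)
qed

text \<open>The tangents and the vertical direction together span the space, so a vector orthogonal
  to all of them would be 0.\<close>

lemma normal_inner_vert:
  assumes n: "n \<noteq> 0" and T: "\<And>a. n \<bullet> tangent y a = 0"
  shows "n \<bullet> vert \<noteq> 0"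
proof
  assume v: "n \<bullet> vert = 0"
  obtain z where z: "n = \<phi> z" using surj_\<phi> by (metis surjD)
  have "z = (fst z, 0) + snd z *\<^sub>R (0, 1)" by simp
  then have "\<phi> z = \<phi> ((fst z, 0) + snd z *\<^sub>R (0, 1))" by (rule arg_cong)
  also have "\<dots> = \<phi> (fst z, 0) + snd z *\<^sub>R vert" unfolding vert_def
    by (simp only: linear_add[OF linear_\<phi>] linear_cmul[OF linear_\<phi>])
  finally have "\<phi> z = \<phi> (fst z, 0) + snd z *\<^sub>R vert" .
  then have "n = tangent y (fst z) + (snd z - dir_deriv (fst z) h y) *\<^sub>R vert"
    using z by (simp add: tangent_eq algebra_simps)
  then have "n \<bullet> n = n \<bullet> tangent y (fst z) + (snd z - dir_deriv (fst z) h y) * (n \<bullet> vert)"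
    using inner_add_right[of n "tangent y (fst z)" "(snd z - dir_deriv (fst z) h y) *\<^sub>R vert"] by simp
  then have "n \<bullet> n = 0" using T[of "fst z"] v by simp
  then show False using n by simp
qed

text \<open>The same splitting into a tangent and a multiple of \<open>vert\<close>; orthogonality
  to \<open>n\<close> removes the vertical coefficient because
  \<open>n \<bullet> vert \<noteq> 0\<close>. It expresses principal directions by parameter
  directions.\<close>

lemma orthogonal_normal_tangent:
  assumes n: "n \<noteq> 0" and T: "\<And>a. n \<bullet> tangent y a = 0" and t: "n \<bullet> t = 0"
  obtains a where "t = tangent y a"
proof -
  obtain z where z: "t = \<phi> z" using surj_\<phi> by (metis surjD)
  have "z = (fst z, 0) + snd z *\<^sub>R (0, 1)" by simp
  then have "\<phi> z = \<phi> ((fst z, 0) + snd z *\<^sub>R (0, 1))" by (rule arg_cong)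
  also have "\<dots> = \<phi> (fst z, 0) + snd z *\<^sub>R vert" unfolding vert_def
    by (simp only: linear_add[OF linear_\<phi>] linear_cmul[OF linear_\<phi>])
  finally have "\<phi> z = \<phi> (fst z, 0) + snd z *\<^sub>R vert" .
  then have eq: "t = tangent y (fst z) + (snd z - dir_deriv (fst z) h y) *\<^sub>R vert"
    using z by (simp add: tangent_eq algebra_simps)
  then have "n \<bullet> t = (snd z - dir_deriv (fst z) h y) * (n \<bullet> vert)"
    using T[of "fst z"] by (simp add: inner_add_right)
  then have "snd z - dir_deriv (fst z) h y = 0"
    using t normal_inner_vert[OF n T] by simp
  then show ?thesis using eq that by simp
qed

lemma AE_vertical_limit_linear:
  fixes f :: "real^3 \<Rightarrow> 'b::euclidean_space" and L :: "'b \<Rightarrow> 'c::euclidean_space"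
  assumes L: "bounded_linear L" and f: "regular f"
  shows "AE y in lebesgue_on B. vertical_limit (\<lambda>x. L (f x)) y = L (vertical_limit f y)"
proof -
  have "H1_classical region f" "H1_classical region (\<lambda>x. L (f x))"
    using f regular_linear_comp[OF L f] by (auto simp only: regular_def)
  from this[THEN AE_vertical_limit_tendsto] show ?thesis
  proof eventually_elim
    case (elim y)
    show ?case by (rule LIMSEQ_unique[OF elim(2) bounded_linear.tendsto[OF L elim(1)]])
  qed
qed

lemma AE_vertical_limit_Pair:
  fixes f :: "real^3 \<Rightarrow> 'b::euclidean_space" and g :: "real^3 \<Rightarrow> 'c::euclidean_space"
  assumes f: "regular f" and g: "regular g"
  shows "AE y in lebesgue_on B. vertical_limit (\<lambda>x. (f x, g x)) y = (vertical_limit f y,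
      vertical_limit g y)"
proof -
  have "H1_classical region f" "H1_classical region g" "H1_classical region (\<lambda>x. (f x, g x))"
    using f g regular_Pair[OF f g] by (auto simp only: regular_def)
  from this[THEN AE_vertical_limit_tendsto] show ?thesis
  proof eventually_elim
    case (elim y)
    show ?case by (rule LIMSEQ_unique[OF elim(3) tendsto_Pair[OF elim(1,2)]])
  qed
qed

text \<open>The quantifier over \<open>t\<close> stands inside the almost everywhere statement: the
  tangents inserted later vary with \<open>y\<close>, so one null set must serve for all
  vectors.\<close>

lemma AE_vertical_limit_jacobian:
  assumes U: "\<And>i. regular (pd i U)"
  shows "AE y in lebesgue_on B. \<forall>t. vertical_limit (jacobian U) y *v cvec t
    = (\<Sum>j\<in>Basis. (t \<bullet> j) *\<^sub>R vertical_limit (dir_deriv j U) y)"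
proof -
  have "AE y in lebesgue_on B. \<forall>i\<in>UNIV. (\<lambda>n. pd i U (lift y (heights n))) \<longlonglongrightarrow> vertical_limit (pd i U) y"
    by (rule AE_finite_allI[OF finite], rule AE_vertical_limit_tendsto) (use U in \<open>simp only:
        regular_def\<close>)
  moreover have "AE y in lebesgue_on B. (\<lambda>n. jacobian U (lift y (heights n))) \<longlonglongrightarrow> vertical_limit
      (jacobian U) y"
    using regular_jacobian[OF U] by (intro AE_vertical_limit_tendsto) (simp only: regular_def)
  ultimately show ?thesis
  proof eventually_elim
    case (elim y)
    have "(\<lambda>n. jacobian U (lift y (heights n))) \<longlonglongrightarrow> (\<Sum>i\<in>UNIV. column_matrix i (vertical_limit (pd i
        U) y))"
      unfolding jacobian_eq_sum using elim(1)
      by (intro tendsto_sum bounded_linear.tendsto[OF bounded_linear_column_matrix]) auto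
    then have J: "vertical_limit (jacobian U) y = (\<Sum>i\<in>UNIV. column_matrix i (vertical_limit (pd i
        U) y))"
      using LIMSEQ_unique[OF elim(2)] by blast
    show ?case
    proof
      fix t
      have "(\<Sum>i\<in>UNIV. column_matrix i (w i)) *v cvec t = (t $ 1) *\<^sub>R w 1 + (t $ 2) *\<^sub>R w 2 + (t $
          3) *\<^sub>R w 3" for w
        by (simp add: vec_eq_iff forall_3 matrix_vector_mult_def sum_3 column_matrix_def cvec_def
            scaleR_conv_of_real[where 'a=complex] algebra_simps)
      then show "vertical_limit (jacobian U) y *v cvec t = (\<Sum>j\<in>Basis. (t \<bullet> j) *\<^sub>R vertical_limit
          (dir_deriv j U) y)"
        unfolding J by (simp add: Basis_3 axis_eq_axis inner_axis pd_def add.assoc)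
    qed
  qed
qed

end

locale minimal_boundary_chart = boundary_chart +
  fixes \<Gamma> :: "(real^3) set" and \<nu> :: "real^3 \<Rightarrow> real^3"
  assumes C2_h: "Ck_on 2 (ball 0 r) h" and graph: "graph_point p \<phi> h ` ball 0 r \<subseteq> \<Gamma>"
    and frontier: "\<Gamma> \<subseteq> frontier D"
    and normal: "\<And>x. x \<in> \<Gamma> \<Longrightarrow> outward_unit_normal D x (\<nu> x)"
    and mean_curvature: "\<And>x. x \<in> \<Gamma> \<Longrightarrow> has_mean_curvature \<Gamma> \<nu> x 0"
begin

lemma lift_0_in: "y \<in> ball 0 r \<Longrightarrow> lift y 0 \<in> \<Gamma>"
  using graph lift_0 by auto

lemma norm_normal: "y \<in> ball 0 r \<Longrightarrow> norm (\<nu> (lift y 0)) = 1"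
  using normal[OF lift_0_in] by (simp add: outward_unit_normal_def)

lemma normal_tangent: "y \<in> ball 0 r \<Longrightarrow> \<nu> (lift y 0) \<bullet> tangent y a = 0"
  using normal[OF lift_0_in, of y] lift_0_in frontier
  by (intro tangent_orthogonal_normal[where S="frontier D"]) (auto simp: outward_unit_normal_def)

text \<open>The horizontal part of \<open>tangent y a\<close> is constant; only the slope varies, so
  the derivative is vertical.\<close>

lemma has_derivative_tangent:
  assumes "a \<in> Basis" "y \<in> ball 0 r"
  shows "((\<lambda>y. tangent y a) has_derivative (\<lambda>b. dir_deriv b (dir_deriv a h) y *\<^sub>R vert)) (at y)"
proof -
  have "Ck_on 1 (ball 0 r) (dir_deriv a h)" using C2_h assms by (simp add: numeral_2_eq_2)
  from Ck_on_1_has_derivative[OF open_ball this assms(2)] show ?thesis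
    unfolding tangent_eq by (auto intro!: derivative_eq_intros)
qed

lemma Ck_on_tangent:
  assumes "a \<in> Basis"
  shows "Ck_on 1 (ball 0 r) (\<lambda>y. tangent y a)"
  unfolding Ck_on_1_iff[OF open_ball]
proof (intro exI conjI ballI)
  have "Ck_on 1 (ball 0 r) (dir_deriv a h)" using C2_h assms by (simp add: numeral_2_eq_2)
  then show "continuous_on (ball 0 r) (\<lambda>y. dir_deriv b (dir_deriv a h) y *\<^sub>R vert)" for b
    by (intro continuous_on_scaleR continuous_on_dir_deriv[OF open_ball] continuous_on_const)
qed (rule has_derivative_tangent[OF assms])

text \<open>Differentiates the orthogonality of \<open>\<nu>\<close> and the tangent along the
  graph. The derivative of \<open>\<nu>\<close> is known only within \<open>\<Gamma>\<close>;
  composition with the graph parametrisation, whose image lies in \<open>\<Gamma>\<close>, makes it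
  a full derivative in \<open>y\<close>.\<close>

lemma shape_operator:
  assumes y: "y \<in> ball 0 r" and a: "a \<in> Basis" and L: "(\<nu> has_derivative L) (at (lift y 0) within \<Gamma>)"
  shows "L (tangent y b) \<bullet> tangent y a = - dir_deriv b (dir_deriv a h) y * (\<nu> (lift y 0) \<bullet> vert)"
proof -
  have A: "((\<lambda>z. lift z 0) has_derivative tangent y) (at y within ball 0 r)"
    by (rule has_derivative_at_withinI[OF has_derivative_lift[OF y]])
  have B: "(\<nu> has_derivative L) (at (lift y 0) within (\<lambda>z. lift z 0) ` ball 0 r)"
    by (rule has_derivative_subset[OF L]) (use lift_0_in in auto)
  have "((\<lambda>z. \<nu> (lift z 0)) has_derivative (\<lambda>b. L (tangent y b))) (at y within ball 0 r)"
    by (rule has_derivative_in_compose[of "\<lambda>z. lift z 0" "tangent y" y "ball 0 r" \<nu> L, OF A B])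
  then have C: "((\<lambda>z. \<nu> (lift z 0)) has_derivative (\<lambda>b. L (tangent y b))) (at y)"
    by (simp only: at_within_open[OF y open_ball])
  have D: "((\<lambda>z. \<nu> (lift z 0) \<bullet> tangent z a) has_derivative
    (\<lambda>b. \<nu> (lift y 0) \<bullet> (dir_deriv b (dir_deriv a h) y *\<^sub>R vert) + L (tangent y b) \<bullet> tangent y a))
        (at y)"
    by (rule has_derivative_inner[OF C has_derivative_tangent[OF a y]])
  have "((\<lambda>z. 0) has_derivative
    (\<lambda>b. \<nu> (lift y 0) \<bullet> (dir_deriv b (dir_deriv a h) y *\<^sub>R vert) + L (tangent y b) \<bullet> tangent y a))
        (at y)"
    by (rule has_derivative_transform_within_open[OF D open_ball y]) (rule normal_tangent)
  from has_derivative_unique[OF this has_derivative_const]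
  have "\<nu> (lift y 0) \<bullet> (dir_deriv b (dir_deriv a h) y *\<^sub>R vert) + L (tangent y b) \<bullet> tangent y a = 0"
    by (rule fun_cong)
  then show ?thesis by simp
qed

text \<open>The tangential components of \<open>J\<close> are proportional to the shape operator, because both have
  the second derivatives of \<open>h\<close> as matrix.  A vanishing mean curvature therefore cancels their trace.\<close>

lemma trace_eq_normal_component:
  assumes y: "y \<in> ball 0 r"
    and J: "\<And>a b. a \<in> Basis \<Longrightarrow> b \<in> Basis \<Longrightarrow>
      cdot (cvec (tangent y a)) (J *v cvec (tangent y b))
      + cdot (cvec (dir_deriv b (dir_deriv a h) y *\<^sub>R vert)) u = 0"
  shows "trace J = cdot (cvec (\<nu> (lift y 0))) (J *v cvec (\<nu> (lift y 0)))"
proof -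
  let ?n = "\<nu> (lift y 0)"
  obtain \<kappa>1 \<kappa>2 where pc: "principal_curvatures \<Gamma> \<nu> (lift y 0) \<kappa>1 \<kappa>2" and "\<kappa>1 + \<kappa>2 = 0"
    using mean_curvature[OF lift_0_in[OF y]] unfolding has_mean_curvature_def by auto
  then obtain L e1 e2 where L: "(\<nu> has_derivative L) (at (lift y 0) within \<Gamma>)"
    and e: "norm e1 = 1" "norm e2 = 1" "e1 \<bullet> e2 = 0" "e1 \<bullet> ?n = 0" "e2 \<bullet> ?n = 0"
    and Le: "L e1 = \<kappa>1 *\<^sub>R e1" "L e2 = \<kappa>2 *\<^sub>R e2"
    unfolding principal_curvatures_def by blast
  have n: "norm ?n = 1" by (rule norm_normal[OF y])
  then have n0: "?n \<noteq> 0" by auto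
  interpret L: bounded_linear L by (rule has_derivative_bounded_linear[OF L])
  interpret T: linear "tangent y" by (rule linear_tangent[OF y])
  interpret cv: bounded_linear cvec by (rule bounded_linear_cvec)
  interpret cd: bounded_bilinear cdot by (rule bounded_bilinear_cdot)
  define q where "q v w = cdot (cvec v) (J *v cvec w)" for v w
  have Jlin: "bounded_linear (\<lambda>w. J *v cvec w)"
    unfolding linear_conv_bounded_linear[symmetric]
    by (intro linearI) (simp_all add: vec_eq_iff matrix_vector_mult_def cvec_def sum.distrib
        sum_distrib_left scaleR_conv_of_real[where 'a=complex] algebra_simps)
  have "bounded_bilinear q"
    unfolding q_def[abs_def] by (rule cd.comp[OF bounded_linear_cvec Jlin])
  then interpret q: bounded_bilinear q .
  have basis: "of_real (?n \<bullet> vert) * q (tangent y a) (tangent y b)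
      = cdot (cvec vert) u * of_real (L (tangent y b) \<bullet> tangent y a)" if "a \<in> Basis" "b \<in> Basis" for a b
  proof -
    have "q (tangent y a) (tangent y b) = - of_real (dir_deriv b (dir_deriv a h) y) * cdot (cvec
        vert) u"
      using J[OF that] by (simp add: q_def cv.scaleR cd.scaleR_left scaleR_conv_of_real[where
          'a=complex] add_eq_0_iff)
    then show ?thesis using shape_operator[OF y that(1) L, of b] by simp
  qed
  \<comment> \<open>Principal directions are in general not images of basis vectors of the parameter
    plane, so the proportionality is extended bilinearly to all tangents.\<close>
  have all: "of_real (?n \<bullet> vert) * q (tangent y a) (tangent y b)
      = cdot (cvec vert) u * of_real (L (tangent y b) \<bullet> tangent y a)" for a b
  proof -
    have a: "tangent y a = (\<Sum>i\<in>Basis. (a \<bullet> i) *\<^sub>R tangent y i)" for a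
      by (subst euclidean_representation[of a, symmetric]) (simp only: T.sum T.scale)
    have "of_real (?n \<bullet> vert) * q (tangent y a) (tangent y b)
      = (\<Sum>i\<in>Basis. \<Sum>j\<in>Basis. of_real ((a \<bullet> i) * (b \<bullet> j)) * (of_real (?n \<bullet> vert) * q (tangent y i)
          (tangent y j)))"
      by (subst a[of a], subst a[of b])
        (simp add: q.sum_left q.sum_right q.scaleR_left q.scaleR_right sum_distrib_left
          scaleR_conv_of_real[where 'a=complex] ac_simps, rule sum.swap)
    also have "\<dots> = (\<Sum>i\<in>Basis. \<Sum>j\<in>Basis. of_real ((a \<bullet> i) * (b \<bullet> j)) *
        (cdot (cvec vert) u * of_real (L (tangent y j) \<bullet> tangent y i)))"
      by (intro sum.cong refl) (simp only: basis)
    also have "\<dots> = cdot (cvec vert) u * of_real (L (tangent y b) \<bullet> tangent y a)"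
      by (subst a[of a], subst a[of b])
        (simp add: L.sum L.scaleR inner_sum_left inner_sum_right sum_distrib_left ac_simps)
    finally show ?thesis .
  qed
  obtain a1 where a1: "e1 = tangent y a1"
    using orthogonal_normal_tangent[OF n0 normal_tangent[OF y]] e(4) by (metis inner_commute)
  obtain a2 where a2: "e2 = tangent y a2"
    using orthogonal_normal_tangent[OF n0 normal_tangent[OF y]] e(5) by (metis inner_commute)
  have "of_real (?n \<bullet> vert) * (q e1 e1 + q e2 e2) = cdot (cvec vert) u * of_real (L e1 \<bullet> e1 + L e2
      \<bullet> e2)"
    using all[of a1 a1] all[of a2 a2] unfolding a1[symmetric] a2[symmetric] by (simp add: distrib_left)
  also have "L e1 \<bullet> e1 + L e2 \<bullet> e2 = 0"
    using e \<open>\<kappa>1 + \<kappa>2 = 0\<close> by (simp add: Le norm_eq_1)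
  finally have "q e1 e1 + q e2 e2 = 0"
    using normal_inner_vert[OF n0 normal_tangent[OF y]] by simp
  then show ?thesis
    using trace_eq_sum_orthonormal[OF e(1,2) n e(3-5), of J] by (simp add: q_def)
qed

text \<open>Provides the hypothesis \<open>J\<close> of the pointwise statement at almost every
  \<open>y\<close>: tangential differentiation excludes a null set for each pair of basis
  directions, and there are only finitely many pairs.\<close>

lemma AE_trace_eq_normal_component:
  assumes U: "regular U" "\<And>i. regular (pd i U)"
    and zero: "AE y in lebesgue_on B. ccross (cvec (\<nu> (graph_point p \<phi> h y))) (vertical_limit U y) = 0"
  shows "AE y in lebesgue_on B. trace (vertical_limit (jacobian U) y)
    = cdot (cvec (\<nu> (graph_point p \<phi> h y))) (vertical_limit (jacobian U) y *v cvec (\<nu> (graph_point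
        p \<phi> h y)))"
proof -
  have dU: "regular (dir_deriv j U)" if "j \<in> Basis" for j
    using that U(2)[of 1] U(2)[of 2] U(2)[of 3] by (auto simp: Basis_3 pd_def)
  have T0: "AE y in lebesgue_on B. cdot (cvec (tangent y a)) (vertical_limit U y) = 0" if "a \<in>
      Basis" for a
    using zero AE_space
  proof eventually_elim
    case (elim y)
    then have y: "y \<in> ball 0 r" using B_subset by auto
    show ?case using elim(1) normal_tangent[OF y] unfolding lift_0[symmetric]
        ccross_cvec_eq_0_iff[OF norm_normal[OF y]] by blast
  qed
  have "AE y in lebesgue_on B. cdot (cvec (tangent y a)) (\<Sum>j\<in>Basis. (tangent y b \<bullet> j) *\<^sub>R
      vertical_limit (dir_deriv j U) y)
      + cdot (cvec (dir_deriv b (\<lambda>y. tangent y a) y)) (vertical_limit U y) = 0" if "a \<in> Basis" for a b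
    by (rule tangential_derivative_eq_0[OF bounded_bilinear_cdot_cvec Ck_on_tangent[OF that] U(1)
        dU T0[OF that]])
  then have "AE y in lebesgue_on B. \<forall>a\<in>Basis. \<forall>b\<in>Basis. cdot (cvec (tangent y a)) (\<Sum>j\<in>Basis.
      (tangent y b \<bullet> j) *\<^sub>R vertical_limit (dir_deriv j U) y)
      + cdot (cvec (dir_deriv b (\<lambda>y. tangent y a) y)) (vertical_limit U y) = 0"
    by (intro AE_finite_allI finite_Basis)
  then show ?thesis
    using AE_vertical_limit_jacobian[OF U(2)] AE_space
  proof eventually_elim
    case (elim y)
    then have y: "y \<in> ball 0 r" using B_subset by auto
    show ?case unfolding lift_0[symmetric]
    proof (rule trace_eq_normal_component[OF y])
      fix a b :: "real^2" assume ab: "a \<in> Basis" "b \<in> Basis"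
      show "cdot (cvec (tangent y a)) (vertical_limit (jacobian U) y *v cvec (tangent y b))
        + cdot (cvec (dir_deriv b (dir_deriv a h) y *\<^sub>R vert)) (vertical_limit U y) = 0"
        using elim(1)[rule_format, OF ab] unfolding elim(2)[rule_format] dir_deriv_eqI[OF
            has_derivative_tangent[OF ab(1) y]] .
    qed
  qed
qed

definition gradient_limit :: "(real^3 \<Rightarrow> complex) \<Rightarrow> real^2 \<Rightarrow> complex^3" where
  "gradient_limit f y = (\<chi> i. vertical_limit (pd i f) y)"

text \<open>A vanishing trace has vanishing derivatives along the surface, and the tangents of the
  two basis directions span the plane orthogonal to \<open>\<nu>\<close>.\<close>

lemma AE_gradient_limit_tangential:
  assumes f: "regular f" "\<And>i. regular (pd i f)"
    and zero: "AE y in lebesgue_on B. vertical_limit f y = 0"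
  shows "AE y in lebesgue_on B. ccross (cvec (\<nu> (graph_point p \<phi> h y))) (gradient_limit f y) = 0"
proof -
  have df: "regular (dir_deriv j f)" if "j \<in> Basis" for j
    using that f(2)[of 1] f(2)[of 2] f(2)[of 3] by (auto simp: Basis_3 pd_def)
  \<comment> \<open>With the constant coefficient 1 the second term of the product rule drops
    out.\<close>
  have c: "Ck_on 1 (ball 0 r) (\<lambda>y. 1 :: real)"
    unfolding Ck_on_1_iff[OF open_ball] by (intro exI[of _ "\<lambda>x b. 0"]) auto
  have d1: "dir_deriv b (\<lambda>y. 1 :: real) y = 0" for b y :: "real^2"
    by (rule dir_deriv_eqI) simp
  have "AE y in lebesgue_on B. 1 *\<^sub>R (\<Sum>j\<in>Basis. (tangent y b \<bullet> j) *\<^sub>R vertical_limit (dir_deriv j f) y)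
      + dir_deriv b (\<lambda>y. 1 :: real) y *\<^sub>R vertical_limit f y = 0" for b
    by (rule tangential_derivative_eq_0[OF bounded_bilinear_scaleR c f(1) df]) (use zero in auto)
  then have "AE y in lebesgue_on B. \<forall>b\<in>Basis. (\<Sum>j\<in>Basis. (tangent y b \<bullet> j) *\<^sub>R vertical_limit
      (dir_deriv j f) y) = 0"
    by (intro AE_finite_allI finite_Basis) (simp add: d1)
  then show ?thesis using AE_space
  proof eventually_elim
    case (elim y)
    then have y: "y \<in> ball 0 r" using B_subset by auto
    have n0: "\<nu> (lift y 0) \<noteq> 0" using norm_normal[OF y] by auto
    interpret T: linear "tangent y" by (rule linear_tangent[OF y])
    interpret c: bounded_bilinear "\<lambda>t u. cdot (cvec t) u" by (rule bounded_bilinear_cdot_cvec)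
    have g: "cdot (cvec t) (gradient_limit f y) = (\<Sum>j\<in>Basis. (t \<bullet> j) *\<^sub>R vertical_limit (dir_deriv
        j f) y)" for t
      by (simp add: Basis_3 axis_eq_axis inner_axis gradient_limit_def cdot_def cvec_def sum_3 pd_def
          scaleR_conv_of_real[where 'a=complex])
    show ?case unfolding lift_0[symmetric] ccross_cvec_eq_0_iff[OF norm_normal[OF y]]
    proof (intro allI impI)
      fix t assume t: "\<nu> (lift y 0) \<bullet> t = 0"
      obtain a where "t = tangent y a"
        by (rule orthogonal_normal_tangent[OF n0 normal_tangent[OF y] t])
      also have "\<dots> = (\<Sum>i\<in>Basis. (a \<bullet> i) *\<^sub>R tangent y i)"
        by (subst euclidean_representation[of a, symmetric]) (simp only: T.sum T.scale)
      finally have "cdot (cvec t) (gradient_limit f y) = (\<Sum>i\<in>Basis. (a \<bullet> i) *\<^sub>R cdot (cvec (tangent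
          y i)) (gradient_limit f y))"
        by (simp only: c.sum_left c.scaleR_left)
      also have "\<dots> = 0" using elim(1) by (simp add: g)
      finally show "cdot (cvec t) (gradient_limit f y) = 0" .
    qed
  qed
qed

end

section \<open>From vertical limits to traces and the conclusion\<close>

lemma Ck1_on_subset: "Ck1_on k S f \<Longrightarrow> T \<subseteq> S \<Longrightarrow> Ck1_on k T f"
proof (induction k arbitrary: f)
  case 0
  then obtain L where "L-lipschitz_on S f" by auto
  then have "L-lipschitz_on T f" using 0(2) by (rule lipschitz_on_subset)
  then show ?case by auto
next
  case (Suc k)
  then show ?case using differentiable_on_subset by auto
qed

context boundary_chart
begin

text \<open>Counting derivatives: with third derivatives square integrable, the second derivatives
  of \<open>U\<close> are still H1 above the graph, as the traces of \<open>curl (curl U)\<close>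
  and of the gradient of the divergence require.\<close>

lemma regular_derivatives:
  fixes U :: "real^3 \<Rightarrow> complex^3"
  assumes U: "Ck_on 3 exterior U" and H3: "Hk_on 3 (ball p \<rho> - closure D) U" and sub: "region \<subseteq>
      ball p \<rho>"
  shows "regular U" "regular (pd i U)" "regular (pd j (pd i U))"
proof -
  let ?S = "ball p \<rho> - closure D"
  have S: "open ?S" by (intro open_Diff) auto
  have RS: "region \<subseteq> ?S" using sub region_subset(1) by blast
  have CS: "Ck_on 3 ?S U" by (rule Ck_on_subset[OF U]) auto
  have d3: "derivs_L2 3 ?S U" by (rule Hk_on_imp_derivs_L2[OF S CS _ H3]) simp
  have regI: "regular f" if "Ck_on (Suc k) exterior f" "derivs_L2 (Suc k) ?S f"
    for k and f :: "real^3 \<Rightarrow> complex^3"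
  proof -
    have "H1_classical ?S f"
      by (rule derivs_L2_imp_H1_classical[OF Ck_on_subset[OF that(1)] that(2)]) auto
    then have "H1_classical region f" by (rule H1_classical_subset[OF _ RS S open_region])
    moreover have "Ck_on 1 exterior f" by (rule Ck_on_mono[OF that(1)]) simp
    ultimately show ?thesis by (simp only: regular_def)
  qed
  have b: "axis i 1 \<in> (Basis :: (real^3) set)" "axis j 1 \<in> (Basis :: (real^3) set)" by simp_all
  have "Ck_on (Suc (Suc (Suc 0))) exterior U" "derivs_L2 (Suc (Suc (Suc 0))) ?S U"
    using U d3 by (simp_all only: numeral_3_eq_3)
  then show "regular U" by (rule regI)
  have "Ck_on (Suc (Suc 0)) exterior (pd i U)" "derivs_L2 (Suc (Suc 0)) ?S (pd i U)"
    using \<open>Ck_on (Suc (Suc (Suc 0))) exterior U\<close> \<open>derivs_L2 (Suc (Suc (Suc 0))) ?S U\<close> b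
    unfolding pd_def Ck_on.simps(2)[of "Suc (Suc 0)"] derivs_L2.simps(2)[of "Suc (Suc 0)"] by blast+
  then show "regular (pd i U)" by (rule regI)
  have "Ck_on (Suc 0) exterior (pd j (pd i U))" "derivs_L2 (Suc 0) ?S (pd j (pd i U))"
    using \<open>Ck_on (Suc (Suc 0)) exterior (pd i U)\<close> \<open>derivs_L2 (Suc (Suc 0)) ?S (pd i U)\<close> b
    unfolding pd_def[of j] Ck_on.simps(2)[of "Suc 0"] derivs_L2.simps(2)[of "Suc 0"] by blast+
  then show "regular (pd j (pd i U))" by (rule regI)
qed

end

lemma ccross_add: "ccross a (b + c) = ccross a b + ccross a c"
  by (simp add: ccross_def vec_eq_iff forall_3 algebra_simps)

lemma ccross_scaleR: "ccross a (k *\<^sub>R b) = k *\<^sub>R ccross a b"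
  by (simp add: ccross_def vec_eq_iff forall_3 scaleR_right_diff_distrib)

context minimal_boundary_chart
begin

text \<open>Both directions use the same relations in a different order: the normal traction is a
  multiple of \<open>\<delta>\<close> once the tangential part of \<open>u\<close> vanishes, and the
  gradient leaves the tangential part of the equation once \<open>\<delta>\<close> vanishes.\<close>

lemma vertical_limit_equivalence:
  assumes const: "\<mu> > 0" "lam + 2 * \<mu> > 0" "\<omega> > 0"
    and C2: "Ck_on 2 exterior U"
    and U: "regular U" "\<And>i. regular (pd i U)" "\<And>i j. regular (pd j (pd i U))"
    and pde: "\<And>x. x \<in> exterior \<Longrightarrow> lame_operator lam \<mu> U x + (\<omega>\<^sup>2) *\<^sub>R U x = 0"
  shows "(AE y in lebesgue_on B. (\<lambda>x (u, J). ccross (cvec (\<nu> x)) u = 0 \<and> cdot (cvec (\<nu> x))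
      (traction lam \<mu> (\<nu> x) J) = 0)
        (graph_point p \<phi> h y) (vertical_limit (\<lambda>x. (U x, jacobian U x)) y)) \<longleftrightarrow>
    (AE y in lebesgue_on B. (\<lambda>x (\<delta>, c). \<delta> = 0 \<and> ccross (cvec (\<nu> x)) c = 0)
        (graph_point p \<phi> h y) (vertical_limit (\<lambda>x. (divergence U x, curl (curl U) x)) y))"
    (is "(AE y in lebesgue_on B. ?P1 y) \<longleftrightarrow> (AE y in lebesgue_on B. ?P2 y)")
proof -
  let ?n = "\<lambda>y. \<nu> (graph_point p \<phi> h y)"
  define u where "u = vertical_limit U"
  define J where "J = vertical_limit (jacobian U)"
  define \<delta> where "\<delta> = vertical_limit (divergence U)"
  define c where "c = vertical_limit (curl (curl U))"
  define g where "g = gradient_limit (divergence U)"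
  have rJ: "regular (jacobian U)" and rd: "regular (divergence U)" and rc: "regular (curl (curl U))"
    using regular_jacobian[OF U(2)] regular_divergence[OF U(2)] regular_curl_curl[OF C2 U(3)] .
  have rg: "regular (pd i (divergence U))" for i
    unfolding pd_def by (rule regular_dir_deriv_divergence[OF C2]) (use U(3) in \<open>simp only: pd_def\<close>)
  have trJ: "AE y in lebesgue_on B. \<delta> y = trace (J y)"
    using AE_vertical_limit_linear[OF bounded_linear_trace rJ] unfolding \<delta>_def J_def
        divergence_def[abs_def] .
  \<comment> \<open>The equation holds at every point of every level, so it survives in the
    limit.\<close>
  have eq: "AE y in lebesgue_on B. (lam + 2 * \<mu>) *\<^sub>R g y + (- \<mu>) *\<^sub>R c y + (\<omega>\<^sup>2) *\<^sub>R u y = 0"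
  proof -
    have "AE y in lebesgue_on B. \<forall>i\<in>UNIV. (\<lambda>n. pd i (divergence U) (lift y (heights n))) \<longlonglongrightarrow>
        vertical_limit (pd i (divergence U)) y"
      by (rule AE_finite_allI[OF finite], rule AE_vertical_limit_tendsto) (use rg in \<open>simp only:
          regular_def\<close>)
    moreover have "AE y in lebesgue_on B. (\<lambda>n. U (lift y (heights n))) \<longlonglongrightarrow> u y"
      unfolding u_def by (rule AE_vertical_limit_tendsto) (use U(1) in \<open>simp only: regular_def\<close>)
    moreover have "AE y in lebesgue_on B. (\<lambda>n. curl (curl U) (lift y (heights n))) \<longlonglongrightarrow> c y"
      unfolding c_def by (rule AE_vertical_limit_tendsto) (use rc in \<open>simp only: regular_def\<close>)
    ultimately show ?thesis using AE_space
    proof eventually_elim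
      case (elim y)
      then have y: "y \<in> B" by simp
      have "(\<lambda>n. gradient (divergence U) (lift y (heights n))) \<longlonglongrightarrow> g y"
        unfolding g_def gradient_limit_def gradient_def by (intro vec_tendstoI) (use elim(1) in simp)
      then have "(\<lambda>n. (lam + 2 * \<mu>) *\<^sub>R gradient (divergence U) (lift y (heights n)) + (- \<mu>) *\<^sub>R
          curl (curl U) (lift y (heights n))
          + (\<omega>\<^sup>2) *\<^sub>R U (lift y (heights n))) \<longlonglongrightarrow> (lam + 2 * \<mu>) *\<^sub>R g y + (- \<mu>) *\<^sub>R c y + (\<omega>\<^sup>2) *\<^sub>R u y"
        by (intro tendsto_add tendsto_scaleR tendsto_const elim)
      moreover have "(lam + 2 * \<mu>) *\<^sub>R gradient (divergence U) (lift y (heights n)) + (- \<mu>) *\<^sub>R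
          curl (curl U) (lift y (heights n))
          + (\<omega>\<^sup>2) *\<^sub>R U (lift y (heights n)) = 0" for n
      proof -
        have "lift y (heights n) \<in> exterior" using lift_heights_in_region[OF y] region_subset(1) by
            blast
        from pde[OF this] lame_operator_eq[OF open_exterior C2 this, of lam \<mu>] show ?thesis by simp
      qed
      ultimately show ?case by (simp add: LIMSEQ_const_iff)
    qed
  qed
  have cross_eq: "AE y in lebesgue_on B. (lam + 2 * \<mu>) *\<^sub>R ccross (cvec (?n y)) (g y)
      + (- \<mu>) *\<^sub>R ccross (cvec (?n y)) (c y) + (\<omega>\<^sup>2) *\<^sub>R ccross (cvec (?n y)) (u y) = 0"
    using eq
  proof eventually_elim
    case (elim y)
    have "ccross (cvec (?n y)) ((lam + 2 * \<mu>) *\<^sub>R g y + (- \<mu>) *\<^sub>R c y + (\<omega>\<^sup>2) *\<^sub>R u y) = 0"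
      unfolding elim by (simp add: ccross_def vec_eq_iff forall_3)
    then show ?case by (simp only: ccross_add ccross_scaleR)
  qed
  have grad: "AE y in lebesgue_on B. ccross (cvec (?n y)) (g y) = 0"
    if "AE y in lebesgue_on B. \<delta> y = 0"
    unfolding g_def by (rule AE_gradient_limit_tangential[OF rd rg]) (use that in \<open>simp only: \<delta>_def\<close>)
  have trac: "AE y in lebesgue_on B. cdot (cvec (?n y)) (traction lam \<mu> (?n y) (J y)) = of_real
      (lam + 2 * \<mu>) * \<delta> y"
    if "AE y in lebesgue_on B. ccross (cvec (?n y)) (u y) = 0"
  proof -
    have "AE y in lebesgue_on B. trace (J y) = cdot (cvec (?n y)) (J y *v cvec (?n y))"
      unfolding J_def by (rule AE_trace_eq_normal_component[OF U(1,2)]) (use that in \<open>simp only: u_def\<close>)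
    then show ?thesis using trJ AE_space
    proof eventually_elim
      case (elim y)
      then have "norm (?n y) = 1" using norm_normal[of y] B_subset by (auto simp: lift_0)
      from cdot_traction[OF this, of lam \<mu> "J y"] show ?case
        using elim by (simp add: algebra_simps)
    qed
  qed
  have P1: "AE y in lebesgue_on B. vertical_limit (\<lambda>x. (U x, jacobian U x)) y = (u y, J y)"
    unfolding u_def J_def by (rule AE_vertical_limit_Pair[OF U(1) rJ])
  have P2: "AE y in lebesgue_on B. vertical_limit (\<lambda>x. (divergence U x, curl (curl U) x)) y = (\<delta> y,
      c y)"
    unfolding \<delta>_def c_def by (rule AE_vertical_limit_Pair[OF rd rc])
  have "(AE y in lebesgue_on B. ccross (cvec (?n y)) (u y) = 0 \<and> cdot (cvec (?n y)) (traction lam \<mu>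
      (?n y) (J y)) = 0)
    \<longleftrightarrow> (AE y in lebesgue_on B. \<delta> y = 0 \<and> ccross (cvec (?n y)) (c y) = 0)" (is "?L \<longleftrightarrow> ?R")
  proof
    assume L: ?L
    then have u0: "AE y in lebesgue_on B. ccross (cvec (?n y)) (u y) = 0" by eventually_elim simp
    have \<delta>0: "AE y in lebesgue_on B. \<delta> y = 0"
      using L trac[OF u0]
    proof eventually_elim
      case (elim y)
      have "complex_of_real (lam + 2 * \<mu>) \<noteq> 0" using const by (simp only: of_real_eq_0_iff)
      then show ?case using elim by simp
    qed
    show ?R
      using cross_eq grad[OF \<delta>0] u0 \<delta>0 by eventually_elim (use const in simp)
  next
    assume R: ?R
    then have \<delta>0: "AE y in lebesgue_on B. \<delta> y = 0" by eventually_elim simp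
    \<comment> \<open>Here the equation comes first, with \<open>\<omega> > 0\<close> to divide by,
      because the traction identity presupposes that the tangential part of \<open>u\<close>
      vanishes.\<close>
    have u0: "AE y in lebesgue_on B. ccross (cvec (?n y)) (u y) = 0"
      using cross_eq grad[OF \<delta>0] R by eventually_elim (use const in simp)
    show ?L
      using trac[OF u0] u0 \<delta>0 by eventually_elim simp
  qed
  moreover have "(AE y in lebesgue_on B. ?P1 y) \<longleftrightarrow> ?L"
  proof
    assume "AE y in lebesgue_on B. ?P1 y"
    with P1 show ?L by eventually_elim simp
  next
    assume ?L
    with P1 show "AE y in lebesgue_on B. ?P1 y" by eventually_elim simp
  qed
  moreover have "(AE y in lebesgue_on B. ?P2 y) \<longleftrightarrow> ?R"
  proof
    assume "AE y in lebesgue_on B. ?P2 y"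
    with P2 show ?R by eventually_elim simp
  next
    assume ?R
    with P2 show "AE y in lebesgue_on B. ?P2 y" by eventually_elim simp
  qed
  ultimately show ?thesis by (simp only:)
qed

text \<open>The common shape of both implications. The given trace of \<open>f1\<close> is its
  vertical limit by uniqueness, \<open>imp\<close> passes to \<open>f2\<close>, and the vertical
  limit of \<open>f2\<close> is a trace in the smaller chart with radius \<open>r'\<close> and
  half-height \<open>\<sigma>\<close>. That chart is admissible since charts are quantified
  existentially.\<close>

lemma transfer_trace:
  fixes f1 :: "real^3 \<Rightarrow> 'b::euclidean_space" and f2 :: "real^3 \<Rightarrow> 'c::euclidean_space"
  assumes f1: "regular f1" and f2: "regular f2" and C21: "Ck1_on 2 (ball 0 r) h"
    and tr: "has_graph_trace p \<phi> r s h f1 g"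
    and P1: "AE y in lebesgue_on (ball 0 r). P1 (graph_point p \<phi> h y) (g y)"
    and imp: "(AE y in lebesgue_on B. P1 (graph_point p \<phi> h y) (vertical_limit f1 y)) \<Longrightarrow>
      (AE y in lebesgue_on B. P2 (graph_point p \<phi> h y) (vertical_limit f2 y))"
  shows "\<exists>\<phi> r s h g. graph_chart D p \<phi> r s h \<and> Ck1_on 2 (ball 0 r) h \<and>
        graph_point p \<phi> h ` ball 0 r \<subseteq> \<Gamma> \<and> has_graph_trace p \<phi> r s h f2 g \<and>
        (AE y in lebesgue_on (ball 0 r). P2 (graph_point p \<phi> h y) (g y))"
proof (intro exI conjI)
  have f: "H1_classical region f1" "H1_classical region f2" "Ck_on 1 exterior f2"
    using f1 f2 by (auto simp only: regular_def)
  have hB: "\<bar>h y\<bar> < \<sigma>" if "y \<in> B" for y using h_less[of y] that by auto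
  show "graph_chart D p \<phi> r' \<sigma> h"
    unfolding graph_chart_def
  proof (intro conjI ballI allI)
    show "h 0 = 0" using chart by (simp add: graph_chart_def)
    show "(p + \<phi> (y, t) \<in> D) = (t < h y)" if "y \<in> B" "t \<in> {-\<sigma><..<\<sigma>}" for y t
    proof -
      have "y \<in> ball 0 r" "t \<in> {-s<..<s}" using that \<sigma> r' by auto
      then show ?thesis using chart unfolding graph_chart_def by blast
    qed
  qed (use linear_\<phi> norm_\<phi> r' \<sigma> hB in auto)
  show "Ck1_on 2 B h" by (rule Ck1_on_subset[OF C21 B_subset(1)])
  show "graph_point p \<phi> h ` B \<subseteq> \<Gamma>" using graph B_subset(1) by blast
  show "has_graph_trace p \<phi> r' \<sigma> h f2 (vertical_limit f2)"
    by (rule has_graph_trace_vertical_limit[OF f(2,3)])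
  have "AE y in lebesgue_on B. P1 (graph_point p \<phi> h y) (g y)"
  proof -
    have "AE y in lebesgue. y \<in> ball 0 r \<longrightarrow> P1 (graph_point p \<phi> h y) (g y)"
      using P1 by (subst (asm) AE_restrict_space_iff) auto
    then have "AE y in lebesgue. y \<in> B \<longrightarrow> P1 (graph_point p \<phi> h y) (g y)"
      by eventually_elim (use B_subset(1) in blast)
    then show ?thesis by (subst AE_restrict_space_iff) auto
  qed
  with trace_eq_vertical_limit[OF f(1) tr]
  have "AE y in lebesgue_on B. P1 (graph_point p \<phi> h y) (vertical_limit f1 y)"
    by eventually_elim simp
  then show "AE y in lebesgue_on B. P2 (graph_point p \<phi> h y) (vertical_limit f2 y)" by (rule imp)
qed

end

text \<open>Shrinking is possible because \<open>h\<close> is continuous with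
  \<open>h 0 = 0\<close>, so that it stays below any prescribed \<open>\<sigma>\<close> near the
  centre.\<close>

lemma minimal_boundary_chart_exists:
  assumes chart: "graph_chart D p \<phi> r s h" and C21: "Ck1_on 2 (ball 0 r) h"
    and graph: "graph_point p \<phi> h ` ball 0 r \<subseteq> \<Gamma>" and frontier: "\<Gamma> \<subseteq> frontier D"
    and normal: "\<And>x. x \<in> \<Gamma> \<Longrightarrow> outward_unit_normal D x (\<nu> x)"
    and curvature: "\<And>x. x \<in> \<Gamma> \<Longrightarrow> has_mean_curvature \<Gamma> \<nu> x 0"
    and \<rho>: "\<rho> > 0"
  shows "\<exists>r' \<sigma>. minimal_boundary_chart D p \<phi> r s h r' \<sigma> \<Gamma> \<nu> \<and> above_graph p \<phi> r' (3 * \<sigma>) h \<subseteq> ball p \<rho>"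
proof -
  have rs: "0 < r" "0 < s" "h 0 = 0" "linear \<phi>" "\<And>z. norm (\<phi> z) = norm z"
    using chart unfolding graph_chart_def by blast+
  have C2: "Ck_on 2 (ball 0 r) h" by (rule Ck1_on_imp_Ck_on[OF C21])
  have C1: "Ck_on 1 (ball 0 r) h" by (rule Ck_on_mono[OF C2]) simp
  \<comment> \<open>The divisor 8 keeps \<open>3 * \<sigma>\<close> below both \<open>s\<close> and
    \<open>\<rho> / 2\<close>; with \<open>r' \<le> \<rho> / 2\<close> the region then fits into the
    ball of radius \<open>\<rho>\<close>, on whose exterior part \<open>U\<close> is H3.\<close>
  define \<sigma> where "\<sigma> = min s \<rho> / 8"
  have \<sigma>: "0 < \<sigma>" "3 * \<sigma> < s" "3 * \<sigma> < \<rho> / 2" using rs \<rho> by (auto simp: \<sigma>_def)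
  have "isCont h 0"
    using Ck_on_imp_continuous_on[OF C1] rs by (simp add: continuous_on_eq_continuous_at)
  then obtain d where d: "d > 0" "\<And>y. dist y 0 < d \<Longrightarrow> dist (h y) (h 0) < \<sigma>"
    using \<sigma>(1) unfolding continuous_at_eps_delta by blast
  define r' where "r' = min (min r d) \<rho> / 2"
  have r': "0 < r'" "r' < r" "r' < d" "r' \<le> \<rho> / 2" using rs d \<rho> by (auto simp: r'_def)
  have "\<bar>h y\<bar> < \<sigma>" if "y \<in> cball 0 r'" for y
    using d(2)[of y] that r' rs(3) by (auto simp: dist_norm)
  note hy = this
  have "minimal_boundary_chart D p \<phi> r s h r' \<sigma> \<Gamma> \<nu>"
    by unfold_locales
      (fact chart C1 r'(1,2) \<sigma>(1,2) C2 graph frontier | (rule hy normal curvature, assumption))+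
  moreover have "above_graph p \<phi> r' (3 * \<sigma>) h \<subseteq> ball p \<rho>"
  proof
    fix x assume "x \<in> above_graph p \<phi> r' (3 * \<sigma>) h"
    then obtain y t where x: "x = p + \<phi> (y, t)" "y \<in> ball 0 r'" "h y < t" "t < 3 * \<sigma>"
      unfolding above_graph_def by blast
    have "\<bar>t\<bar> \<le> 3 * \<sigma>" using x hy[of y] \<sigma> by auto
    moreover have "norm (\<phi> (y, t)) \<le> norm y + \<bar>t\<bar>"
      unfolding rs(5) by (simp add: norm_Pair sqrt_sum_squares_le_sum_abs[of "norm y" t, simplified])
    ultimately have "norm (\<phi> (y, t)) < \<rho>" using x(2) r' \<sigma> by simp
    then show "x \<in> ball p \<rho>" unfolding x(1) by (simp add: dist_norm)
  qed
  ultimately show ?thesis by blast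
qed

theorem theorem2p1:
  fixes lam \<mu> \<omega> :: real
    and D \<Gamma> :: "(real^3) set"
    and \<nu> :: "real^3 \<Rightarrow> real^3" and d d' :: "real^3"
    and \<alpha>p \<alpha>s :: complex
    and U :: "real^3 \<Rightarrow> complex^3"
  assumes "\<mu> > 0" and "3 * lam + 2 * \<mu> > 0" and "\<omega> > 0"
    and "scatterer D"
    and "regular_piece D \<Gamma>"
    and "\<And>x. x \<in> \<Gamma> \<Longrightarrow> outward_unit_normal D x (\<nu> x)"
    and "\<And>x. x \<in> \<Gamma> \<Longrightarrow> has_mean_curvature \<Gamma> \<nu> x 0"
    and "norm d = 1" and "norm d' = 1" and "d \<bullet> d' = 0"
    and "scattering_solution lam \<mu> \<omega> D (incident_wave lam \<mu> \<omega> \<alpha>p \<alpha>s d d') U"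
    and "locally_H3_near D \<Gamma> U"
  shows "fourth_kind_condition lam \<mu> D \<Gamma> \<nu> U \<longleftrightarrow>
     trace_satisfies D \<Gamma> (\<lambda>x. (divergence U x, curl (curl U) x))
       (\<lambda>x (\<delta>, c). \<delta> = 0 \<and> ccross (cvec (\<nu> x)) c = 0)"
proof -
  let ?f1 = "\<lambda>x. (U x, jacobian U x)" and ?f2 = "\<lambda>x. (divergence U x, curl (curl U) x)"
  let ?P1 = "\<lambda>x (u, J). ccross (cvec (\<nu> x)) u = 0 \<and> cdot (cvec (\<nu> x)) (traction lam \<mu> (\<nu> x) J) = 0"
    and ?P2 = "\<lambda>x (\<delta>, c). \<delta> = 0 \<and> ccross (cvec (\<nu> x)) c = 0"
  let ?Q = "\<lambda>p f P. \<exists>\<phi> r s h g. graph_chart D p \<phi> r s h \<and> Ck1_on 2 (ball 0 r) h \<and>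
        graph_point p \<phi> h ` ball 0 r \<subseteq> \<Gamma> \<and> has_graph_trace p \<phi> r s h f g \<and>
        (AE y in lebesgue_on (ball 0 r). P (graph_point p \<phi> h y) (g y))"
  have frontier: "\<Gamma> \<subseteq> frontier D"
    using assms(5) openin_imp_subset unfolding regular_piece_def by blast
  have C: "Ck_on k (- closure D) U" for k
    using assms(11) unfolding scattering_solution_def smooth_on_def by blast
  have pde: "lame_operator lam \<mu> U x + (\<omega>\<^sup>2) *\<^sub>R U x = 0" if "x \<in> - closure D" for x
    using assms(11) that unfolding scattering_solution_def by blast
  \<comment> \<open>Three times this sum is
    \<open>(3 * lam + 2 * \<mu>) + 4 * \<mu>\<close>.\<close>
  have lam: "lam + 2 * \<mu> > 0" using assms(1,2) by linarith
  \<comment> \<open>Each side may choose its own chart at \<open>p\<close>, so the chart of the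
    assumed side is shrunk to obtain one for the other.\<close>
  have "?Q p ?f1 ?P1 \<longleftrightarrow> ?Q p ?f2 ?P2" if p: "p \<in> \<Gamma>" for p
  proof -
    obtain \<rho> where \<rho>: "\<rho> > 0" "Hk_on 3 (ball p \<rho> - closure D) U"
      using assms(12) p unfolding locally_H3_near_def by blast
    show ?thesis
    proof
      assume "?Q p ?f1 ?P1"
      then obtain \<phi> r s h g where c: "graph_chart D p \<phi> r s h" "Ck1_on 2 (ball 0 r) h"
        "graph_point p \<phi> h ` ball 0 r \<subseteq> \<Gamma>" "has_graph_trace p \<phi> r s h ?f1 g"
        "AE y in lebesgue_on (ball 0 r). ?P1 (graph_point p \<phi> h y) (g y)" by (elim exE conjE)
      have "\<exists>r' \<sigma>. minimal_boundary_chart D p \<phi> r s h r' \<sigma> \<Gamma> \<nu> \<and> above_graph p \<phi> r' (3 * \<sigma>) h \<subseteq>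
          ball p \<rho>"
        by (rule minimal_boundary_chart_exists[OF c(1-3) frontier _ _ \<rho>(1)]) (erule assms(6), erule
            assms(7))
      then obtain r' \<sigma> where m: "minimal_boundary_chart D p \<phi> r s h r' \<sigma> \<Gamma> \<nu>"
        and sub: "above_graph p \<phi> r' (3 * \<sigma>) h \<subseteq> ball p \<rho>"
        by (elim exE conjE)
      interpret minimal_boundary_chart D p \<phi> r s h r' \<sigma> \<Gamma> \<nu> by (rule m)
      note reg = regular_derivatives[OF C \<rho>(2) sub[folded region_def]]
      show "?Q p ?f2 ?P2"
        by (rule transfer_trace[OF regular_Pair[OF reg(1) regular_jacobian[OF reg(2)]]
              regular_Pair[OF regular_divergence[OF reg(2)] regular_curl_curl[OF C reg(3)]] c(2,4,5)])
          (rule iffD1[OF vertical_limit_equivalence[OF assms(1) lam assms(3) C reg pde]])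
    next
      assume "?Q p ?f2 ?P2"
      then obtain \<phi> r s h g where c: "graph_chart D p \<phi> r s h" "Ck1_on 2 (ball 0 r) h"
        "graph_point p \<phi> h ` ball 0 r \<subseteq> \<Gamma>" "has_graph_trace p \<phi> r s h ?f2 g"
        "AE y in lebesgue_on (ball 0 r). ?P2 (graph_point p \<phi> h y) (g y)" by (elim exE conjE)
      have "\<exists>r' \<sigma>. minimal_boundary_chart D p \<phi> r s h r' \<sigma> \<Gamma> \<nu> \<and> above_graph p \<phi> r' (3 * \<sigma>) h \<subseteq>
          ball p \<rho>"
        by (rule minimal_boundary_chart_exists[OF c(1-3) frontier _ _ \<rho>(1)]) (erule assms(6), erule
            assms(7))
      then obtain r' \<sigma> where m: "minimal_boundary_chart D p \<phi> r s h r' \<sigma> \<Gamma> \<nu>"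
        and sub: "above_graph p \<phi> r' (3 * \<sigma>) h \<subseteq> ball p \<rho>"
        by (elim exE conjE)
      interpret minimal_boundary_chart D p \<phi> r s h r' \<sigma> \<Gamma> \<nu> by (rule m)
      note reg = regular_derivatives[OF C \<rho>(2) sub[folded region_def]]
      show "?Q p ?f1 ?P1"
        by (rule transfer_trace[OF regular_Pair[OF regular_divergence[OF reg(2)]
            regular_curl_curl[OF C reg(3)]]
              regular_Pair[OF reg(1) regular_jacobian[OF reg(2)]] c(2,4,5)])
          (rule iffD2[OF vertical_limit_equivalence[OF assms(1) lam assms(3) C reg pde]])
    qed
  qed
  then show ?thesis unfolding fourth_kind_condition_def trace_satisfies_def by (rule ball_cong[OF refl])
qed

end
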